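(* Let $\mathcal{R}$ be a finite index set and let $$\mathcal{G}=\{\, i a_k^\dagger a_k : 1\le k\le n\,\}\cup\{\, g_{\sigma_p}^{\gamma_p} : p\in\mathcal{R}\,\}\subseteq \hat A_n ,$$ where each $g_{\sigma_p}^{\gamma_p}$ ($\sigma_p\in\{+,-\}$, $\gamma_p=(\alpha^{(p)},\beta^{(p)})\in\mathbb{N}_0^{2n}$) is a basis element of $\hat A_n$ that does not lie in $\hat A_n^1$. Let $\mathfrak{g}$ be the real Lie subalgebra of $\hat A_n$ generated by $\mathcal{G}$ (the smallest real subspace containing $\mathcal G$ and closed under commutators). For $K\in\{0,1,2,=,\mathrm{om},\perp\}$ write $\mathcal{G}^K=\mathcal{G}\cap\hat A_n^K$, and let $\mathfrak{c}_{\mathcal G}$ be the set of all elements of $\mathcal{G}$ that commute with every element of $\mathcal{G}$. Then $\mathfrak{g}$ is finite-dimensional if and only if all of the following hold: (i) $\mathcal{G}^\perp=\emptyset$; (ii) $\mathcal{G}^{=}\subseteq\mathfrak{c}_{\mathcal G}$; (iii) $[x,y]\in\hat A_n^{\mathrm{om}}$ for all $x\in\mathcal G^2$ and $y\in\mathcal G^{\mathrm{om}}$; (iv) for all $x,y\in\mathcal G^{\mathrm{om}}$, the orthogonal projection of $[x,y]$ onto $\hat A_n^\perp$ is zero.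
   Context: Fix $n\ge 1$. The Weyl algebra $A_n$ is the unital associative $\mathbb{C}$-algebra generated by $a_1,\dots,a_n,a_1^\dagger,\dots,a_n^\dagger$ subject to $[a_i,a_j^\dagger]=\delta_{ij}$ and $[a_i,a_j]=[a_i^\dagger,a_j^\dagger]=0$, where $[x,y]=xy-yx$. $\mathbb N_0$ denotes the nonnegative integers. For $\gamma=(\alpha,\beta)\in\mathbb N_0^{2n}$ ($\alpha,\beta\in\mathbb N_0^n$) set $a^{\gamma}=(a_1^\dagger)^{\alpha_1}\cdots(a_n^\dagger)^{\alpha_n}a_1^{\beta_1}\cdots a_n^{\beta_n}$ (normal-ordered monomials); these form a $\mathbb C$-basis of $A_n$. Put $|\gamma|=\sum_j\alpha_j+\sum_j\beta_j$. The adjoint $\dagger$ is the conjugate-linear anti-automorphism of $A_n$ with $(a_j)^\dagger=a_j^\dagger$, $(a_j^\dagger)^\dagger=a_j$, $1^\dagger=1$; so $(a^{(\alpha,\beta)})^\dagger=a^{(\beta,\alpha)}$. The skew-hermitian Weyl algebra is $\hat A_n=\{g\in A_n: g^\dagger=-g\}$, a real Lie algebra under the commutator. For a monomial $m$ let $g_+(m)=i(m^\dagger+m)$ and $g_-(m)=m^\dagger-m$, and for $\gamma\in\mathbb N_0^{2n}$ let $g_\pm^\gamma=g_\pm(a^\gamma)$. On $\mathbb N_0^n$ use the lexicographic order ($\alpha>\beta$ iff $\alpha_k>\beta_k$ for the least $k$ with $\alpha_k\ne\beta_k$). A basis element is an element $g_+^{(\alpha,\beta)}$ with $\alpha\ge\beta$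 or $g_-^{(\alpha,\beta)}$ with $\alpha>\beta$; the basis elements form an $\mathbb R$-basis of $\hat A_n$, and $\hat A_n$ carries the inner product for which the basis elements are mutually orthogonal and nonzero; orthogonal projections are taken with respect to it. Subspaces of $\hat A_n$ (real spans of basis elements $g_\sigma^{\gamma}$, $\gamma=(\alpha,\beta)$): $\hat A_n^0$ is spanned by $2i$ and $2ia_k^\dagger a_k$ ($1\le k\le n$), i.e. the basis elements with $\alpha=\beta$, $|\gamma|\in\{0,2\}$; $\hat A_n^1$ by basis elements with $|\gamma|=1$; $\hat A_n^2$ by basis elements with $|\gamma|=2$ and $\alpha\ne\beta$; $\hat A_n^=$ by basis elements with $\alpha=\beta$ and $|\gamma|\ge 4$; $\hat A_n^{\mathrm{om}}$ by basis elements with $|\gamma|\ge3$ for which there is a unique index $k$ with $\alpha_k+\beta_k=1$ and $\alpha_j=\beta_j$ for all $j\neq k$; $\hat A_n^\perp$ by all remaining basis elements. Thus $\hat A_n$ is the orthogonal direct sum of these six subspaces. *)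

theory Defs
  imports Complex_Main
begin

text \<open>A normal-ordered monomial a^(alpha,beta) is encoded by the pair (alpha, beta) of
  exponent functions nat => nat (modes are indexed 0..n-1; exponents vanish for k >= n).
  An element of A_n is its coefficient function on monomials (finitely supported).\<close>

type_synonym mon = "(nat \<Rightarrow> nat) \<times> (nat \<Rightarrow> nat)"
type_synonym welem = "mon \<Rightarrow> complex"

definition valid_mon :: "nat \<Rightarrow> mon \<Rightarrow> bool" where
  "valid_mon n m \<longleftrightarrow> (\<forall>k\<ge>n. fst m k = 0 \<and> snd m k = 0)"

definition wsupp :: "welem \<Rightarrow> mon set" where
  "wsupp f = {m. f m \<noteq> 0}"

definition in_weyl :: "nat \<Rightarrow> welem \<Rightarrow> bool" where
  "in_weyl n f \<longleftrightarrow> finite (wsupp f) \<and> (\<forall>m\<in>wsupp f. valid_mon n m)"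

text \<open>Normal ordering: a_k^b (a_k^dagger)^c = sum_j C(b,j) C(c,j) j! (a_k^dagger)^(c-j) a_k^(b-j),
  different modes commute. Hence a^(al,be) a^(al',be') =
  sum_{j <= min(be,al')} prod_k C(be_k,j_k) C(al'_k,j_k) j_k! a^(al+al'-j, be+be'-j).
  wcoef n m1 m2 m is the coefficient of a^m in the product a^m1 a^m2.\<close>

definition wcoef :: "nat \<Rightarrow> mon \<Rightarrow> mon \<Rightarrow> mon \<Rightarrow> complex" where
  "wcoef n m1 m2 m =
     (let al = fst m1; be = snd m1; al' = fst m2; be' = snd m2; ga = fst m; de = snd m;
          j = (\<lambda>k. al k + al' k - ga k)
      in if (\<forall>k. ga k \<le> al k + al' k \<and> j k \<le> be k \<and> j k \<le> al' k \<and> de k + j k = be k + be' k)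
         then of_nat (\<Prod>k<n. (be k choose j k) * (al' k choose j k) * fact (j k))
         else 0)"

definition wmul :: "nat \<Rightarrow> welem \<Rightarrow> welem \<Rightarrow> welem" where
  "wmul n f g = (\<lambda>m. \<Sum>m1\<in>wsupp f. \<Sum>m2\<in>wsupp g. f m1 * g m2 * wcoef n m1 m2 m)"

definition wbr :: "nat \<Rightarrow> welem \<Rightarrow> welem \<Rightarrow> welem" where
  "wbr n x y = (\<lambda>m. wmul n x y m - wmul n y x m)"

definition mono :: "mon \<Rightarrow> welem" where
  "mono m0 = (\<lambda>m. if m = m0 then 1 else 0)"

definition swapm :: "mon \<Rightarrow> mon" where
  "swapm m = (snd m, fst m)"

definition wdag :: "welem \<Rightarrow> welem" where
  "wdag f = (\<lambda>m. cnj (f (swapm m)))"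

definition Ahat :: "nat \<Rightarrow> welem set" where
  "Ahat n = {f. in_weyl n f \<and> wdag f = (\<lambda>m. - f m)}"

definition gplus :: "mon \<Rightarrow> welem" where
  "gplus m0 = (\<lambda>m. \<i> * (wdag (mono m0) m + mono m0 m))"

definition gminus :: "mon \<Rightarrow> welem" where
  "gminus m0 = (\<lambda>m. wdag (mono m0) m - mono m0 m)"

definition gsig :: "bool \<Rightarrow> mon \<Rightarrow> welem" where
  "gsig s m0 = (if s then gplus m0 else gminus m0)"

definition lex_gt :: "nat \<Rightarrow> (nat \<Rightarrow> nat) \<Rightarrow> (nat \<Rightarrow> nat) \<Rightarrow> bool" where
  "lex_gt n al be \<longleftrightarrow> (\<exists>k<n. al k > be k \<and> (\<forall>j<k. al j = be j))"

definition is_basis_gamma :: "nat \<Rightarrow> bool \<Rightarrow> mon \<Rightarrow> bool" where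
  "is_basis_gamma n s m \<longleftrightarrow> valid_mon n m \<and>
     (if s then (lex_gt n (fst m) (snd m) \<or> fst m = snd m) else lex_gt n (fst m) (snd m))"

definition basis_elem :: "nat \<Rightarrow> welem \<Rightarrow> bool" where
  "basis_elem n x \<longleftrightarrow> (\<exists>s m. is_basis_gamma n s m \<and> x = gsig s m)"

definition mdeg :: "nat \<Rightarrow> mon \<Rightarrow> nat" where
  "mdeg n m = (\<Sum>k<n. fst m k + snd m k)"

datatype cls = C0 | C1 | C2 | Ceq | Com | Cperp

definition is_om :: "nat \<Rightarrow> mon \<Rightarrow> bool" where
  "is_om n m \<longleftrightarrow> mdeg n m \<ge> 3 \<and>
     (\<exists>!k. k < n \<and> fst m k + snd m k = 1 \<and> (\<forall>j<n. j \<noteq> k \<longrightarrow> fst m j = snd m j))"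

definition mclass :: "nat \<Rightarrow> mon \<Rightarrow> cls" where
  "mclass n m =
    (if fst m = snd m \<and> mdeg n m \<in> {0, 2} then C0
     else if mdeg n m = 1 then C1
     else if mdeg n m = 2 \<and> fst m \<noteq> snd m then C2
     else if fst m = snd m \<and> mdeg n m \<ge> 4 then Ceq
     else if is_om n m then Com
     else Cperp)"

definition rspan :: "welem set \<Rightarrow> welem set" where
  "rspan S = {x. \<exists>F c. finite F \<and> F \<subseteq> S \<and>
                 x = (\<lambda>m. \<Sum>b\<in>F. complex_of_real (c b) * b m)}"

definition Asub :: "nat \<Rightarrow> cls \<Rightarrow> welem set" where
  "Asub n K = rspan {x. \<exists>s m. is_basis_gamma n s m \<and> mclass n m = K \<and> x = gsig s m}"

text \<open>Orthogonal projection onto hat A_n^K.  Every class is invariant under swapping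
  (al,be) <-> (be,al), and g_+^(al,be), g_-^(al,be) only involve the monomials a^(al,be),
  a^(be,al); hence for the orthogonal decomposition along the basis elements, projecting onto
  hat A_n^K amounts to keeping exactly the coefficients of the monomials of class K.\<close>
definition wproj :: "nat \<Rightarrow> cls \<Rightarrow> welem \<Rightarrow> welem" where
  "wproj n K x = (\<lambda>m. if mclass n m = K then x m else 0)"

definition real_subspace :: "welem set \<Rightarrow> bool" where
  "real_subspace S \<longleftrightarrow> (\<lambda>m. 0) \<in> S \<and> (\<forall>x\<in>S. \<forall>y\<in>S. (\<lambda>m. x m + y m) \<in> S) \<and>
     (\<forall>x\<in>S. \<forall>c::real. (\<lambda>m. complex_of_real c * x m) \<in> S)"

definition lie_gen :: "nat \<Rightarrow> welem set \<Rightarrow> welem set" where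
  "lie_gen n G = \<Inter>{S. G \<subseteq> S \<and> real_subspace S \<and> (\<forall>x\<in>S. \<forall>y\<in>S. wbr n x y \<in> S)}"

definition fin_dim :: "welem set \<Rightarrow> bool" where
  "fin_dim S \<longleftrightarrow> (\<exists>B. finite B \<and> S \<subseteq> rspan B)"

definition unit_vec :: "nat \<Rightarrow> nat \<Rightarrow> nat" where
  "unit_vec k = (\<lambda>j. if j = k then 1 else 0)"

definition inum :: "nat \<Rightarrow> welem" where
  "inum k = (\<lambda>m. \<i> * mono (unit_vec k, unit_vec k) m)"

definition centr :: "nat \<Rightarrow> welem set \<Rightarrow> welem set" where
  "centr n G = {x\<in>G. \<forall>y\<in>G. wbr n x y = (\<lambda>m. 0)}"

end

theory Submission
  imports Defs "HOL-Library.Function_Algebras" "HOL-Library.FuncSet"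
begin

text \<open>Say that a generator clashes with a diagonal or \<open>om\<close> generator if it changes the occupation
  number of a mode on which the latter depends through the number operator. The four conditions hold
  iff no generator is of class \<open>perp\<close> and no two generators clash.

  If there is no such obstruction, all generators lie in the span of finitely many monomials that is
  closed under brackets: polynomials of degree at most two in the modes that some generator changes,
  with bounded coefficients in the other number operators.

  Conversely, let the Weyl algebra act on polynomials, with matrix entries indexed by occupation
  numbers. An obstruction yields a diagonal element \<open>H\<close>, either a generator or the bracket
  of \<open>g_+\<close> and \<open>g_-\<close> for the same monomial, and an element \<open>x\<close> on whose matrix entries \<open>ad H\<close>
  acts by the differences of the diagonal entries of \<open>H\<close>. These take infinitely many values, so the
  iterates of \<open>ad H\<close> on \<open>x\<close> span an infinite-dimensional space.\<close>

section \<open>Linear dependence\<close>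

text \<open>Following leading monomials through iterated brackets would require excluding
  cancellation at every step. Matrix entries avoid this: \<open>ad H\<close> multiplies each of them
  by a number. The number operators among the generators provide \<open>H\<close>. Bracketing with i
  a_k^dagger a_k turns g_+ of an off-diagonal monomial into a nonzero multiple of g_- and back, so
  both signs are available, and [g_+, g_-] = 2i(m d - d m), with d the adjoint of m, is diagonal.
  Class \<open>om\<close> is exceptional because a mode occurring to the first power contributes a
  a^dagger - a^dagger a = 1 to this commutator. The eigenvalue of \<open>H\<close> then does not
  depend on that mode, so \<open>H\<close> is harmless to the monomial it comes from and obstructs
  only through a clash. For class \<open>perp\<close> the monomial itself serves as
  \<open>x\<close>. Generators of degree one must be excluded: one of them could clash with an
  \<open>om\<close> generator, and conditions (iii) and (iv), which test only classes
  \<open>C2\<close> and \<open>Com\<close> against \<open>Com\<close>, would not detect it.\<close>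

lemma vector_space_welem:
  "vector_space (\<lambda>(c::real) (f::welem). (\<lambda>m. complex_of_real c * f m))"
  by unfold_locales (auto simp: fun_eq_iff algebra_simps)

text \<open>The dimension bound concerns sets, while the family \<open>v\<close> may repeat itself.
  A repetition is already a relation, with coefficients 1 and -1, so \<open>v\<close> may be taken
  injective.\<close>

lemma rspan_dependent:
  fixes v :: "nat \<Rightarrow> welem"
  assumes B: "finite B" and v: "\<And>r. v r \<in> rspan B"
  obtains c :: "nat \<Rightarrow> real" and i
  where "i \<le> card B" "c i \<noteq> 0" "\<forall>m. (\<Sum>r\<le>card B. complex_of_real (c r) * v r m) = 0"
proof (rule ccontr)
  note * = that
  assume "\<not> thesis"
  hence no: "c i = 0" if "i \<le> card B" "\<And>m. (\<Sum>r\<le>card B. complex_of_real (c r) * v r m) = 0" for c i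
    using * that by blast
  interpret V: vector_space "\<lambda>(c::real) (f::welem). (\<lambda>m. complex_of_real c * f m)"
    by (rule vector_space_welem)
  have sum_apply: "sum g S m = (\<Sum>x\<in>S. g x m)" if "finite S" for g :: "'z \<Rightarrow> welem" and S m
    using that by induction auto
  have inj: "inj_on v {..card B}"
  proof (rule inj_onI, rule ccontr)
    fix r s assume rs: "r \<in> {..card B}" "s \<in> {..card B}" "v r = v s" "r \<noteq> s"
    define c :: "nat \<Rightarrow> real" where "c = (\<lambda>k. if k = r then 1 else if k = s then -1 else 0)"
    have "(\<Sum>k\<le>card B. complex_of_real (c k) * v k m) = 0" for m
    proof -
      have "(\<Sum>k\<le>card B. complex_of_real (c k) * v k m) = (\<Sum>k\<in>{r,s}. complex_of_real (c k) * v k m)"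
        by (rule sum.mono_neutral_right) (use rs in \<open>auto simp: c_def\<close>)
      also have "\<dots> = 0" using rs by (auto simp: c_def)
      finally show ?thesis .
    qed
    from no[OF _ this, of r] rs show False by (auto simp: c_def)
  qed
  have ind: "V.independent (v ` {..card B})"
  proof
    assume "V.dependent (v ` {..card B})"
    then obtain u where u: "\<exists>x\<in>v ` {..card B}. u x \<noteq> 0"
      "(\<Sum>x\<in>v ` {..card B}. (\<lambda>m. complex_of_real (u x) * x m)) = 0"
      by (subst (asm) V.dependent_finite) auto
    have "(\<Sum>r\<le>card B. complex_of_real (u (v r)) * v r m) = 0" for m
      using fun_cong[OF u(2), of m] by (simp add: sum.reindex[OF inj] sum_apply)
    from no[OF _ this] u(1) show False by auto
  qed
  have "v ` {..card B} \<subseteq> V.span B"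
  proof
    fix x assume "x \<in> v ` {..card B}"
    then have "x \<in> rspan B" using v by auto
    then obtain F c where F: "finite F" "F \<subseteq> B" "x = (\<lambda>m. \<Sum>b\<in>F. complex_of_real (c b) * b m)"
      by (auto simp: rspan_def)
    have "x = (\<Sum>b\<in>F. (\<lambda>m. complex_of_real (c b) * b m))"
      using F by (auto simp: fun_eq_iff sum_apply)
    also have "\<dots> \<in> V.span B"
      using F(2) by (intro V.span_sum V.span_scale V.span_base) auto
    finally show "x \<in> V.span B" .
  qed
  from V.independent_span_bound[OF B ind this] show False
    by (simp add: card_image[OF inj])
qed

section \<open>Product and bracket\<close>

lemma wmul_superset:
  assumes "finite A" "wsupp f \<subseteq> A" "finite B" "wsupp g \<subseteq> B"
  shows "wmul n f g m = (\<Sum>m1\<in>A. \<Sum>m2\<in>B. f m1 * g m2 * wcoef n m1 m2 m)"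
proof -
  have "wmul n f g m = (\<Sum>m1\<in>wsupp f. \<Sum>m2\<in>B. f m1 * g m2 * wcoef n m1 m2 m)"
    unfolding wmul_def
    by (intro sum.cong sum.mono_neutral_left refl) (use assms in \<open>auto simp: wsupp_def\<close>)
  also have "\<dots> = (\<Sum>m1\<in>A. \<Sum>m2\<in>B. f m1 * g m2 * wcoef n m1 m2 m)"
    by (intro sum.mono_neutral_left) (use assms in \<open>auto simp: wsupp_def\<close>)
  finally show ?thesis .
qed

text \<open>The difference is studied as a whole because terms contracted only in modes where both
  monomials are balanced, in particular the uncontracted term, cancel in it.\<close>

definition bcoef :: "nat \<Rightarrow> mon \<Rightarrow> mon \<Rightarrow> mon \<Rightarrow> complex" where
  "bcoef n m1 m2 m = wcoef n m1 m2 m - wcoef n m2 m1 m"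

lemma wbr_superset:
  assumes "finite A" "wsupp f \<subseteq> A" "finite B" "wsupp g \<subseteq> B"
  shows "wbr n f g m = (\<Sum>m1\<in>A. \<Sum>m2\<in>B. f m1 * g m2 * bcoef n m1 m2 m)"
proof -
  have "wmul n g f m = (\<Sum>m1\<in>A. \<Sum>m2\<in>B. f m1 * g m2 * wcoef n m2 m1 m)"
    by (subst wmul_superset[OF assms(3,4,1,2)], subst sum.swap) (simp add: mult_ac)
  then show ?thesis
    by (simp add: wbr_def wmul_superset[OF assms] bcoef_def algebra_simps sum_subtractf)
qed

text \<open>Here \<open>j k\<close> counts the contracted pairs of a_k and a_k^dagger. Writing the
  exponents as sums removes the truncated subtractions of \<open>wcoef_def\<close>.\<close>

lemma wcoef_nzD:
  assumes "wcoef n (al, be) (al', be') (ga, de) \<noteq> 0"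
  shows "\<exists>j. \<forall>k. ga k + j k = al k + al' k \<and> de k + j k = be k + be' k \<and> j k \<le> be k \<and> j k \<le> al' k"
proof (intro exI[of _ "\<lambda>k. al k + al' k - ga k"] allI)
  fix k
  let ?j = "al k + al' k - ga k"
  have "ga k \<le> al k + al' k \<and> ?j \<le> be k \<and> ?j \<le> al' k \<and> de k + ?j = be k + be' k"
    using assms unfolding wcoef_def Let_def fst_conv snd_conv by meson
  then show "ga k + ?j = al k + al' k \<and> de k + ?j = be k + be' k \<and> ?j \<le> be k \<and> ?j \<le> al' k"
    by simp
qed

lemma wcoef_contract:
  assumes "\<And>k. ga k + j k = al k + al' k" "\<And>k. de k + j k = be k + be' k"
    "\<And>k. j k \<le> be k" "\<And>k. j k \<le> al' k"
  shows "wcoef n (al, be) (al', be') (ga, de) = of_nat (\<Prod>k<n. (be k choose j k) * (al' k choose j k) * fact (j k))"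
proof -
  have j: "al k + al' k - ga k = j k" "ga k \<le> al k + al' k" for k
    using assms(1)[of k] by linarith+
  show ?thesis
    by (simp add: wcoef_def Let_def j assms(2-4))
qed

lemma finite_bounded_mons: "finite {m. valid_mon n m \<and> (\<forall>k. fst m k \<le> D \<and> snd m k \<le> D)}"
proof -
  let ?F = "{f. \<forall>x. (x \<in> {..<n} \<longrightarrow> f x \<in> {..D}) \<and> (x \<notin> {..<n} \<longrightarrow> f x = 0)}"
  have "finite ?F" by (rule finite_set_of_finite_funs) auto
  then have "finite (?F \<times> ?F)" by simp
  moreover have "{m. valid_mon n m \<and> (\<forall>k. fst m k \<le> D \<and> snd m k \<le> D)} \<subseteq> ?F \<times> ?F"
    by (auto simp: valid_mon_def)
  ultimately show ?thesis by (rule rev_finite_subset)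
qed

lemma valid_mon_wcoef:
  assumes "valid_mon n m1" "valid_mon n m2" "wcoef n m1 m2 m \<noteq> 0"
  shows "valid_mon n m"
proof -
  obtain al be al' be' ga de where m: "m1 = (al, be)" "m2 = (al', be')" "m = (ga, de)"
    by (meson surj_pair)
  show ?thesis
    using wcoef_nzD[of n al be al' be' ga de] assms unfolding m valid_mon_def
    by (auto simp: ) (metis add_is_0)+
qed

lemma finite_wcoef:
  assumes "valid_mon n m1" "valid_mon n m2"
  shows "finite {m. wcoef n m1 m2 m \<noteq> 0}"
proof -
  obtain al be al' be' where m: "m1 = (al, be)" "m2 = (al', be')"
    by (meson surj_pair)
  define D where "D = (\<Sum>k<n. al k + al' k + be k + be' k)"
  have D: "al k + al' k + be k + be' k \<le> D" for k
  proof (cases "k < n")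
    case True
    then show ?thesis unfolding D_def
      by (intro member_le_sum[of k "{..<n}" "\<lambda>k. al k + al' k + be k + be' k"]) auto
  next
    case False then show ?thesis using assms by (auto simp: m valid_mon_def)
  qed
  have "{m. wcoef n m1 m2 m \<noteq> 0} \<subseteq> {m. valid_mon n m \<and> (\<forall>k. fst m k \<le> D \<and> snd m k \<le> D)}"
  proof (clarify, intro conjI allI)
    fix ga de k assume nz: "wcoef n m1 m2 (ga, de) \<noteq> 0"
    show "valid_mon n (ga, de)" using valid_mon_wcoef[OF assms nz] .
    obtain j where "ga k + j k = al k + al' k" "de k + j k = be k + be' k"
      using wcoef_nzD[OF nz[unfolded m]] by blast
    then show "fst (ga, de) k \<le> D" "snd (ga, de) k \<le> D" using D[of k] by auto
  qed
  then show ?thesis using finite_bounded_mons by (rule finite_subset)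
qed

lemma in_weyl_wmul:
  assumes "in_weyl n f" "in_weyl n g"
  shows "in_weyl n (wmul n f g)"
proof -
  have sub: "wsupp (wmul n f g) \<subseteq> (\<Union>m1\<in>wsupp f. \<Union>m2\<in>wsupp g. {m. wcoef n m1 m2 m \<noteq> 0})"
  proof
    fix m assume "m \<in> wsupp (wmul n f g)"
    then have "wmul n f g m \<noteq> 0" by (simp add: wsupp_def)
    then have "(\<Sum>m1\<in>wsupp f. \<Sum>m2\<in>wsupp g. f m1 * g m2 * wcoef n m1 m2 m) \<noteq> 0"
      by (simp add: wmul_def)
    then show "m \<in> (\<Union>m1\<in>wsupp f. \<Union>m2\<in>wsupp g. {m. wcoef n m1 m2 m \<noteq> 0})"
      by (elim sum.not_neutral_contains_not_neutral) auto
  qed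
  have "finite (\<Union>m1\<in>wsupp f. \<Union>m2\<in>wsupp g. {m. wcoef n m1 m2 m \<noteq> 0})"
    using assms by (auto simp: in_weyl_def intro!: finite_wcoef)
  moreover have "valid_mon n m" if m: "m \<in> wsupp (wmul n f g)" for m
  proof -
    obtain m1 m2 where "m1 \<in> wsupp f" "m2 \<in> wsupp g" "wcoef n m1 m2 m \<noteq> 0"
      using sub m by blast
    then show ?thesis using assms unfolding in_weyl_def by (blast intro: valid_mon_wcoef)
  qed
  ultimately show ?thesis using sub by (auto simp: in_weyl_def intro: finite_subset)
qed

lemma in_weyl_add: "in_weyl n f \<Longrightarrow> in_weyl n g \<Longrightarrow> in_weyl n (\<lambda>m. f m + g m)"
proof -
  have "wsupp (\<lambda>m. f m + g m) \<subseteq> wsupp f \<union> wsupp g" by (auto simp: wsupp_def)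
  then show "in_weyl n f \<Longrightarrow> in_weyl n g \<Longrightarrow> in_weyl n (\<lambda>m. f m + g m)"
    unfolding in_weyl_def by (meson UnE finite_UnI finite_subset subsetD)
qed

lemma in_weyl_scale: "in_weyl n f \<Longrightarrow> in_weyl n (\<lambda>m. c * f m)"
  unfolding in_weyl_def by (auto simp: wsupp_def intro: finite_subset[of _ "{m. f m \<noteq> 0}"])

lemma in_weyl_wbr: "in_weyl n f \<Longrightarrow> in_weyl n g \<Longrightarrow> in_weyl n (wbr n f g)"
  using in_weyl_add[OF in_weyl_wmul[of n f g] in_weyl_scale[OF in_weyl_wmul[of n g f], of "-1"]]
  by (simp add: wbr_def)

section \<open>The polynomial representation\<close>

text \<open>The falling factorial x(x-1)...(x-b+1), zero for x < b: the factor with which the b-th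
  derivative maps z^x to z^(x-b).\<close>

definition ffac :: "nat \<Rightarrow> nat \<Rightarrow> nat" where
  "ffac x b = (x choose b) * fact b"

lemma ffac_0 [simp]: "ffac x 0 = 1" by (simp add: ffac_def)

lemma ffac_eq_0_iff: "ffac x b = 0 \<longleftrightarrow> x < b"
  by (auto simp: ffac_def binomial_eq_0_iff)

lemma ffac_self: "ffac x x = fact x" by (simp add: ffac_def)

lemma ffac_Suc: "ffac x (Suc b) = ffac x b * (x - b)"
proof (cases "b \<le> x")
  case True
  have "Suc b * (x choose Suc b) = (x - b) * (x choose b)"
    using binomial_absorb_comp[of x b] Suc_times_binomial_eq[of x b] 
    by (metis True binomial_absorption diff_Suc_1' binomial_absorb_comp mult.commute)
  moreover have "ffac x (Suc b) = (Suc b * (x choose Suc b)) * fact b"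
    by (simp add: ffac_def algebra_simps)
  ultimately show ?thesis by (simp only: ffac_def mult_ac)
qed (simp add: ffac_def)

lemma ffac_mult_fact: "b \<le> x \<Longrightarrow> ffac x b * fact (x - b) = fact x"
  using binomial_fact_lemma[of b x] by (simp add: ffac_def algebra_simps)

lemma ffac_add: "ffac (b + x) (b + c) = ffac (b + x) b * ffac x c"
proof (cases "c \<le> x")
  case True
  have "ffac (b + x) (b + c) * fact (x - c) = (ffac (b + x) b * ffac x c) * fact (x - c)"
    using ffac_mult_fact[of "b + c" "b + x"] ffac_mult_fact[of b "b + x"] ffac_mult_fact[of c x] True
    by (simp add: mult.assoc)
  then show ?thesis by simp
qed (simp add: ffac_def not_le binomial_eq_0)

text \<open>Both sides are the factor with which a^b (a^dagger)^a' a^b' acts on z^x; on the left the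
  operator is normally ordered first. Once \<open>ffac x b'\<close> and b! are pulled out,
  Vandermonde's identity remains.\<close>

lemma ffac_normal_order:
  "(\<Sum>j\<le>min b a'. (b choose j) * (a' choose j) * fact j * ffac x (b + b' - j)) = ffac x b' * ffac (x - b' + a') b"
proof (cases "b' \<le> x")
  case False
  then have "ffac x b' = 0" "\<And>j. j \<le> b \<Longrightarrow> ffac x (b + b' - j) = 0"
    by (simp_all add: ffac_eq_0_iff)
  then show ?thesis by simp
next
  case True
  then obtain M where M: "x = b' + M" by (auto simp: le_iff_add)
  have summand: "(b choose j) * (a' choose j) * fact j * ffac x (b + b' - j) =
     ffac x b' * fact b * ((a' choose j) * (M choose (b - j)))" if "j \<le> b" for j
  proof -
    have e: "b + b' - j = b' + (b - j)" using that by simp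
    have "(b choose j) * fact j * ffac M (b - j) = (fact j * fact (b - j) * (b choose j)) * (M choose (b - j))"
      by (simp add: ffac_def algebra_simps)
    also have "\<dots> = fact b * (M choose (b - j))"
      using binomial_fact_lemma[OF that] by simp
    finally have f: "(b choose j) * fact j * ffac M (b - j) = fact b * (M choose (b - j))" .
    have "(b choose j) * (a' choose j) * fact j * ffac x (b + b' - j) = 
      ffac x b' * (a' choose j) * ((b choose j) * fact j * ffac M (b - j))"
      unfolding e M ffac_add by simp
    also have "\<dots> = ffac x b' * fact b * ((a' choose j) * (M choose (b - j)))"
      unfolding f by simp
    finally show ?thesis .
  qed
  have "(\<Sum>j\<le>min b a'. (b choose j) * (a' choose j) * fact j * ffac x (b + b' - j)) =
     ffac x b' * fact b * (\<Sum>j\<le>min b a'. (a' choose j) * (M choose (b - j)))"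
    unfolding sum_distrib_left by (intro sum.cong refl summand) simp
  also have "(\<Sum>j\<le>min b a'. (a' choose j) * (M choose (b - j))) = (\<Sum>j\<le>b. (a' choose j) * (M choose (b - j)))"
    by (rule sum.mono_neutral_left) auto
  also have "\<dots> = (a' + M) choose b" by (rule vandermonde)
  finally show ?thesis by (simp add: M ffac_def algebra_simps)
qed

section \<open>The representation and its multiplicativity\<close>

definition ff :: "nat \<Rightarrow> (nat \<Rightarrow> nat) \<Rightarrow> (nat \<Rightarrow> nat) \<Rightarrow> nat" where
  "ff n N b = (\<Prod>k<n. ffac (N k) (b k))"

definition shiftv :: "mon \<Rightarrow> (nat \<Rightarrow> nat) \<Rightarrow> nat \<Rightarrow> nat" where
  "shiftv m N = (\<lambda>k. N k - snd m k + fst m k)"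

text \<open>The transpose of the action on polynomials: the monomial \<open>m\<close> maps \<open>z^N\<close> to
  \<open>ff n N (snd m) * z^(shiftv m N)\<close>, and \<open>\<psi>\<close> is a linear functional given by its values on the \<open>z^N\<close>.
  Hence products are reversed. Truncated subtraction in \<open>shiftv\<close> only occurs where \<open>ff\<close> vanishes.\<close>

definition rep :: "nat \<Rightarrow> welem \<Rightarrow> ((nat \<Rightarrow> nat) \<Rightarrow> complex) \<Rightarrow> (nat \<Rightarrow> nat) \<Rightarrow> complex" where
  "rep n f \<psi> N = (\<Sum>m\<in>wsupp f. f m * of_nat (ff n N (snd m)) * \<psi> (shiftv m N))"

lemma ff_eq_0_iff: "ff n N b = 0 \<longleftrightarrow> (\<exists>k<n. N k < b k)"
  by (auto simp: ff_def ffac_eq_0_iff)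

lemma ff_nzD: "ff n N b \<noteq> 0 \<Longrightarrow> k < n \<Longrightarrow> b k \<le> N k"
  using ff_eq_0_iff not_less by blast

lemma rep_superset:
  assumes "finite A" "wsupp f \<subseteq> A"
  shows "rep n f \<psi> N = (\<Sum>m\<in>A. f m * of_nat (ff n N (snd m)) * \<psi> (shiftv m N))"
  unfolding rep_def by (rule sum.mono_neutral_left) (use assms in \<open>auto simp: wsupp_def\<close>)

lemma rep_add:
  assumes "in_weyl n f" "in_weyl n g"
  shows "rep n (\<lambda>m. f m + g m) \<psi> N = rep n f \<psi> N + rep n g \<psi> N"
proof -
  let ?A = "wsupp f \<union> wsupp g"
  have "finite ?A" "wsupp (\<lambda>m. f m + g m) \<subseteq> ?A"
    using assms by (auto simp: in_weyl_def wsupp_def)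
  then show ?thesis
    by (simp add: rep_superset[of ?A] sum.distrib algebra_simps)
qed

lemma rep_scale:
  assumes "in_weyl n f"
  shows "rep n (\<lambda>m. c * f m) \<psi> N = c * rep n f \<psi> N"
proof -
  have "finite (wsupp f)" "wsupp (\<lambda>m. c * f m) \<subseteq> wsupp f"
    using assms by (auto simp: in_weyl_def wsupp_def)
  then show ?thesis
    by (simp add: rep_superset[of "wsupp f"] sum_distrib_left algebra_simps)
qed

text \<open>The monomials of the product correspond bijectively to the contraction vectors, which
  fill a box. The sum over a box of a product over modes is a product of one-mode sums, and
  \<open>ffac_normal_order\<close> evaluates each of them.\<close>

lemma ff_mono_mult:
  assumes v: "valid_mon n (al, be)" "valid_mon n (al', be')"
  shows "(\<Sum>m | wcoef n (al, be) (al', be') m \<noteq> 0. wcoef n (al, be) (al', be') m * of_nat (ff n N (snd m)))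
     = of_nat (ff n N be' * ff n (shiftv (al', be') N) be)"
proof -
  let ?P = "PiE {..<n} (\<lambda>k. {..min (be k) (al' k)})"
  define c where "c = (\<lambda>k j. (be k choose j) * (al' k choose j) * fact j)"
  \<comment> \<open>Elements of \<open>?P\<close> are \<open>undefined\<close> outside
    \<open>{..<n}\<close>, so the exponents there are set to 0, as \<open>valid_mon\<close>
    demands.\<close>
  define t :: "(nat \<Rightarrow> nat) \<Rightarrow> mon" where "t = (\<lambda>g. ((\<lambda>k. if k < n then al k + al' k - g k else 0), (\<lambda>k. if k < n then be k + be' k - g k else 0)))"
  have wc: "wcoef n (al, be) (al', be') (t g) = of_nat (\<Prod>k<n. c k (g k))" if "g \<in> ?P" for g
  proof -
    define j where "j = (\<lambda>k. if k < n then g k else 0)"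
    have g: "g k \<le> be k" "g k \<le> al' k" if "k < n" for k using that \<open>g \<in> ?P\<close> by (auto simp: PiE_iff)
    have "wcoef n (al, be) (al', be') (t g) = of_nat (\<Prod>k<n. (be k choose j k) * (al' k choose j k) * fact (j k))"
      unfolding t_def
    proof (rule wcoef_contract)
      fix k
      show "(if k < n then al k + al' k - g k else 0) + j k = al k + al' k"
        using g[of k] v by (auto simp: j_def valid_mon_def)
      show "(if k < n then be k + be' k - g k else 0) + j k = be k + be' k"
        using g[of k] v by (auto simp: j_def valid_mon_def)
      show "j k \<le> be k" "j k \<le> al' k" using g[of k] by (auto simp: j_def)
    qed
    also have "(\<Prod>k<n. (be k choose j k) * (al' k choose j k) * fact (j k)) = (\<Prod>k<n. c k (g k))"
      by (intro prod.cong) (auto simp: c_def j_def)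
    finally show ?thesis .
  qed
  have inj: "inj_on t ?P"
  proof (rule inj_onI)
    fix g h assume gh: "g \<in> ?P" "h \<in> ?P" "t g = t h"
    show "g = h"
    proof (rule PiE_ext[OF gh(1,2)])
      fix k assume k: "k \<in> {..<n}"
      from gh(3) have "al k + al' k - g k = al k + al' k - h k"
        using k by (auto simp: t_def dest: fun_cong[of _ _ k])
      moreover have "g k \<le> al' k" "h k \<le> al' k" using gh k by (auto simp: PiE_iff)
      ultimately show "g k = h k" by linarith
    qed
  qed
  have im: "{m. wcoef n (al, be) (al', be') m \<noteq> 0} = t ` ?P"
  proof (intro equalityI subsetI)
    fix m assume "m \<in> t ` ?P"
    then obtain g where g: "g \<in> ?P" "m = t g" by auto
    have "c k (g k) \<noteq> 0" if "k < n" for k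
      using PiE_mem[OF g(1), of k] that by (auto simp: c_def binomial_eq_0_iff)
    then show "m \<in> {m. wcoef n (al, be) (al', be') m \<noteq> 0}"
      unfolding g(2) mem_Collect_eq wc[OF g(1)] by auto
  next
    fix m assume "m \<in> {m. wcoef n (al, be) (al', be') m \<noteq> 0}"
    then have nz: "wcoef n (al, be) (al', be') (fst m, snd m) \<noteq> 0" by simp
    then obtain j where j: "\<And>k. fst m k + j k = al k + al' k" "\<And>k. snd m k + j k = be k + be' k"
       "\<And>k. j k \<le> be k" "\<And>k. j k \<le> al' k"
      using wcoef_nzD by blast
    have eq: "fst m k = al k + al' k - j k" "snd m k = be k + be' k - j k" for k
      using j(1,2)[of k] by linarith+
    have "m = t (restrict j {..<n})"
      using eq v by (auto simp: t_def prod_eq_iff fun_eq_iff valid_mon_def)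
    moreover have "restrict j {..<n} \<in> ?P" using j by auto
    ultimately show "m \<in> t ` ?P" by blast
  qed
  have "(\<Sum>m | wcoef n (al, be) (al', be') m \<noteq> 0. wcoef n (al, be) (al', be') m * of_nat (ff n N (snd m)))
    = (\<Sum>g\<in>?P. of_nat (\<Prod>k<n. c k (g k)) * of_nat (ff n N (snd (t g))))"
    unfolding im by (simp add: sum.reindex[OF inj] wc del: of_nat_prod)
  also have "\<dots> = of_nat (\<Sum>g\<in>?P. (\<Prod>k<n. c k (g k) * ffac (N k) (be k + be' k - g k)))"
    by (simp add: ff_def t_def prod.distrib)
  also have "(\<Sum>g\<in>?P. (\<Prod>k<n. c k (g k) * ffac (N k) (be k + be' k - g k)))
     = (\<Prod>k<n. \<Sum>j\<le>min (be k) (al' k). c k j * ffac (N k) (be k + be' k - j))"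
    by (subst prod_sum_PiE) auto
  also have "\<dots> = (\<Prod>k<n. ffac (N k) (be' k) * ffac (N k - be' k + al' k) (be k))"
    unfolding c_def by (simp only: ffac_normal_order)
  also have "\<dots> = ff n N be' * ff n (shiftv (al', be') N) be"
    by (simp add: ff_def prod.distrib shiftv_def)
  finally show ?thesis .
qed

text \<open>Since none of the three factors \<open>ff\<close> vanishes, no subtraction truncates,
  and both sides are \<open>N\<close> plus the weights of the two monomials.\<close>

lemma shiftv_contract:
  assumes "valid_mon n (al, be)" "valid_mon n (al', be')"
    "wcoef n (al, be) (al', be') m \<noteq> 0" "ff n N (snd m) \<noteq> 0"
    "ff n N be' \<noteq> 0" "ff n (shiftv (al', be') N) be \<noteq> 0"
  shows "shiftv m N = shiftv (al, be) (shiftv (al', be') N)"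
proof
  fix k
  from assms(3) have "wcoef n (al, be) (al', be') (fst m, snd m) \<noteq> 0" by simp
  from wcoef_nzD[OF this] obtain j where j: "fst m k + j k = al k + al' k" "snd m k + j k = be k + be' k"
    by blast
  show "shiftv m N k = shiftv (al, be) (shiftv (al', be') N) k"
  proof (cases "k < n")
    case True
    then have "snd m k \<le> N k" "be' k \<le> N k" "be k \<le> N k - be' k + al' k"
      using assms(4-6)[THEN ff_nzD, OF True] by (simp_all add: shiftv_def)
    then show ?thesis using j by (simp add: shiftv_def)
  next
    case False
    then show ?thesis using j assms(1,2) by (auto simp: shiftv_def valid_mon_def)
  qed
qed

lemma ff_mono_mult_shift:
  assumes v: "valid_mon n m1" "valid_mon n m2"
  shows "(\<Sum>m | wcoef n m1 m2 m \<noteq> 0. wcoef n m1 m2 m * of_nat (ff n N (snd m)) * \<psi> (shiftv m N))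
     = of_nat (ff n N (snd m2)) * of_nat (ff n (shiftv m2 N) (snd m1)) * \<psi> (shiftv m1 (shiftv m2 N))"
proof -
  obtain al be al' be' where m: "m1 = (al, be)" "m2 = (al', be')"
    by (meson surj_pair)
  let ?A = "{m. wcoef n m1 m2 m \<noteq> 0}"
  have fin: "finite ?A" using v by (rule finite_wcoef)
  note * = ff_mono_mult[OF v[unfolded m], of N, folded m]
  show ?thesis
  proof (cases "ff n N be' * ff n (shiftv (al', be') N) be = 0")
    case True
    \<comment> \<open>Truncation may make the shifts differ here, so every summand has to vanish by
      itself. It does, because the factors in front of \<open>\<psi>\<close> are natural numbers
      with sum 0.\<close>
    have nonneg: "wcoef n m1 m2 m \<in> \<nat>" for m by (simp add: wcoef_def Let_def del: of_nat_prod)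
    define w where "w = (\<lambda>m. SOME x. of_nat x = wcoef n m1 m2 m)"
    have w: "of_nat (w m) = wcoef n m1 m2 m" for m
      unfolding w_def by (rule someI_ex) (metis nonneg Nats_cases)
    have "of_nat (\<Sum>m\<in>?A. w m * ff n N (snd m)) = (0::complex)"
      using * True by (simp add: w m)
    then have "(\<Sum>m\<in>?A. w m * ff n N (snd m)) = 0" by (simp only: of_nat_eq_0_iff)
    then have "w m * ff n N (snd m) = 0" if "m \<in> ?A" for m
      using that unfolding sum_eq_0_iff[OF fin] by blast
    then have "wcoef n m1 m2 m * of_nat (ff n N (snd m)) = 0" if "m \<in> ?A" for m
      using that by (metis w of_nat_mult of_nat_0)
    then have "(\<Sum>m\<in>?A. wcoef n m1 m2 m * of_nat (ff n N (snd m)) * \<psi> (shiftv m N)) = 0"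
      by (intro sum.neutral) auto
    then show ?thesis using True by (auto simp: m)
  next
    case False
    have "(\<Sum>m\<in>?A. wcoef n m1 m2 m * of_nat (ff n N (snd m)) * \<psi> (shiftv m N))
       = (\<Sum>m\<in>?A. wcoef n m1 m2 m * of_nat (ff n N (snd m)) * \<psi> (shiftv m1 (shiftv m2 N)))"
    proof (intro sum.cong refl)
      fix m' assume "m' \<in> ?A"
      then show "wcoef n m1 m2 m' * of_nat (ff n N (snd m')) * \<psi> (shiftv m' N) =
        wcoef n m1 m2 m' * of_nat (ff n N (snd m')) * \<psi> (shiftv m1 (shiftv m2 N))"
        using shiftv_contract[OF v[unfolded m], of m' N] False unfolding m
        by (cases "ff n N (snd m') = 0") auto
    qed
    then show ?thesis using * by (simp add: sum_distrib_right [symmetric] m)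
  qed
qed

lemma rep_wmul:
  assumes "in_weyl n f" "in_weyl n g"
  shows "rep n (wmul n f g) \<psi> N = rep n g (rep n f \<psi>) N"
proof -
  define A where "A = (\<Union>m1\<in>wsupp f. \<Union>m2\<in>wsupp g. {m. wcoef n m1 m2 m \<noteq> 0}) \<union> wsupp (wmul n f g)"
  have fin: "finite A" unfolding A_def
    using assms in_weyl_wmul[OF assms] by (auto simp: in_weyl_def intro!: finite_wcoef)
  have inner: "(\<Sum>m\<in>A. wcoef n m1 m2 m * of_nat (ff n N (snd m)) * \<psi> (shiftv m N))
     = of_nat (ff n N (snd m2)) * of_nat (ff n (shiftv m2 N) (snd m1)) * \<psi> (shiftv m1 (shiftv m2 N))"
    if "m1 \<in> wsupp f" "m2 \<in> wsupp g" for m1 m2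
  proof -
    have v: "valid_mon n m1" "valid_mon n m2" using that assms by (auto simp: in_weyl_def)
    have "(\<Sum>m\<in>A. wcoef n m1 m2 m * of_nat (ff n N (snd m)) * \<psi> (shiftv m N))
       = (\<Sum>m | wcoef n m1 m2 m \<noteq> 0. wcoef n m1 m2 m * of_nat (ff n N (snd m)) * \<psi> (shiftv m N))"
      by (rule sum.mono_neutral_right) (use that fin in \<open>auto simp: A_def\<close>)
    with ff_mono_mult_shift[OF v] show ?thesis by simp
  qed
  have "rep n (wmul n f g) \<psi> N = (\<Sum>m\<in>A. wmul n f g m * of_nat (ff n N (snd m)) * \<psi> (shiftv m N))"
    by (rule rep_superset[OF fin]) (auto simp: A_def)
  also have "\<dots> = (\<Sum>m\<in>A. \<Sum>m1\<in>wsupp f. \<Sum>m2\<in>wsupp g. f m1 * g m2 * (wcoef n m1 m2 m * of_nat (ff n N (snd m)) * \<psi> (shiftv m N)))"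
    by (simp add: wmul_def sum_distrib_right mult.assoc)
  also have "\<dots> = (\<Sum>m1\<in>wsupp f. \<Sum>m2\<in>wsupp g. \<Sum>m\<in>A. f m1 * g m2 * (wcoef n m1 m2 m * of_nat (ff n N (snd m)) * \<psi> (shiftv m N)))"
    by (subst sum.swap) (intro sum.cong refl sum.swap)
  also have "\<dots> = (\<Sum>m1\<in>wsupp f. \<Sum>m2\<in>wsupp g. f m1 * g m2 * (of_nat (ff n N (snd m2)) * of_nat (ff n (shiftv m2 N) (snd m1)) * \<psi> (shiftv m1 (shiftv m2 N))))"
    by (intro sum.cong refl) (simp only: sum_distrib_left [symmetric] inner)
  also have "\<dots> = (\<Sum>m2\<in>wsupp g. \<Sum>m1\<in>wsupp f. f m1 * g m2 * (of_nat (ff n N (snd m2)) * of_nat (ff n (shiftv m2 N) (snd m1)) * \<psi> (shiftv m1 (shiftv m2 N))))"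
    by (rule sum.swap)
  also have "\<dots> = rep n g (rep n f \<psi>) N"
    by (simp add: rep_def sum_distrib_left algebra_simps)
  finally show ?thesis .
qed

lemma rep_wbr:
  assumes "in_weyl n f" "in_weyl n g"
  shows "rep n (wbr n f g) \<psi> N = rep n g (rep n f \<psi>) N - rep n f (rep n g \<psi>) N"
  using rep_add[OF in_weyl_wmul[OF assms] in_weyl_scale[OF in_weyl_wmul[OF assms(2,1)], of "-1"]]
  by (simp add: wbr_def rep_scale[OF in_weyl_wmul[OF assms(2,1)], of "-1", simplified] rep_wmul assms)

text \<open>If \<open>H\<close> is diagonal, then \<open>ad H\<close> multiplies the matrix entry \<open>(N, M)\<close> by \<open>h M - h N\<close>.
  In finite dimension \<open>ad H\<close> is annihilated by a polynomial, which would vanish at all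
  these numbers.\<close>

lemma infinite_eigenvalues_not_fin_dim:
  assumes weyl: "\<And>x. x \<in> S \<Longrightarrow> in_weyl n x"
    and br: "\<And>x y. x \<in> S \<Longrightarrow> y \<in> S \<Longrightarrow> wbr n x y \<in> S"
    and H: "H \<in> S" and x: "x \<in> S"
    and diag: "\<And>\<psi> N. rep n H \<psi> N = h N * \<psi> N"
    and nz: "\<And>N. N \<in> I \<Longrightarrow> rep n x (\<lambda>K. if K = M N then 1 else 0) N \<noteq> 0"
    and inf: "infinite ((\<lambda>N. h (M N) - h N) ` I)"
  shows "\<not> fin_dim S"
proof
  assume "fin_dim S"
  then obtain B where B: "finite B" "S \<subseteq> rspan B" by (auto simp: fin_dim_def)
  define v where "v r = ((wbr n H) ^^ r) x" for r
  have vS: "v r \<in> S" for r by (induction r) (auto simp: v_def x br H)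
  have vB: "v r \<in> rspan B" for r using vS B(2) by blast
  obtain c i where c: "i \<le> card B" "c i \<noteq> 0"
    "\<forall>m. (\<Sum>r\<le>card B. complex_of_real (c r) * v r m) = 0"
    by (rule rspan_dependent[where v = v, OF B(1) vB]) (rule that)
  define \<delta> where "\<delta> L = (\<lambda>K. if K = L then 1 else 0 :: complex)" for L :: "nat \<Rightarrow> nat"
  have rl: "rep n y (\<lambda>K. a * \<psi> K) N = a * rep n y \<psi> N" for y a \<psi> N
    by (simp add: rep_def sum_distrib_left mult_ac)
  have ent: "rep n (v r) (\<delta> L) N = (h L - h N) ^ r * rep n x (\<delta> L) N" for r L N
  proof (induction r)
    case 0 then show ?case by (simp add: v_def)
  next
    case (Suc r)
    have H\<delta>: "rep n H (\<delta> L) = (\<lambda>K. h L * \<delta> L K)"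
      by (rule ext) (simp add: diag \<delta>_def)
    have "rep n (v (Suc r)) (\<delta> L) N = rep n (v r) (rep n H (\<delta> L)) N - rep n H (rep n (v r) (\<delta> L)) N"
      using rep_wbr[OF weyl[OF H] weyl[OF vS[of r]]] by (simp add: v_def)
    also have "\<dots> = (h L - h N) * rep n (v r) (\<delta> L) N"
      unfolding H\<delta> rl diag by (simp add: algebra_simps)
    finally show ?case using Suc by simp
  qed
  have repsum: "rep n (\<lambda>m. \<Sum>r\<le>k. complex_of_real (c r) * v r m) \<psi> N = (\<Sum>r\<le>k. complex_of_real (c r) * rep n (v r) \<psi> N)"
    and "in_weyl n (\<lambda>m. \<Sum>r\<le>k. complex_of_real (c r) * v r m)" for k \<psi> N
    by (induction k) (simp_all add: rep_add rep_scale in_weyl_add in_weyl_scale weyl vS)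
  have rep0: "rep n (\<lambda>m. 0) \<psi> N = 0" for \<psi> N by (simp add: rep_def wsupp_def)
  have "(\<lambda>N. h (M N) - h N) ` I \<subseteq> {z. (\<Sum>r\<le>card B. complex_of_real (c r) * z ^ r) = 0}"
  proof safe
    fix N assume N: "N \<in> I"
    have "0 = (\<Sum>r\<le>card B. complex_of_real (c r) * rep n (v r) (\<delta> (M N)) N)"
      using repsum[of "card B"] rep0 by (simp add: c(3)[rule_format])
    also have "\<dots> = (\<Sum>r\<le>card B. complex_of_real (c r) * (h (M N) - h N) ^ r) * rep n x (\<delta> (M N)) N"
      unfolding ent by (simp add: sum_distrib_right mult.assoc)
    finally show "(\<Sum>r\<le>card B. complex_of_real (c r) * (h (M N) - h N) ^ r) = 0"
      using nz[OF N] by (simp add: \<delta>_def)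
  qed
  moreover have "finite {z. (\<Sum>r\<le>card B. complex_of_real (c r) * z ^ r) = 0}"
    using c by (intro polyfun_roots_finite[of _ i]) auto
  ultimately show False using inf finite_subset by blast
qed

section \<open>Growth of falling factorials\<close>

text \<open>The factors of \<open>ffac (p + y) p\<close> are y+1, ..., y+p.\<close>

lemma ffac_lower: "y ^ p \<le> ffac (p + y) p"
proof (induction p arbitrary: y)
  case (Suc p)
  have "y ^ Suc p \<le> (Suc y) ^ p * Suc y"
    using power_mono[of y "Suc y" "Suc p"] by (simp add: mult.commute)
  also have "\<dots> \<le> ffac (p + Suc y) p * Suc y"
    using Suc[of "Suc y"] by (rule mult_right_mono) simp
  also have "\<dots> = ffac (Suc p + y) (Suc p)"
    by (simp add: ffac_Suc)
  finally show ?case .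
qed simp

text \<open>Passing from t to t+1 replaces the smallest factor t+1 by p+t+1.\<close>

lemma ffac_strict_mono: "p > 0 \<Longrightarrow> strict_mono (\<lambda>t. ffac (p + t) p)"
  unfolding strict_mono_Suc_iff
proof
  fix t assume "p > 0"
  then obtain q where p: "p = Suc q" by (cases p) auto
  have "ffac (p + t) p = ffac (p + t) q * Suc t" by (simp add: p ffac_Suc)
  also have "\<dots> < ffac (p + t) q * Suc (p + t)"
    using ffac_eq_0_iff[of "p + t" q] by (intro mult_strict_left_mono) (auto simp: p)
  also have "\<dots> = ffac (p + Suc t) p"
    using ffac_add[of 1 "p + t" q] by (simp add: p ffac_Suc[of _ 0] mult.commute)
  finally show "ffac (p + t) p < ffac (p + Suc t) p" .
qed

lemma ffac_ge_fact: "0 < t \<Longrightarrow> fact (Suc p) \<le> ffac (p + t) p"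
proof -
  assume "0 < t"
  have "fact (Suc p) = ffac (p + 1) p" using ffac_mult_fact[of p "p + 1"] by simp
  also have "\<dots> \<le> ffac (p + t) p" 
    using strict_mono_less_eq[OF ffac_strict_mono, of p 1 t] \<open>0 < t\<close> by (cases "p = 0") auto
  finally show ?thesis .
qed

text \<open>The offset \<open>c\<close> is the accumulated weight of shifts and may be negative; the
  equation is required only eventually because shifts truncate for small \<open>R\<close>.\<close>

lemma ffac_asymp:
  assumes "eventually (\<lambda>R. real (f R) = real R + c) sequentially"
  shows "(\<lambda>R. real (ffac (f R) p) / real R ^ p) \<longlonglongrightarrow> 1"
proof (induction p)
  case (Suc p)
  have "(\<lambda>R. 1 + (c - real p) / real R) \<longlonglongrightarrow> 1 + 0"
    by (intro tendsto_intros lim_const_over_n)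
  moreover have "eventually (\<lambda>R. 1 + (c - real p) / real R = real (f R - p) / real R) sequentially"
    using assms eventually_ge_at_top[of "nat \<lceil>\<bar>c\<bar>\<rceil> + p + 1"]
  proof eventually_elim
    case (elim R)
    have "\<bar>c\<bar> \<le> real (nat \<lceil>\<bar>c\<bar>\<rceil>)" by linarith
    then have "real (f R) \<ge> real p" "real R > 0" using elim by linarith+
    then show ?case using elim(1) by (simp add: of_nat_diff field_simps)
  qed
  ultimately have "(\<lambda>R. real (f R - p) / real R) \<longlonglongrightarrow> 1"
    by (simp add: tendsto_cong)
  from tendsto_mult[OF Suc this] show ?case
    by (simp add: ffac_Suc mult.commute)
qed simp

lemma eventually_shift:
  assumes "eventually (\<lambda>R. real (f R) = real R + c) sequentially"
  shows "eventually (\<lambda>R. real (f R - b + a) = real R + (c - real b + real a)) sequentially"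
  using assms eventually_ge_at_top[of "nat \<lceil>\<bar>c\<bar>\<rceil> + b"]
proof eventually_elim
  case (elim R)
  have "\<bar>c\<bar> \<le> real (nat \<lceil>\<bar>c\<bar>\<rceil>)" by linarith
  then have "real (f R) \<ge> real b" using elim by linarith
  then show ?case using elim(1) by (simp add: of_nat_diff)
qed

lemma finite_image_bounded:
  fixes f :: "'i \<Rightarrow> real"
  assumes "finite (f ` A)"
  obtains M where "\<And>x. x \<in> A \<Longrightarrow> \<bar>f x\<bar> \<le> M"
proof
  fix x assume "x \<in> A"
  then show "\<bar>f x\<bar> \<le> Max (abs ` f ` A)" using assms by (intro Max_ge) auto
qed

text \<open>A finite range is bounded, so dividing by \<open>R\<close> to the positive total degree
  would give limit 0, whereas the limit is \<open>c1 - c2\<close>.\<close>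

lemma infinite_range_asymp:
  fixes P Q :: "'i \<Rightarrow> nat \<Rightarrow> real" and c1 c2 :: real
  assumes "\<And>l. l \<in> L \<Longrightarrow> (\<lambda>R. P l R / real R ^ d l) \<longlonglongrightarrow> 1"
    and "\<And>l. l \<in> L \<Longrightarrow> (\<lambda>R. Q l R / real R ^ d l) \<longlonglongrightarrow> 1"
    and ne: "c1 \<noteq> c2" and d: "0 < (\<Sum>l\<in>L. d l)"
  shows "infinite ((\<lambda>R. c1 * (\<Prod>l\<in>L. P l R) - c2 * (\<Prod>l\<in>L. Q l R)) ` {R0..})" (is "infinite (?F ` _)")
proof
  assume fin: "finite (?F ` {R0..})"
  let ?d = "\<Sum>l\<in>L. d l"
  obtain M where M: "\<And>R. R \<in> {R0..} \<Longrightarrow> \<bar>?F R\<bar> \<le> M"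
    using finite_image_bounded[OF fin] by blast
  have "(\<lambda>R. c1 * (\<Prod>l\<in>L. P l R / real R ^ d l) - c2 * (\<Prod>l\<in>L. Q l R / real R ^ d l)) \<longlonglongrightarrow> c1 * (\<Prod>l\<in>L. 1) - c2 * (\<Prod>l\<in>L. 1)"
    by (intro tendsto_intros assms)
  then have "(\<lambda>R. ?F R / real R ^ ?d) \<longlonglongrightarrow> c1 - c2"
    by (simp add: prod_dividef power_sum diff_divide_distrib)
  moreover have "(\<lambda>R. ?F R / real R ^ ?d) \<longlonglongrightarrow> 0"
  proof (rule tendsto_0_le)
    show "(\<lambda>R. M / real R) \<longlonglongrightarrow> 0" by (rule lim_const_over_n)
    show "eventually (\<lambda>R. norm (?F R / real R ^ ?d) \<le> norm (M / real R) * 1) sequentially"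
      using eventually_ge_at_top[of "max 1 R0"]
    proof eventually_elim
      case (elim R)
      have "real R ^ 1 \<le> real R ^ ?d" using elim d by (intro power_increasing) auto
      then have "\<bar>?F R\<bar> / real R ^ ?d \<le> \<bar>M\<bar> / real R"
        using M[of R] elim by (intro frac_le) auto
      then show ?case by (simp add: abs_divide)
    qed
  qed
  ultimately show False using LIMSEQ_unique ne by force
qed

text \<open>With \<open>M = 0\<close> it turns bounded differences into linear growth; applied once
  more, it turns bounded second differences into quadratic growth.\<close>

lemma bounded_differences:
  fixes q :: "nat \<Rightarrow> real"
  assumes "\<And>t. q (Suc t) - q t \<le> A + M * real t" "0 \<le> M"
  shows "q t \<le> q 0 + A * t + M * real t ^ 2"
proof (induction t)
  case (Suc t)
  have "q (Suc t) \<le> q t + A + M * real t" using assms(1)[of t] by simp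
  also have "\<dots> \<le> q 0 + A * real (Suc t) + M * (real t ^ 2 + real t)"
    using Suc by (simp add: algebra_simps)
  also have "\<dots> \<le> q 0 + A * real (Suc t) + M * real (Suc t) ^ 2"
    using assms(2) by (intro add_left_mono mult_left_mono) (auto simp: power2_eq_square algebra_simps)
  finally show ?case .
qed simp

text \<open>Finitely many differences are bounded, which would make \<open>q\<close> grow at most
  linearly.\<close>

lemma infinite_first_differences:
  fixes q :: "nat \<Rightarrow> real"
  assumes q: "\<And>t. real t ^ 2 \<le> q t"
  shows "infinite (range (\<lambda>t. q (Suc t) - q t))"
proof
  assume "finite (range (\<lambda>t. q (Suc t) - q t))"
  then obtain M where M: "\<And>t. \<bar>q (Suc t) - q t\<bar> \<le> M"
    by (rule finite_image_bounded) auto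
  have le: "q t \<le> q 0 + M * t" for t
    using bounded_differences[of q M 0 t] M by (simp add: abs_le_iff)
  obtain t :: nat where t: "q 0 + M + 1 < real t" using reals_Archimedean2 by blast
  have "0 \<le> q 0" "0 \<le> M" using q[of 0] M[of 0] by auto
  then have "real t \<ge> 1" using t by linarith
  have "(q 0 + M + 1) * real t \<le> real t ^ 2"
    using t by (simp add: power2_eq_square mult_right_mono)
  also have "\<dots> \<le> q 0 + M * t" using q[of t] le[of t] by linarith
  also have "\<dots> \<le> (q 0 + M) * t"
    using \<open>0 \<le> q 0\<close> \<open>real t \<ge> 1\<close> mult_left_mono[of 1 "real t" "q 0"] by (simp add: algebra_simps)
  finally show False using \<open>real t \<ge> 1\<close> by (simp add: algebra_simps)
qed

text \<open>Finitely many second differences are bounded, which would make \<open>q\<close> grow at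
  most quadratically. Quadratic growth would not suffice as a hypothesis, since t^2 has constant
  second differences; this is why degree 3 is the threshold.\<close>

lemma infinite_second_differences:
  fixes q :: "nat \<Rightarrow> real"
  assumes q: "\<And>t. real t ^ 3 \<le> q t"
  shows "infinite (range (\<lambda>t. 2 * q (Suc t) - q (Suc (Suc t)) - q t))"
proof
  assume "finite (range (\<lambda>t. 2 * q (Suc t) - q (Suc (Suc t)) - q t))"
  then obtain M where M: "\<And>t. \<bar>2 * q (Suc t) - q (Suc (Suc t)) - q t\<bar> \<le> M"
    by (rule finite_image_bounded) auto
  have M0: "0 \<le> M" using M[of 0] by linarith
  define A where "A = \<bar>q 1 - q 0\<bar>"
  have "q (Suc t) - q t \<le> (q (Suc 0) - q 0) + M * t + 0 * t ^ 2" for t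
    using bounded_differences[of "\<lambda>t. q (Suc t) - q t" M 0 t] M by (simp add: abs_le_iff algebra_simps)
  then have le: "q t \<le> q 0 + A * t + M * real t ^ 2" for t
    using M0 by (intro bounded_differences) (auto simp: A_def intro: order.trans[OF _ add_right_mono[OF abs_ge_self]])
  \<comment> \<open>For t >= 1 each term of the bound is at most its coefficient times t^2, so a
    \<open>t\<close> above the sum of the coefficients lets t^3 exceed it.\<close>
  obtain t :: nat where t: "q 0 + A + M + 1 < real t" using reals_Archimedean2 by blast
  have q0: "0 \<le> q 0" "0 \<le> A" using q[of 0] by (auto simp: A_def)
  then have t1: "real t \<ge> 1" using t M0 by linarith
  have t2: "1 \<le> real t ^ 2" "real t \<le> real t ^ 2" using t1 mult_left_mono[OF t1, of "real t"] unfolding power2_eq_square by linarith+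
  have "(q 0 + A + M + 1) * real t ^ 2 \<le> real t ^ 3"
    using mult_right_mono[of "q 0 + A + M + 1" "real t" "real t ^ 2"] t by (simp add: power3_eq_cube power2_eq_square mult.assoc)
  also have "\<dots> \<le> q 0 + A * t + M * real t ^ 2" using q[of t] le[of t] by linarith
  also have "\<dots> \<le> q 0 * real t ^ 2 + A * real t ^ 2 + M * real t ^ 2"
    using q0 t2 mult_left_mono[OF t2(1), of "q 0"] mult_left_mono[OF t2(2), of A] by simp
  finally show False using t2 by (simp add: algebra_simps)
qed

text \<open>The one-mode case of the eigenvalue below: the first factor comes from applying
  (a^dagger)^a a^b to z^x, the second from applying its adjoint to the result.\<close>

definition amp :: "nat \<Rightarrow> nat \<Rightarrow> nat \<Rightarrow> nat" where
  "amp a b x = ffac x b * ffac (x - b + a) a"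

lemma amp_00 [simp]: "amp 0 0 x = 1" by (simp add: amp_def)

lemma amp_asymp:
  assumes "eventually (\<lambda>R. real (f R) = real R + c) sequentially"
  shows "(\<lambda>R. real (amp a b (f R)) / real R ^ (a + b)) \<longlonglongrightarrow> 1"
  using tendsto_mult[OF ffac_asymp[OF assms, of b] ffac_asymp[OF eventually_shift[OF assms, of b a], of a]]
  by (simp add: amp_def power_add mult.commute)

text \<open>At b the value is a! b!, at a it is at least (a+1)! (b+1)!, and (a+1)(b+1) >= 3. The
  points b and a are the least occupation number on which the monomial acts nontrivially and its
  image under the shift.\<close>

lemma amp_jump:
  assumes "b < a" "2 \<le> a + b"
  shows "2 * amp a b b < amp a b a"
proof -
  obtain c where c: "a = b + c" "0 < c" using assms(1) by (auto simp: less_iff_Suc_add)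
  have "fact (Suc b) * fact (Suc a) \<le> ffac a b * ffac (a + c) a"
    using ffac_ge_fact[OF c(2), of b] ffac_ge_fact[OF c(2), of a] c by (intro mult_mono) auto
  also have "a + c = a - b + a" using c by simp
  finally have "fact (Suc b) * fact (Suc a) \<le> amp a b a" by (simp add: amp_def)
  moreover have "2 * amp a b b < fact (Suc b) * fact (Suc a)"
  proof -
    have "3 \<le> Suc b * Suc a" using assms by (cases a; cases b) auto
    then have "3 * (fact b * fact a) \<le> Suc b * Suc a * (fact b * fact a)"
      by (rule mult_right_mono) simp
    moreover have "amp a b b = fact b * fact a" by (simp add: amp_def ffac_self)
    moreover have "fact (Suc b) * fact (Suc a) = Suc b * Suc a * (fact b * fact a :: nat)"
      by (simp only: fact_Suc of_nat_id mult_ac)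
    moreover have "fact b * fact a > (0::nat)" by simp
    ultimately show ?thesis by linarith
  qed
  ultimately show ?thesis by linarith
qed

text \<open>\<open>phi n m N\<close> is the eigenvalue on \<open>z^N\<close> of the adjoint of \<open>a^m\<close> times \<open>a^m\<close>.\<close>

definition phi :: "nat \<Rightarrow> mon \<Rightarrow> (nat \<Rightarrow> nat) \<Rightarrow> nat" where
  "phi n m N = (\<Prod>k<n. amp (fst m k) (snd m k) (N k))"

text \<open>Up to the factor 2i, the expression is the difference of the eigenvalues of [g_+, g_-]
  at the shift of \<open>N\<close> and at \<open>N\<close>. The modes in \<open>J\<close> are frozen
  at \<open>be j\<close>, which the shift moves to \<open>al j\<close>; the last term vanishes
  because \<open>be k < al k\<close>. All other modes are sent to infinity together, and assumption
  \<open>c\<close> says that the leading coefficients of the two remaining terms differ.\<close>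

lemma infinite_phi_fixed_modes:
  assumes J: "J \<subseteq> {..<n}" "k \<in> J" "be k < al k"
    and c: "2 * (\<Prod>j\<in>J. amp (al j) (be j) (be j)) \<noteq> (\<Prod>j\<in>J. amp (al j) (be j) (al j))"
    and l: "l < n" "l \<notin> J" "0 < al l + be l"
  shows "infinite ((\<lambda>N. 2 * real (phi n (al, be) N) - real (phi n (al, be) (shiftv (al, be) N)) - real (phi n (be, al) N))
     ` {N. \<forall>k<n. be k \<le> N k})" (is "infinite (?V ` ?I)")
proof -
  define NR where "NR R = (\<lambda>j. if j \<in> J then be j else R)" for R :: nat
  define R0 where "R0 = (\<Sum>j<n. be j)"
  have R0: "be j \<le> R" if "j < n" "R0 \<le> R" for j R
    using member_le_sum[of j "{..<n}" be] that by (simp add: R0_def)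
  let ?L = "{..<n} - J"
  have split: "prod g {..<n} = prod g J * prod g ?L" for g :: "nat \<Rightarrow> nat"
    using prod.subset_diff[OF J(1)] by (simp add: mult.commute)
  let ?c1 = "real (2 * (\<Prod>j\<in>J. amp (al j) (be j) (be j)))"
  let ?c2 = "real (\<Prod>j\<in>J. amp (al j) (be j) (al j))"
  let ?P = "\<lambda>l R. real (amp (al l) (be l) R)"
  let ?Q = "\<lambda>l R. real (amp (al l) (be l) (R - be l + al l))"
  have V: "?V (NR R) = ?c1 * (\<Prod>l\<in>?L. ?P l R) - ?c2 * (\<Prod>l\<in>?L. ?Q l R)" for R
  proof -
    have "amp (be k) (al k) (be k) = 0" using J(3) by (simp add: amp_def ffac_eq_0_iff)
    then have "phi n (be, al) (NR R) = 0"
      using J by (auto simp: phi_def NR_def intro!: bexI[of _ k])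
    moreover have "phi n (al, be) (NR R) = (\<Prod>j\<in>J. amp (al j) (be j) (be j)) * (\<Prod>l\<in>?L. amp (al l) (be l) R)"
      unfolding phi_def split by (simp add: NR_def)
    moreover have "phi n (al, be) (shiftv (al, be) (NR R)) = (\<Prod>j\<in>J. amp (al j) (be j) (al j)) * (\<Prod>l\<in>?L. amp (al l) (be l) (R - be l + al l))"
      unfolding phi_def split by (simp add: NR_def shiftv_def)
    ultimately show ?thesis by simp
  qed
  have "infinite ((\<lambda>R. ?c1 * (\<Prod>l\<in>?L. ?P l R) - ?c2 * (\<Prod>l\<in>?L. ?Q l R)) ` {R0..})"
  proof (rule infinite_range_asymp[where P = ?P and Q = ?Q and d = "\<lambda>l. al l + be l"])
    show "(\<lambda>R. ?P l R / real R ^ (al l + be l)) \<longlonglongrightarrow> 1" for l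
      by (rule amp_asymp[where c = 0]) simp
    show "(\<lambda>R. ?Q l R / real R ^ (al l + be l)) \<longlonglongrightarrow> 1" for l
      by (rule amp_asymp[OF eventually_shift[where c = 0]]) simp
    show "?c1 \<noteq> ?c2" using c by (simp only: of_nat_eq_iff not_False_eq_True)
    show "0 < (\<Sum>l\<in>?L. al l + be l)" using l by (auto simp: sum_nonneg_eq_0_iff simp del: sum.distrib intro!: bexI[of _ l] Nat.gr0I)
  qed
  moreover have "(\<lambda>R. ?c1 * (\<Prod>l\<in>?L. ?P l R) - ?c2 * (\<Prod>l\<in>?L. ?Q l R)) ` {R0..} \<subseteq> ?V ` ?I"
  proof (rule image_subsetI)
    fix R assume "R \<in> {R0..}"
    then have "NR R \<in> ?I" using R0 by (auto simp: NR_def)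
    then show "?c1 * (\<Prod>l\<in>?L. ?P l R) - ?c2 * (\<Prod>l\<in>?L. ?Q l R) \<in> ?V ` ?I"
      unfolding V[symmetric] by (rule imageI)
  qed
  ultimately show ?thesis using infinite_super by blast
qed

text \<open>Along the orbit b + t*w of the shift, with \<open>w\<close> the weight of mode
  \<open>k\<close>, the three terms are values of one sequence \<open>q\<close> at consecutive
  points. They form a negated second difference, and \<open>q\<close> grows at least like
  t^(a+b).\<close>

lemma infinite_phi_single_mode:
  assumes k: "k < n" "be k < al k" "3 \<le> al k + be k"
    and l: "\<And>l. l < n \<Longrightarrow> l \<noteq> k \<Longrightarrow> al l = 0 \<and> be l = 0"
  shows "infinite ((\<lambda>N. 2 * real (phi n (al, be) N) - real (phi n (al, be) (shiftv (al, be) N)) - real (phi n (be, al) N))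
     ` {N. \<forall>k<n. be k \<le> N k})" (is "infinite (?V ` ?I)")
proof -
  define a b where "a = al k" and "b = be k"
  obtain w where w: "a = b + w" "0 < w" using k by (auto simp: less_iff_Suc_add a_def b_def)
  define q where "q t = real (amp a b (b + t * w))" for t
  define NR where "NR x = (\<lambda>j. if j = k then x else 0)" for x :: nat
  have one: "prod g {..<n} = g k" if "\<And>j. j < n \<Longrightarrow> j \<noteq> k \<Longrightarrow> g j = 1" for g :: "nat \<Rightarrow> nat"
    using prod.remove[of "{..<n}" k g] k(1) that by simp
  \<comment> \<open>The base point has index \<open>Suc t\<close>, because the adjoint monomial
    refers to the preceding point of the orbit.\<close>
  have V: "?V (NR (b + Suc t * w)) = 2 * q (Suc t) - q (Suc (Suc t)) - q t" for t
  proof -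
    let ?N = "NR (b + Suc t * w)"
    have "phi n (al, be) ?N = amp a b (b + Suc t * w)"
      unfolding phi_def by (subst one) (auto simp: l NR_def a_def b_def)
    moreover have "phi n (al, be) (shiftv (al, be) ?N) = amp a b (b + Suc (Suc t) * w)"
      unfolding phi_def using w by (subst one) (auto simp: l NR_def a_def b_def shiftv_def algebra_simps)
    moreover have "phi n (be, al) ?N = amp b a (b + Suc t * w)"
      unfolding phi_def by (subst one) (auto simp: l NR_def a_def b_def)
    moreover have "amp b a (b + Suc t * w) = amp a b (b + t * w)"
      by (simp add: amp_def w mult.commute add_ac)
    ultimately show ?thesis by (simp only: q_def)
  qed
  have "infinite (range (\<lambda>t. 2 * q (Suc t) - q (Suc (Suc t)) - q t))"
  proof (rule infinite_second_differences)
    fix t :: nat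
    have "t ^ 3 \<le> t ^ (b + a)" using k by (cases "t = 0") (auto simp: a_def b_def power_0_left intro!: power_increasing)
    also have "\<dots> \<le> (t * w) ^ b * (t * w) ^ a"
      unfolding power_add[symmetric] using w by (intro power_mono) auto
    also have "\<dots> \<le> ffac (b + t * w) b * ffac (a + t * w) a"
      by (intro mult_mono ffac_lower) auto
    also have "\<dots> = amp a b (b + t * w)" by (simp add: amp_def add.commute)
    finally show "real t ^ 3 \<le> q t" unfolding q_def of_nat_power[symmetric] of_nat_le_iff .
  qed
  moreover have "range (\<lambda>t. 2 * q (Suc t) - q (Suc (Suc t)) - q t) \<subseteq> ?V ` ?I"
  proof clarify
    fix t
    have "NR (b + Suc t * w) \<in> ?I" using l by (auto simp: NR_def b_def)
    then show "2 * q (Suc t) - q (Suc (Suc t)) - q t \<in> ?V ` ?I"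
      unfolding V[symmetric] by (rule imageI)
  qed
  ultimately show ?thesis using infinite_super by blast
qed

text \<open>If another mode has positive \<open>p\<close>, mode \<open>k\<close> is frozen at
  \<open>p k + be k\<close>, which the shift moves to \<open>p k + al k\<close>; the leading
  coefficients differ by strict monotonicity. Otherwise only mode \<open>k\<close> matters, and the
  values are first differences along an orbit of the shift. Assumption \<open>e\<close> then makes
  the growth at least quadratic and rules out the number operator, whose differences are
  constant.\<close>

lemma infinite_ff_differences:
  assumes k: "k < n" "0 < p k" "al k \<noteq> be k" and e: "2 \<le> e * (\<Sum>l<n. p l)"
  shows "infinite ((\<lambda>N. real (ff n (shiftv (al, be) N) p ^ e) - real (ff n N p ^ e))
     ` {N. \<forall>k<n. be k \<le> N k})" (is "infinite (?V ` ?I)")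
proof (cases "\<exists>l<n. l \<noteq> k \<and> 0 < p l")
  case True
  then obtain l where l: "l < n" "l \<noteq> k" "0 < p l" by blast
  define NR where "NR R = (\<lambda>j. if j = k then p k + be k else R)" for R :: nat
  define R0 where "R0 = (\<Sum>j<n. be j)"
  have R0: "be j \<le> R" if "j < n" "R0 \<le> R" for j R
    using member_le_sum[of j "{..<n}" be] that by (simp add: R0_def)
  let ?L = "{..<n} - {k}"
  have split: "prod g {..<n} = g k * prod g ?L" for g :: "nat \<Rightarrow> nat"
    using prod.remove[of "{..<n}" k g] k(1) by simp
  have e0: "e > 0" using e by (cases e) auto
  let ?c1 = "real (ffac (p k + al k) (p k) ^ e)"
  let ?c2 = "real (ffac (p k + be k) (p k) ^ e)"
  let ?P = "\<lambda>l R. real (ffac (R - be l + al l) (p l) ^ e)"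
  let ?Q = "\<lambda>l R. real (ffac R (p l) ^ e)"
  have V: "?V (NR R) = ?c1 * (\<Prod>l\<in>?L. ?P l R) - ?c2 * (\<Prod>l\<in>?L. ?Q l R)" for R
  proof -
    have "ff n (NR R) p ^ e = ffac (p k + be k) (p k) ^ e * (\<Prod>l\<in>?L. ffac R (p l) ^ e)"
      unfolding ff_def split by (simp add: NR_def power_mult_distrib prod_power_distrib)
    moreover have "ff n (shiftv (al, be) (NR R)) p ^ e = ffac (p k + al k) (p k) ^ e * (\<Prod>l\<in>?L. ffac (R - be l + al l) (p l) ^ e)"
      unfolding ff_def split by (simp add: NR_def shiftv_def power_mult_distrib prod_power_distrib)
    ultimately show ?thesis by simp
  qed
  have "infinite ((\<lambda>R. ?c1 * (\<Prod>l\<in>?L. ?P l R) - ?c2 * (\<Prod>l\<in>?L. ?Q l R)) ` {R0..})"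
  proof (rule infinite_range_asymp[where P = ?P and Q = ?Q and d = "\<lambda>l. p l * e"])
    have pw: "(\<lambda>R. real (f R ^ e) / real R ^ (m * e)) \<longlonglongrightarrow> 1"
      if "(\<lambda>R. real (f R) / real R ^ m) \<longlonglongrightarrow> 1" for f :: "nat \<Rightarrow> nat" and m
      using tendsto_power[OF that, of e] by (simp add: power_divide power_mult)
    show "(\<lambda>R. ?P l R / real R ^ (p l * e)) \<longlonglongrightarrow> 1" for l
      by (rule pw, rule ffac_asymp[OF eventually_shift[where c = 0]]) simp
    show "(\<lambda>R. ?Q l R / real R ^ (p l * e)) \<longlonglongrightarrow> 1" for l
      by (rule pw, rule ffac_asymp[where c = 0]) simp
    have "ffac (p k + al k) (p k) \<noteq> ffac (p k + be k) (p k)"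
      using strict_mono_eq[OF ffac_strict_mono[OF k(2)]] k(3) by simp
    then show "?c1 \<noteq> ?c2" using e0 by (simp only: of_nat_eq_iff power_eq_iff_eq_base zero_le not_False_eq_True)
    show "0 < (\<Sum>l\<in>?L. p l * e)" using l e0 by (auto intro!: bexI[of _ l] Nat.gr0I)
  qed
  moreover have "(\<lambda>R. ?c1 * (\<Prod>l\<in>?L. ?P l R) - ?c2 * (\<Prod>l\<in>?L. ?Q l R)) ` {R0..} \<subseteq> ?V ` ?I"
  proof (rule image_subsetI)
    fix R assume "R \<in> {R0..}"
    then have "NR R \<in> ?I" using R0 by (auto simp: NR_def)
    then show "?c1 * (\<Prod>l\<in>?L. ?P l R) - ?c2 * (\<Prod>l\<in>?L. ?Q l R) \<in> ?V ` ?I"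
      unfolding V[symmetric] by (rule imageI)
  qed
  ultimately show ?thesis using infinite_super by blast
next
  case False
  define a b where "a = al k" and "b = be k"
  define w where "w = (if b < a then a - b else b - a)"
  have w: "0 < w" using k(3) by (auto simp: w_def a_def b_def)
  define q where "q t = real (ffac (p k + (b + t * w)) (p k) ^ e)" for t
  define NR where "NR x = (\<lambda>j. if j = k then x else be j)" for x :: nat
  have one: "prod g {..<n} = g k" if "\<And>j. j < n \<Longrightarrow> j \<noteq> k \<Longrightarrow> g j = 1" for g :: "nat \<Rightarrow> nat"
    using prod.remove[of "{..<n}" k g] k(1) that by simp
  have sp: "(\<Sum>l<n. p l) = p k"
    using sum.remove[of "{..<n}" k p] k(1) False by auto
  have ff: "ff n N p = ffac (N k) (p k)" for N
    unfolding ff_def using False by (intro one) auto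
  have inf: "infinite (range (\<lambda>t. q (Suc t) - q t))"
  proof (rule infinite_first_differences)
    fix t :: nat
    have "t ^ 2 \<le> t ^ (p k * e)" using e sp by (cases "t = 0") (auto simp: mult.commute power_0_left intro!: power_increasing)
    also have "\<dots> \<le> ((b + t * w) ^ p k) ^ e"
      unfolding power_mult[symmetric] using w by (intro power_mono) (auto intro: trans_le_add2)
    also have "\<dots> \<le> ffac (p k + (b + t * w)) (p k) ^ e"
      by (intro power_mono ffac_lower) auto
    finally show "real t ^ 2 \<le> q t" unfolding q_def of_nat_power[symmetric] of_nat_le_iff .
  qed
  have NRk: "shiftv (al, be) (NR x) k = x - b + a" "NR x k = x" for x
    by (simp_all add: NR_def shiftv_def a_def b_def)
  show ?thesis
  proof (cases "b < a")
    case True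
    have V: "?V (NR (p k + (b + t * w))) = q (Suc t) - q t" for t
    proof -
      have "p k + (b + t * w) - b + a = p k + (b + Suc t * w)" using True by (simp add: w_def)
      then show ?thesis unfolding ff q_def NRk by (simp only:)
    qed
    have "range (\<lambda>t. q (Suc t) - q t) \<subseteq> ?V ` ?I"
    proof clarify
      fix t
      have "NR (p k + (b + t * w)) \<in> ?I" by (auto simp: NR_def b_def)
      then show "q (Suc t) - q t \<in> ?V ` ?I" unfolding V[symmetric] by (rule imageI)
    qed
    then show ?thesis using inf infinite_super by blast
  next
    case neg: False
    \<comment> \<open>The weight is negative, so the shift runs down the orbit: the base point is
      the upper one and the difference changes sign.\<close>
    have V: "?V (NR (p k + (b + Suc t * w))) = - (q (Suc t) - q t)" for t
    proof -
      have "p k + (b + Suc t * w) - b + a = p k + (b + t * w)" using neg by (simp add: w_def)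
      then show ?thesis unfolding ff q_def NRk by (simp only: minus_diff_eq)
    qed
    have "uminus ` range (\<lambda>t. q (Suc t) - q t) \<subseteq> ?V ` ?I"
    proof clarify
      fix t
      have "NR (p k + (b + Suc t * w)) \<in> ?I" by (auto simp: NR_def b_def)
      then show "- (q (Suc t) - q t) \<in> ?V ` ?I" unfolding V[symmetric] by (rule imageI)
    qed
    moreover have "infinite (uminus ` range (\<lambda>t. q (Suc t) - q t))"
      using inf by (subst finite_image_iff) auto
    ultimately show ?thesis using infinite_super by blast
  qed
qed

section \<open>Bracket coefficients of monomials\<close>

lemma swapm_simps [simp]: "fst (swapm m) = snd m" "snd (swapm m) = fst m" "swapm (swapm m) = m"
  by (auto simp: swapm_def)

lemma swapm_eq_iff: "swapm m = m \<longleftrightarrow> fst m = snd m" "m = swapm m \<longleftrightarrow> fst m = snd m"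
  by (cases m; auto simp: swapm_def)+

lemma valid_mon_swapm [simp]: "valid_mon n (swapm m) = valid_mon n m"
  by (auto simp: valid_mon_def)

lemma wcoef_nzE:
  assumes "wcoef n m1 m2 m \<noteq> 0"
  obtains j where "\<And>k. fst m k + j k = fst m1 k + fst m2 k" "\<And>k. snd m k + j k = snd m1 k + snd m2 k"
    "\<And>k. j k \<le> snd m1 k" "\<And>k. j k \<le> fst m2 k"
  using wcoef_nzD[of n "fst m1" "snd m1" "fst m2" "snd m2" "fst m" "snd m"] assms
  by (metis prod.collapse)

lemma wcoef_eq:
  assumes "\<And>k. fst m k + j k = fst m1 k + fst m2 k" "\<And>k. snd m k + j k = snd m1 k + snd m2 k"
    "\<And>k. j k \<le> snd m1 k" "\<And>k. j k \<le> fst m2 k"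
  shows "wcoef n m1 m2 m = of_nat (\<Prod>k<n. (snd m1 k choose j k) * (fst m2 k choose j k) * fact (j k))"
  using wcoef_contract[of "fst m" j "fst m1" "fst m2" "snd m" "snd m1" "snd m2" n] assms by simp

text \<open>If both factors were balanced in every contracted mode, the same \<open>j\<close> would
  be a contraction vector for the product in the other order, with equal coefficient, and the two
  terms would cancel.\<close>

lemma bcoef_nz_aux:
  assumes nz: "wcoef n m1 m2 m \<noteq> 0" and b: "bcoef n m1 m2 m \<noteq> 0"
  obtains j k where "\<And>k. fst m k + j k = fst m1 k + fst m2 k" "\<And>k. snd m k + j k = snd m1 k + snd m2 k"
    "\<And>k. j k \<le> snd m1 k" "\<And>k. j k \<le> fst m2 k"
    "0 < j k" "\<not> (fst m1 k = snd m1 k \<and> fst m2 k = snd m2 k)"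
proof -
  obtain j where j: "\<And>k. fst m k + j k = fst m1 k + fst m2 k" "\<And>k. snd m k + j k = snd m1 k + snd m2 k"
    "\<And>k. j k \<le> snd m1 k" "\<And>k. j k \<le> fst m2 k"
    using wcoef_nzE[OF nz] by blast
  have "\<exists>k. 0 < j k \<and> \<not> (fst m1 k = snd m1 k \<and> fst m2 k = snd m2 k)"
  proof (rule ccontr)
    assume "\<not> ?thesis"
    then have c: "j k = 0 \<or> fst m1 k = snd m1 k \<and> fst m2 k = snd m2 k" for k by auto
    have "wcoef n m2 m1 m = of_nat (\<Prod>k<n. (snd m2 k choose j k) * (fst m1 k choose j k) * fact (j k))"
    proof (rule wcoef_eq)
      fix k
      show "fst m k + j k = fst m2 k + fst m1 k" "snd m k + j k = snd m2 k + snd m1 k"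
        using j(1,2)[of k] by auto
      show "j k \<le> snd m2 k" "j k \<le> fst m1 k" using c[of k] j(3,4)[of k] by auto
    qed
    moreover have "wcoef n m1 m2 m = of_nat (\<Prod>k<n. (snd m1 k choose j k) * (fst m2 k choose j k) * fact (j k))"
      by (rule wcoef_eq) (use j in auto)
    moreover have "(snd m1 k choose j k) * (fst m2 k choose j k) * fact (j k) = (snd m2 k choose j k) * (fst m1 k choose j k) * fact (j k)" for k
      using c[of k] by auto
    ultimately show False using b by (simp add: bcoef_def)
  qed
  then show ?thesis using that j by blast
qed

text \<open>The bounds by \<open>max\<close> hold whichever of the two products yields
  \<open>m\<close>.\<close>

lemma bcoef_nzE:
  assumes b: "bcoef n m1 m2 m \<noteq> 0"
  obtains j k where "\<And>k. fst m k + j k = fst m1 k + fst m2 k" "\<And>k. snd m k + j k = snd m1 k + snd m2 k"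
    "\<And>k. j k \<le> max (fst m1 k) (snd m1 k)" "\<And>k. j k \<le> max (fst m2 k) (snd m2 k)"
    "0 < j k" "\<not> (fst m1 k = snd m1 k \<and> fst m2 k = snd m2 k)"
proof (cases "wcoef n m1 m2 m = 0")
  case False
  from bcoef_nz_aux[OF False b] that show ?thesis by (metis max.coboundedI1 max.coboundedI2)
next
  case True
  then have "wcoef n m2 m1 m \<noteq> 0" "bcoef n m2 m1 m \<noteq> 0" using b by (auto simp: bcoef_def)
  from bcoef_nz_aux[OF this] that show ?thesis
    by (metis max.coboundedI1 max.coboundedI2 add.commute)
qed

text \<open>A contraction removes one creation and one annihilation operator of the same mode, so
  weights add.\<close>

lemma bcoef_weight:
  assumes "bcoef n m1 m2 m \<noteq> 0"
  shows "int (fst m k) - int (snd m k) = (int (fst m1 k) - int (snd m1 k)) + (int (fst m2 k) - int (snd m2 k))"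
proof -
  obtain j where "fst m k + j k = fst m1 k + fst m2 k" "snd m k + j k = snd m1 k + snd m2 k"
    using bcoef_nzE[OF assms] by metis
  then show ?thesis by linarith
qed

text \<open>The monomial left after a single contraction, in mode \<open>k\<close>. Brackets are
  shown to be nonzero at such monomials, whose coefficient has a simple closed form.\<close>

definition contr :: "nat \<Rightarrow> mon \<Rightarrow> mon \<Rightarrow> mon" where
  "contr k m1 m2 = (\<lambda>i. fst m1 i + fst m2 i - unit_vec k i, \<lambda>i. snd m1 i + snd m2 i - unit_vec k i)"

lemma contr_commute: "contr k m1 m2 = contr k m2 m1"
  by (simp add: contr_def add.commute)

lemma wcoef_contr:
  assumes "k < n" "0 < fst m1 k + fst m2 k" "0 < snd m1 k + snd m2 k"
  shows "wcoef n m1 m2 (contr k m1 m2) = of_nat (snd m1 k * fst m2 k)"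
proof (cases "snd m1 k = 0 \<or> fst m2 k = 0")
  case True
  have "wcoef n m1 m2 (contr k m1 m2) = 0"
  proof (rule ccontr)
    assume "wcoef n m1 m2 (contr k m1 m2) \<noteq> 0"
    then obtain j where "fst (contr k m1 m2) k + j k = fst m1 k + fst m2 k" "j k \<le> snd m1 k" "j k \<le> fst m2 k"
      using wcoef_nzE by metis
    then show False using True assms by (auto simp: contr_def unit_vec_def)
  qed
  then show ?thesis using True by auto
next
  case False
  have "wcoef n m1 m2 (contr k m1 m2) = of_nat (\<Prod>i<n. (snd m1 i choose unit_vec k i) * (fst m2 i choose unit_vec k i) * fact (unit_vec k i))"
    by (rule wcoef_eq) (use False in \<open>auto simp: contr_def unit_vec_def\<close>)
  also have "(\<Prod>i<n. (snd m1 i choose unit_vec k i) * (fst m2 i choose unit_vec k i) * fact (unit_vec k i))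
     = (\<Prod>i<n. if i = k then snd m1 k * fst m2 k else 1)"
    by (intro prod.cong) (auto simp: unit_vec_def)
  also have "\<dots> = snd m1 k * fst m2 k" using assms(1) by (simp add: prod.delta)
  finally show ?thesis .
qed

lemma bcoef_contr:
  assumes "k < n" "0 < fst m1 k + fst m2 k" "0 < snd m1 k + snd m2 k"
  shows "bcoef n m1 m2 (contr k m1 m2) = of_nat (snd m1 k * fst m2 k) - of_nat (snd m2 k * fst m1 k)"
  using wcoef_contr[OF assms] wcoef_contr[of k n m2 m1] assms
  by (simp add: bcoef_def contr_commute[of k m1 m2] add.commute)

text \<open>A monomial reached from only one pair of monomials cannot be cancelled; this is how
  brackets are shown to be nonzero.\<close>

lemma wbr_single:
  assumes x: "finite (wsupp x)" and y: "finite (wsupp y)"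
    and u: "\<And>a b. a \<in> wsupp x \<Longrightarrow> b \<in> wsupp y \<Longrightarrow> bcoef n a b m \<noteq> 0 \<Longrightarrow> a = a0 \<and> b = b0"
  shows "wbr n x y m = x a0 * y b0 * bcoef n a0 b0 m"
proof -
  let ?A = "insert a0 (wsupp x)" and ?B = "insert b0 (wsupp y)"
  have "wbr n x y m = (\<Sum>a\<in>?A. \<Sum>b\<in>?B. x a * y b * bcoef n a b m)"
    by (rule wbr_superset) (use x y in auto)
  also have "\<dots> = (\<Sum>a\<in>?A. \<Sum>b\<in>?B. if a = a0 \<and> b = b0 then x a0 * y b0 * bcoef n a0 b0 m else 0)"
  proof (intro sum.cong refl)
    fix a b
    show "x a * y b * bcoef n a b m = (if a = a0 \<and> b = b0 then x a0 * y b0 * bcoef n a0 b0 m else 0)"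
      using u[of a b] by (auto simp: wsupp_def)
  qed
  also have "\<dots> = (\<Sum>a\<in>?A. if a = a0 then x a0 * y b0 * bcoef n a0 b0 m else 0)"
    by (intro sum.cong refl) (use y in \<open>auto simp: sum.delta\<close>)
  also have "\<dots> = x a0 * y b0 * bcoef n a0 b0 m" using x by (simp add: sum.delta)
  finally show ?thesis .
qed

lemma wbr_nzE:
  assumes "wbr n x y m \<noteq> 0" "finite (wsupp x)" "finite (wsupp y)"
  obtains a b where "a \<in> wsupp x" "b \<in> wsupp y" "bcoef n a b m \<noteq> 0"
proof -
  have "(\<Sum>a\<in>wsupp x. \<Sum>b\<in>wsupp y. x a * y b * bcoef n a b m) \<noteq> 0"
    using assms wbr_superset[of "wsupp x" x "wsupp y" y n m] by simp
  then show ?thesis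
    by (elim sum.not_neutral_contains_not_neutral) (use that in auto)
qed

lemma wcoef_swapm: "wcoef n (swapm m2) (swapm m1) (swapm m) = wcoef n m1 m2 m"
proof -
  have *: "wcoef n (swapm m2) (swapm m1) (swapm m) = wcoef n m1 m2 m" if nz: "wcoef n m1 m2 m \<noteq> 0" for m1 m2 m
  proof -
    obtain j where j: "\<And>k. fst m k + j k = fst m1 k + fst m2 k" "\<And>k. snd m k + j k = snd m1 k + snd m2 k"
      "\<And>k. j k \<le> snd m1 k" "\<And>k. j k \<le> fst m2 k"
      using wcoef_nzE[OF nz] by blast
    have "wcoef n m1 m2 m = of_nat (\<Prod>k<n. (snd m1 k choose j k) * (fst m2 k choose j k) * fact (j k))"
      by (rule wcoef_eq) (use j in auto)
    moreover have "wcoef n (swapm m2) (swapm m1) (swapm m) = of_nat (\<Prod>k<n. (snd (swapm m2) k choose j k) * (fst (swapm m1) k choose j k) * fact (j k))"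
      by (rule wcoef_eq) (use j in \<open>auto simp: add.commute\<close>)
    ultimately show ?thesis by (simp add: mult_ac)
  qed
  show ?thesis
    using *[of m1 m2 m] *[of "swapm m2" "swapm m1" "swapm m"] by (cases "wcoef n m1 m2 m = 0") auto
qed

lemma bcoef_swapm: "bcoef n (swapm m1) (swapm m2) (swapm m) = - bcoef n m1 m2 m"
  by (simp add: bcoef_def wcoef_swapm)

lemma cnj_bcoef: "cnj (bcoef n m1 m2 m) = bcoef n m1 m2 m"
  by (simp add: bcoef_def wcoef_def Let_def del: of_nat_prod)

section \<open>Basis elements\<close>

lemma wdag_mono: "wdag (Defs.mono m) = Defs.mono (swapm m)"
proof
  fix m'
  have "swapm m' = m \<longleftrightarrow> m' = swapm m" by (metis swapm_simps(3))
  then show "wdag (Defs.mono m) m' = Defs.mono (swapm m) m'"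
    by (simp add: wdag_def Defs.mono_def)
qed

lemma gplus_eq: "gplus m = (\<lambda>m'. \<i> * (Defs.mono (swapm m) m' + Defs.mono m m'))"
  by (simp add: gplus_def wdag_mono)

lemma gminus_eq: "gminus m = (\<lambda>m'. Defs.mono (swapm m) m' + (-1) * Defs.mono m m')"
  by (simp add: gminus_def wdag_mono)

lemma wsupp_mono: "wsupp (Defs.mono m) = {m}"
  by (auto simp: wsupp_def Defs.mono_def)

lemma in_weyl_mono: "valid_mon n m \<Longrightarrow> in_weyl n (Defs.mono m)"
  by (simp add: in_weyl_def wsupp_mono)

lemma in_weyl_gsig: "valid_mon n m \<Longrightarrow> in_weyl n (gsig s m)"
  unfolding gsig_def gplus_eq gminus_eq
  by (cases s; simp only: if_True if_False; intro in_weyl_scale in_weyl_add in_weyl_mono; simp)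

lemma wsupp_gsig: "wsupp (gsig s m) \<subseteq> {m, swapm m}"
  by (auto simp: wsupp_def gsig_def gplus_eq gminus_eq Defs.mono_def split: if_splits)

lemma finite_wsupp_gsig [simp]: "finite (wsupp (gsig s m))"
  using wsupp_gsig by (rule finite_subset) simp

lemma gsig_nz:
  assumes "s \<or> fst m \<noteq> snd m"
  shows "gsig s m m \<noteq> 0" "gsig s m (swapm m) \<noteq> 0"
  using assms by (auto simp: gsig_def gplus_eq gminus_eq Defs.mono_def swapm_eq_iff)

lemma wdag_gsig: "wdag (gsig s m) = (\<lambda>m'. - gsig s m m')"
proof
  fix m'
  have "swapm m' = m \<longleftrightarrow> m' = swapm m" "swapm m' = swapm m \<longleftrightarrow> m' = m"
    by (metis swapm_simps(3))+
  then show "wdag (gsig s m) m' = - gsig s m m'"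
    by (simp add: wdag_def gsig_def gplus_eq gminus_eq Defs.mono_def)
qed

lemma gsig_Ahat: "valid_mon n m \<Longrightarrow> gsig s m \<in> Ahat n"
  by (simp add: Ahat_def in_weyl_gsig wdag_gsig)

lemma AhatD: "x \<in> Ahat n \<Longrightarrow> x (swapm m) = - cnj (x m)"
proof -
  assume "x \<in> Ahat n"
  then have "wdag x (swapm m) = - x (swapm m)" by (simp add: Ahat_def)
  then show ?thesis by (simp add: wdag_def)
qed

text \<open>The support of a skew-hermitian element is invariant under \<open>swapm\<close>, so both
  sums can be reindexed along it; \<open>bcoef_swapm\<close> supplies the sign.\<close>

lemma wbr_Ahat:
  assumes x: "x \<in> Ahat n" and y: "y \<in> Ahat n"
  shows "wbr n x y \<in> Ahat n"
proof -
  have w: "in_weyl n x" "in_weyl n y" using x y by (auto simp: Ahat_def)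
  then have fin: "finite (wsupp x)" "finite (wsupp y)" by (auto simp: in_weyl_def)
  have "bij_betw swapm (wsupp z) (wsupp z)" if "z \<in> Ahat n" for z
    by (rule bij_betwI[where g = swapm]) (auto simp: wsupp_def AhatD[OF that])
  note re = sum.reindex_bij_betw[OF this[OF x]] sum.reindex_bij_betw[OF this[OF y]]
  have "wdag (wbr n x y) m = - wbr n x y m" for m
  proof -
    have "wdag (wbr n x y) m = (\<Sum>a\<in>wsupp x. \<Sum>b\<in>wsupp y. cnj (x a) * cnj (y b) * bcoef n a b (swapm m))"
      by (simp add: wdag_def wbr_superset[OF fin(1) order_refl fin(2) order_refl] cnj_bcoef)
    also have "\<dots> = (\<Sum>a\<in>wsupp x. \<Sum>b\<in>wsupp y. - (x (swapm a) * y (swapm b) * bcoef n (swapm a) (swapm b) m))"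
    proof (intro sum.cong refl)
      fix a b
      show "cnj (x a) * cnj (y b) * bcoef n a b (swapm m) = - (x (swapm a) * y (swapm b) * bcoef n (swapm a) (swapm b) m)"
        using bcoef_swapm[of n a b "swapm m"] by (simp add: AhatD[OF x] AhatD[OF y])
    qed
    also have "\<dots> = - wbr n x y m"
      unfolding sum_negf re(2)[of "\<lambda>b. x (swapm a) * y b * bcoef n (swapm a) b m" for a]
        re(1)[of "\<lambda>a. \<Sum>b\<in>wsupp y. x a * y b * bcoef n a b m"]
      by (simp add: wbr_superset[OF fin(1) order_refl fin(2) order_refl])
    finally show ?thesis .
  qed
  then show ?thesis using in_weyl_wbr[OF w] by (auto simp: Ahat_def)
qed

section \<open>Real spans of basis elements\<close>

lemma rspan_eq_span:
  "rspan S = module.span (\<lambda>(c::real) (f::welem). (\<lambda>m. complex_of_real c * f m)) S"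
proof -
  interpret V: vector_space "\<lambda>(c::real) (f::welem). (\<lambda>m. complex_of_real c * f m)"
    by (rule vector_space_welem)
  have sum_apply: "sum g S = (\<lambda>m. \<Sum>x\<in>S. g x m)" if "finite S" for g :: "'z \<Rightarrow> welem" and S
    using that by induction auto
  show ?thesis
    unfolding V.span_explicit rspan_def
    by (intro Collect_cong ex_cong1) (auto simp: sum_apply)
qed

lemma rspan_add: "x \<in> rspan S \<Longrightarrow> y \<in> rspan S \<Longrightarrow> (\<lambda>m. x m + y m) \<in> rspan S"
proof -
  interpret V: vector_space "\<lambda>(c::real) (f::welem). (\<lambda>m. complex_of_real c * f m)"
    by (rule vector_space_welem)
  show "x \<in> rspan S \<Longrightarrow> y \<in> rspan S \<Longrightarrow> (\<lambda>m. x m + y m) \<in> rspan S"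
    using V.span_add[of x S y] by (simp add: rspan_eq_span plus_fun_def)
qed

lemma rspan_scale: "x \<in> rspan S \<Longrightarrow> (\<lambda>m. complex_of_real c * x m) \<in> rspan S"
proof -
  interpret V: vector_space "\<lambda>(c::real) (f::welem). (\<lambda>m. complex_of_real c * f m)"
    by (rule vector_space_welem)
  show "x \<in> rspan S \<Longrightarrow> (\<lambda>m. complex_of_real c * x m) \<in> rspan S"
    using V.span_scale[of x S c] by (simp add: rspan_eq_span)
qed

lemma rspan_base: "x \<in> S \<Longrightarrow> x \<in> rspan S"
proof -
  interpret V: vector_space "\<lambda>(c::real) (f::welem). (\<lambda>m. complex_of_real c * f m)"
    by (rule vector_space_welem)
  show "x \<in> S \<Longrightarrow> x \<in> rspan S" using V.span_base[of x S] by (simp add: rspan_eq_span)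
qed

lemma rspan_0: "(\<lambda>m. 0) \<in> rspan S"
  unfolding rspan_def by (intro CollectI exI[of _ "{}"] exI) auto

lemma rspan_sum:
  assumes "\<And>i. i \<in> I \<Longrightarrow> t i \<in> rspan S"
  shows "(\<lambda>m. \<Sum>i\<in>I. t i m) \<in> rspan S"
  using assms by (induction I rule: infinite_finite_induct) (auto simp: rspan_0 intro!: rspan_add)

lemma rspan_wsupp:
  assumes "x \<in> rspan S" "m \<in> wsupp x"
  obtains b where "b \<in> S" "m \<in> wsupp b"
proof -
  obtain F c where F: "F \<subseteq> S" "x = (\<lambda>m. \<Sum>b\<in>F. complex_of_real (c b) * b m)"
    using assms(1) by (auto simp: rspan_def)
  have "(\<Sum>b\<in>F. complex_of_real (c b) * b m) \<noteq> 0" using assms(2) F(2) by (simp add: wsupp_def)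
  then show ?thesis
    by (elim sum.not_neutral_contains_not_neutral) (use F that in \<open>auto simp: wsupp_def\<close>)
qed

lemma mclass_swapm [simp]: "mclass n (swapm m) = mclass n m"
proof -
  have "mdeg n (swapm m) = mdeg n m" by (simp add: mdeg_def add.commute)
  moreover have "is_om n (swapm m) = is_om n m"
    unfolding is_om_def swapm_simps calculation by (simp add: add.commute eq_commute)
  ultimately show ?thesis by (auto simp: mclass_def)
qed

lemma Asub_wsupp:
  assumes "x \<in> Asub n K" "m \<in> wsupp x"
  shows "mclass n m = K"
proof -
  obtain s m0 where "mclass n m0 = K" "m \<in> wsupp (gsig s m0)"
    using assms unfolding Asub_def by (elim rspan_wsupp) auto
  then show ?thesis using wsupp_gsig[of s m0] by auto
qed

lemma lex_gt_neq: "lex_gt n a b \<Longrightarrow> a \<noteq> b"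
  by (auto simp: lex_gt_def)

lemma lex_gt_asym: "lex_gt n a b \<Longrightarrow> \<not> lex_gt n b a"
proof
  assume "lex_gt n a b" "lex_gt n b a"
  then obtain k l where k: "a k > b k" "\<forall>j<k. a j = b j" and l: "b l > a l" "\<forall>j<l. b j = a j"
    unfolding lex_gt_def by blast
  show False using k l by (cases k l rule: linorder_cases) auto
qed

lemma lex_gt_total:
  assumes "valid_mon n (a, b)" "a \<noteq> b"
  shows "lex_gt n a b \<or> lex_gt n b a"
proof -
  define k where "k = (LEAST k. a k \<noteq> b k)"
  obtain k0 where "a k0 \<noteq> b k0" using assms(2) by auto
  then have k: "a k \<noteq> b k" unfolding k_def by (rule LeastI)
  have j: "\<forall>j<k. a j = b j" unfolding k_def using not_less_Least by blast
  have "k < n" using k assms(1) by (auto simp: valid_mon_def) (metis not_le)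
  then show ?thesis using k j unfolding lex_gt_def by (metis linorder_neqE_nat)
qed

lemma gsig_Asub_iff:
  assumes "is_basis_gamma n s m"
  shows "gsig s m \<in> Asub n K \<longleftrightarrow> mclass n m = K"
proof
  have "s \<or> fst m \<noteq> snd m" using assms lex_gt_neq by (auto simp: is_basis_gamma_def split: if_splits)
  then have "m \<in> wsupp (gsig s m)" by (simp add: wsupp_def gsig_nz)
  then show "gsig s m \<in> Asub n K \<Longrightarrow> mclass n m = K" using Asub_wsupp by blast
  show "mclass n m = K \<Longrightarrow> gsig s m \<in> Asub n K"
    unfolding Asub_def using assms by (intro rspan_base) blast
qed

text \<open>Skew-hermiticity determines the coefficient at \<open>swapm m\<close> from the one at
  \<open>m\<close>, so the two together form a real combination of g_+ and g_-. The set
  \<open>P\<close> picks the lexicographically larger monomial of each pair.\<close>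

lemma Ahat_AsubI:
  assumes x: "x \<in> Ahat n" and K: "\<And>m. m \<in> wsupp x \<Longrightarrow> mclass n m = K"
  shows "x \<in> Asub n K"
proof -
  define P where "P = {m \<in> wsupp x. lex_gt n (fst m) (snd m) \<or> fst m = snd m}"
  define t where "t m = (\<lambda>m'. if m' = m \<or> m' = swapm m then x m' else 0)" for m
  have fin: "finite P" and val: "\<And>m. m \<in> wsupp x \<Longrightarrow> valid_mon n m"
    using x by (auto simp: P_def Ahat_def in_weyl_def)
  let ?S = "{x. \<exists>s m. is_basis_gamma n s m \<and> mclass n m = K \<and> x = gsig s m}"
  have t: "t m \<in> rspan ?S" if m: "m \<in> P" for m
  proof (cases "fst m = snd m")
    case True
    have "is_basis_gamma n True m" "mclass n m = K"
      using m True val[of m] K[of m] by (auto simp: P_def is_basis_gamma_def)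
    then have "gsig True m \<in> ?S" by blast
    \<comment> \<open>On a diagonal monomial g_+ is 2i times the monomial, hence the division by
      2.\<close>
    then have "(\<lambda>m'. complex_of_real (Im (x m) / 2) * gsig True m m') \<in> rspan ?S"
      by (intro rspan_scale rspan_base)
    moreover have xm: "complex_of_real (Im (x m)) * \<i> = x m"
      using AhatD[OF x, of m] True by (simp add: swapm_eq_iff[THEN iffD2] complex_eq_iff)
    have "t m = (\<lambda>m'. complex_of_real (Im (x m) / 2) * gsig True m m')"
    proof
      fix m'
      show "t m m' = complex_of_real (Im (x m) / 2) * gsig True m m'"
        using True xm by (cases "m' = m") (simp_all add: t_def gsig_def gplus_eq Defs.mono_def swapm_eq_iff[THEN iffD2])
    qed
    ultimately show ?thesis by simp
  next
    case False
    then have "is_basis_gamma n True m" "is_basis_gamma n False m" "mclass n m = K"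
      using m val[of m] K[of m] by (auto simp: P_def is_basis_gamma_def)
    then have "gsig True m \<in> ?S" "gsig False m \<in> ?S" by blast+
    then have "(\<lambda>m'. complex_of_real (Im (x m)) * gsig True m m' + complex_of_real (- Re (x m)) * gsig False m m') \<in> rspan ?S"
      by (intro rspan_add rspan_scale rspan_base)
    moreover have "t m = (\<lambda>m'. complex_of_real (Im (x m)) * gsig True m m' + complex_of_real (- Re (x m)) * gsig False m m')"
    proof
      fix m'
      show "t m m' = complex_of_real (Im (x m)) * gsig True m m' + complex_of_real (- Re (x m)) * gsig False m m'"
        using False AhatD[OF x, of m]
        by (cases "m' = m"; cases "m' = swapm m")
          (auto simp: t_def gsig_def gplus_eq gminus_eq Defs.mono_def swapm_eq_iff complex_eq_iff)
    qed
    ultimately show ?thesis by simp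
  qed
  have "x = (\<lambda>m'. \<Sum>m\<in>P. t m m')"
  proof
    fix m'
    show "x m' = (\<Sum>m\<in>P. t m m')"
    proof (cases "m' \<in> wsupp x")
      case False
      then have "t m m' = 0" for m by (auto simp: t_def wsupp_def)
      with False show ?thesis by (simp add: wsupp_def)
    next
      case True
      have v: "valid_mon n m'" by (rule val[OF True])
      have sw: "swapm m' \<in> wsupp x" using True AhatD[OF x, of m'] by (simp add: wsupp_def)
      obtain m0 where m0: "m0 \<in> P" "m' = m0 \<or> m' = swapm m0"
      proof (cases "lex_gt n (fst m') (snd m') \<or> fst m' = snd m'")
        case True
        then show ?thesis using that[of m'] \<open>m' \<in> wsupp x\<close> by (simp add: P_def)
      next
        case False
        then have "lex_gt n (snd m') (fst m')"
          using lex_gt_total[of n "fst m'" "snd m'"] v by auto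
        then show ?thesis using that[of "swapm m'"] sw by (simp add: P_def)
      qed
      have uniq: "m = m0" if "m \<in> P" "m' = m \<or> m' = swapm m" for m
      proof (rule ccontr)
        assume ne: "m \<noteq> m0"
        with m0(2) that(2) have "m0 = swapm m" by (metis swapm_simps(3))
        with m0(1) that(1) ne show False
          using lex_gt_asym[of n "fst m" "snd m"] swapm_eq_iff[of m] by (auto simp: P_def)
      qed
      have "(\<Sum>m\<in>P. t m m') = (\<Sum>m\<in>P. if m = m0 then x m' else 0)"
      proof (intro sum.cong refl)
        fix m assume "m \<in> P"
        then have "m' = m \<or> m' = swapm m \<longleftrightarrow> m = m0" using uniq m0(2) by blast
        then show "t m m' = (if m = m0 then x m' else 0)" by (simp only: t_def)
      qed
      also have "\<dots> = x m'" using fin m0 by (simp add: sum.delta)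
      finally show ?thesis by simp
    qed
  qed
  with rspan_sum[of P t ?S] t show ?thesis by (simp add: Asub_def)
qed

section \<open>Obstructions to finite dimension\<close>

definition rmon :: "nat \<Rightarrow> mon \<Rightarrow> ((nat \<Rightarrow> nat) \<Rightarrow> complex) \<Rightarrow> (nat \<Rightarrow> nat) \<Rightarrow> complex" where
  "rmon n m \<psi> N = of_nat (ff n N (snd m)) * \<psi> (shiftv m N)"

lemma rep_mono: "rep n (Defs.mono m) \<psi> N = rmon n m \<psi> N"
  unfolding rep_def wsupp_mono by (simp add: rmon_def Defs.mono_def)

lemma rep_gplus:
  assumes "valid_mon n m"
  shows "rep n (gplus m) \<psi> N = \<i> * (rmon n (swapm m) \<psi> N + rmon n m \<psi> N)"
proof -
  have w: "in_weyl n (Defs.mono m)" "in_weyl n (Defs.mono (swapm m))"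
    using assms by (auto intro: in_weyl_mono)
  show ?thesis unfolding gplus_eq
    by (subst rep_scale) (auto intro: in_weyl_add w simp: rep_add w rep_mono)
qed

lemma rep_gminus:
  assumes "valid_mon n m"
  shows "rep n (gminus m) \<psi> N = rmon n (swapm m) \<psi> N - rmon n m \<psi> N"
proof -
  have w: "in_weyl n (Defs.mono m)" "in_weyl n (Defs.mono (swapm m))"
    using assms by (auto intro: in_weyl_mono)
  show ?thesis unfolding gminus_eq
    by (subst rep_add[OF w(2) in_weyl_scale[OF w(1)]], subst rep_scale[OF w(1)]) (simp add: rep_mono)
qed

lemma rmon_swapm_rmon:
  assumes v: "valid_mon n m"
  shows "rmon n (swapm m) (rmon n m \<psi>) N = of_nat (phi n (swapm m) N) * \<psi> N"
proof -
  have phi: "phi n (swapm m) N = ff n N (fst m) * ff n (shiftv (swapm m) N) (snd m)"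
    by (simp add: phi_def ff_def amp_def shiftv_def prod.distrib)
  have "shiftv m (shiftv (swapm m) N) = N" if "ff n N (fst m) \<noteq> 0"
  proof
    fix k
    show "shiftv m (shiftv (swapm m) N) k = N k"
    proof (cases "k < n")
      case True
      then have "fst m k \<le> N k" using ff_nzD[OF that] by blast
      then show ?thesis by (simp add: shiftv_def)
    next
      case False
      then show ?thesis using v by (simp add: shiftv_def valid_mon_def)
    qed
  qed
  then show ?thesis by (cases "ff n N (fst m) = 0") (auto simp: rmon_def phi)
qed

text \<open>With d the adjoint of m, [i(d + m), d - m] = 2i(m d - d m): the squares cancel, and both
  remaining products are diagonal.\<close>

lemma rep_wbr_gplus_gminus:
  assumes v: "valid_mon n m"
  shows "rep n (wbr n (gplus m) (gminus m)) \<psi> N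
    = 2 * \<i> * (of_nat (phi n (swapm m) N) - of_nat (phi n m N)) * \<psi> N"
proof -
  have w: "in_weyl n (gplus m)" "in_weyl n (gminus m)"
    using in_weyl_gsig[OF v, of True] in_weyl_gsig[OF v, of False] by (auto simp: gsig_def)
  have lin: "rmon n m' (\<lambda>K. \<i> * (f K + g K)) N = \<i> * (rmon n m' f N + rmon n m' g N)"
    "rmon n m' (\<lambda>K. f K - g K) N = rmon n m' f N - rmon n m' g N" for m' f g
    by (auto simp: rmon_def algebra_simps)
  have e: "rep n (gplus m) \<psi> = (\<lambda>K. \<i> * (rmon n (swapm m) \<psi> K + rmon n m \<psi> K))"
    "rep n (gminus m) \<psi> = (\<lambda>K. rmon n (swapm m) \<psi> K - rmon n m \<psi> K)"
    by (auto simp: rep_gplus rep_gminus v)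
  have 1: "rmon n (swapm m) (rmon n m \<psi>) N = of_nat (phi n (swapm m) N) * \<psi> N"
    by (rule rmon_swapm_rmon[OF v])
  have 2: "rmon n m (rmon n (swapm m) \<psi>) N = of_nat (phi n m N) * \<psi> N"
    using rmon_swapm_rmon[of n "swapm m" \<psi> N] v by simp
  show ?thesis
    unfolding rep_wbr[OF w] e rep_gplus[OF v] rep_gminus[OF v] lin 1 2
    by (simp add: algebra_simps)
qed

text \<open>Where \<open>m\<close> and its adjoint both act nontrivially, they lead to different
  occupation numbers, so the adjoint contributes nothing to this entry.\<close>

lemma rep_gsig_entry:
  assumes v: "valid_mon n m" and ne: "fst m \<noteq> snd m" and N: "\<forall>k<n. snd m k \<le> N k"
  shows "rep n (gsig s m) (\<lambda>K. if K = shiftv m N then 1 else 0) N \<noteq> 0"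
proof -
  let ?\<delta> = "\<lambda>K. if K = shiftv m N then 1 else 0 :: complex"
  have "rmon n (swapm m) ?\<delta> N = 0"
  proof (rule ccontr)
    assume nz: "rmon n (swapm m) ?\<delta> N \<noteq> 0"
    then have eq: "shiftv (swapm m) N = shiftv m N" and f: "ff n N (fst m) \<noteq> 0"
      by (auto simp: rmon_def split: if_splits)
    obtain k where k: "fst m k \<noteq> snd m k" using ne by auto
    then have "k < n" using v by (auto simp: valid_mon_def) (metis not_le)
    then have "fst m k \<le> N k" "snd m k \<le> N k" using ff_nzD[OF f] N by auto
    with fun_cong[OF eq, of k] k show False by (simp add: shiftv_def)
  qed
  moreover have "rmon n m ?\<delta> N \<noteq> 0"
    using N by (auto simp: rmon_def ff_eq_0_iff not_less)
  ultimately show ?thesis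
    using v by (cases s) (simp_all add: gsig_def rep_gplus rep_gminus)
qed

lemma infinite_scaled:
  fixes f :: "'i \<Rightarrow> real" and g :: "'i \<Rightarrow> complex"
  assumes "infinite (f ` I)" "c \<noteq> 0" "\<And>N. N \<in> I \<Longrightarrow> g N = c * of_real (f N)"
  shows "infinite (g ` I)"
proof -
  have "g ` I = (\<lambda>r. c * complex_of_real r) ` f ` I"
    using assms(3) by (force simp: image_image intro!: image_cong)
  moreover have "inj_on (\<lambda>r. c * complex_of_real r) (f ` I)"
    using assms(2) by (auto simp: inj_on_def)
  ultimately show ?thesis using assms(1) by (simp add: finite_image_iff)
qed

text \<open>A monomial and its adjoint join the same two occupation vectors in opposite directions,
  with the same two factors.\<close>

lemma phi_swapm_shiftv:
  assumes "\<forall>k<n. snd m k \<le> N k"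
  shows "phi n (swapm m) (shiftv m N) = phi n m N"
  unfolding phi_def
proof (intro prod.cong refl)
  fix k assume "k \<in> {..<n}"
  then have "snd m k \<le> N k" using assms by auto
  then show "amp (fst (swapm m) k) (snd (swapm m) k) (shiftv m N k) = amp (fst m k) (snd m k) (N k)"
    by (simp add: amp_def shiftv_def)
qed

section \<open>Unbounded eigenvalue differences for monomials of class \<open>perp\<close>\<close>

definition phi_unbounded :: "nat \<Rightarrow> mon \<Rightarrow> bool" where
  "phi_unbounded n m \<longleftrightarrow>
     infinite ((\<lambda>N. 2 * real (phi n m N) - real (phi n m (shiftv m N)) - real (phi n (swapm m) N))
       ` {N. \<forall>k<n. snd m k \<le> N k})"

lemma phi_unbounded_high_mode:
  assumes k: "k < n" "be k < al k" "2 \<le> al k + be k" and sum: "3 \<le> (\<Sum>k<n. al k + be k)"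
  shows "phi_unbounded n (al, be)"
proof (cases "\<exists>l<n. l \<noteq> k \<and> 0 < al l + be l")
  case True
  then obtain l where l: "l < n" "l \<noteq> k" "0 < al l + be l" by auto
  show ?thesis unfolding phi_unbounded_def swapm_def fst_conv snd_conv
  proof (rule infinite_phi_fixed_modes[where J = "{k}" and k = k and l = l])
    show "2 * (\<Prod>j\<in>{k}. amp (al j) (be j) (be j)) \<noteq> (\<Prod>j\<in>{k}. amp (al j) (be j) (al j))"
      using amp_jump[OF k(2,3)] by simp
  qed (use k l in auto)
next
  case False
  have "(\<Sum>k<n. al k + be k) = (\<Sum>k\<in>{k}. al k + be k)"
    by (rule sum.mono_neutral_right) (use k(1) False in auto)
  with sum have k3: "3 \<le> al k + be k" by simp
  show ?thesis unfolding phi_unbounded_def swapm_def fst_conv snd_conv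
    by (rule infinite_phi_single_mode[where k = k and al = al and be = be, OF k(1,2) k3]) (use False in auto)
qed

text \<open>Freezing mode \<open>j\<close> alone would fail: \<open>amp 1 0\<close> is 1 at 0 and 2
  at 1, so the leading coefficients agree. This is the exception made for class \<open>om\<close>.
  Freezing the second mode too changes the comparison to 2 against 4, or 2 against 0. Degree at
  least 3 leaves a further mode to send to infinity.\<close>

lemma phi_unbounded_two_modes:
  assumes j: "j < n" "al j = 1" "be j = 0" and k: "k < n" "k \<noteq> j" "al k + be k = 1"
    and sum: "3 \<le> (\<Sum>k<n. al k + be k)"
  shows "phi_unbounded n (al, be)"
proof -
  have "\<exists>l<n. l \<notin> {j, k} \<and> 0 < al l + be l"
  proof (rule ccontr)
    assume no: "\<not> ?thesis"
    have "(\<Sum>k<n. al k + be k) = (\<Sum>k\<in>{j,k}. al k + be k)"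
      by (rule sum.mono_neutral_right) (use no j k in auto)
    also have "\<dots> = 2" using j k by auto
    finally show False using sum by simp
  qed
  then obtain l where l: "l < n" "l \<notin> {j, k}" "0 < al l + be l" by auto
  have "al k = 1 \<and> be k = 0 \<or> al k = 0 \<and> be k = 1" using k(3) by arith
  then have c: "2 * (\<Prod>i\<in>{j,k}. amp (al i) (be i) (be i)) \<noteq> (\<Prod>i\<in>{j,k}. amp (al i) (be i) (al i))"
    using j k(2) by (auto simp: amp_def ffac_def)
  show ?thesis unfolding phi_unbounded_def swapm_def fst_conv snd_conv
    by (rule infinite_phi_fixed_modes[where J = "{j,k}" and k = j and l = l and al = al and be = be, OF _ _ _ c])
      (use l j k in auto)
qed

text \<open>Either some unbalanced mode has total exponent at least 2, or all unbalanced modes have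
  total exponent 1, and then there are at least two of them since \<open>m\<close> is not of class
  \<open>om\<close>. Passing to the adjoint makes the creation exponent the larger one in the chosen
  mode.\<close>

lemma phi_unbounded_perp:
  assumes v: "valid_mon n m" and ne: "fst m \<noteq> snd m" and d: "3 \<le> mdeg n m" and om: "\<not> is_om n m"
  shows "\<exists>m'\<in>{m, swapm m}. phi_unbounded n m'"
proof -
  have d': "3 \<le> (\<Sum>k<n. fst m k + snd m k)" "3 \<le> (\<Sum>k<n. snd m k + fst m k)"
    using d by (auto simp: mdeg_def add.commute)
  have sw: ?thesis if "phi_unbounded n (fst m, snd m) \<or> phi_unbounded n (snd m, fst m)"
    using that by (simp add: swapm_def)
  show ?thesis
  proof (cases "\<exists>k<n. fst m k \<noteq> snd m k \<and> 2 \<le> fst m k + snd m k")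
    case True
    then obtain k where k: "k < n" "fst m k \<noteq> snd m k" "2 \<le> fst m k + snd m k" by blast
    then have "snd m k < fst m k \<or> fst m k < snd m k" by linarith
    then show ?thesis
      using phi_unbounded_high_mode[where k = k and al = "fst m" and be = "snd m", OF k(1) _ _ d'(1)]
        phi_unbounded_high_mode[where k = k and al = "snd m" and be = "fst m", OF k(1) _ _ d'(2)] k(3)
      by (intro sw) (auto simp: add.commute)
  next
    case False
    have one: "fst m k + snd m k = 1" if "k < n" "fst m k \<noteq> snd m k" for k
    proof -
      have "\<not> 2 \<le> fst m k + snd m k" using False that by blast
      then show ?thesis using that(2) by linarith
    qed
    obtain j where jne: "fst m j \<noteq> snd m j" using ne by auto
    then have "j < n" using v unfolding valid_mon_def by (metis not_le)
    with jne have j: "j < n" "fst m j \<noteq> snd m j" by auto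
    have "\<exists>k<n. k \<noteq> j \<and> fst m k \<noteq> snd m k"
    proof (rule ccontr)
      assume no: "\<not> ?thesis"
      have "is_om n m" unfolding is_om_def
      proof (intro conjI ex1I[of _ j])
        fix k assume "k < n \<and> fst m k + snd m k = 1 \<and> (\<forall>j<n. j \<noteq> k \<longrightarrow> fst m j = snd m j)"
        then show "k = j" using j by blast
      qed (use d j no one in auto)
      with om show False by simp
    qed
    then obtain k where k: "k < n" "k \<noteq> j" "fst m k \<noteq> snd m k" by blast
    have k1: "fst m k + snd m k = 1" "snd m k + fst m k = 1" using one[OF k(1,3)] by auto
    have "fst m j = 1 \<and> snd m j = 0 \<or> snd m j = 1 \<and> fst m j = 0" using one[OF j] by arith
    then show ?thesis
      using phi_unbounded_two_modes[where j = j and k = k and al = "fst m" and be = "snd m", OF j(1) _ _ k(1,2) k1(1) d'(1)]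
        phi_unbounded_two_modes[where j = j and k = k and al = "snd m" and be = "fst m", OF j(1) _ _ k(1,2) k1(2) d'(2)]
      by (intro sw) blast
  qed
qed

lemma gplus_swapm: "gplus (swapm m) = gplus m"
  by (simp add: gplus_eq add.commute)

lemma gminus_swapm: "gminus (swapm m) = (\<lambda>m'. complex_of_real (-1) * gminus m m')"
  by (simp add: gminus_eq)

locale weyl_lie =
  fixes n :: nat and S :: "welem set"
  assumes sub: "real_subspace S"
    and br: "\<And>x y. x \<in> S \<Longrightarrow> y \<in> S \<Longrightarrow> wbr n x y \<in> S"
    and weyl: "\<And>x. x \<in> S \<Longrightarrow> in_weyl n x"
    and num: "\<And>k. k < n \<Longrightarrow> inum k \<in> S"
begin

lemma scale: "x \<in> S \<Longrightarrow> (\<lambda>m. complex_of_real c * x m) \<in> S"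
  using sub by (simp add: real_subspace_def)

lemma perp_not_fin_dim:
  assumes v: "valid_mon n m" and ne: "fst m \<noteq> snd m" and d: "3 \<le> mdeg n m" and om: "\<not> is_om n m"
    and S: "gplus m \<in> S" "gminus m \<in> S"
  shows "\<not> fin_dim S"
proof -
  obtain m' where m': "m' = m \<or> m' = swapm m" and "phi_unbounded n m'"
    using phi_unbounded_perp[OF v ne d om] by blast
  note inf = this(2)[unfolded phi_unbounded_def]
  have v': "valid_mon n m'" and ne': "fst m' \<noteq> snd m'" using v ne m' by auto
  have S': "gplus m' \<in> S" "gminus m' \<in> S"
    using m' S scale[OF S(2), of "-1"] by (auto simp: gplus_swapm gminus_swapm)
  define h where "h N = 2 * \<i> * (of_nat (phi n (swapm m') N) - of_nat (phi n m' N))" for N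
  show ?thesis
  proof (rule infinite_eigenvalues_not_fin_dim[where M = "shiftv m'" and h = h])
    show "wbr n (gplus m') (gminus m') \<in> S" using S' br by blast
    show "rep n (wbr n (gplus m') (gminus m')) \<psi> N = h N * \<psi> N" for \<psi> N
      unfolding h_def by (rule rep_wbr_gplus_gminus[OF v'])
    show "rep n (gplus m') (\<lambda>K. if K = shiftv m' N then 1 else 0) N \<noteq> 0" if "N \<in> {N. \<forall>k<n. snd m' k \<le> N k}" for N
      using rep_gsig_entry[OF v' ne', of N True] that by (simp add: gsig_def)
    show "infinite ((\<lambda>N. h (shiftv m' N) - h N) ` {N. \<forall>k<n. snd m' k \<le> N k})"
      by (rule infinite_scaled[OF inf, of "2 * \<i>"])
        (auto simp: h_def phi_swapm_shiftv algebra_simps)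
  qed (use S' br weyl in auto)
qed

text \<open>The exponent \<open>e = 1\<close> serves a diagonal generator, \<open>e = 2\<close> the
  bracket of g_+ and g_- of an \<open>om\<close> monomial.\<close>

lemma diag_not_fin_dim:
  assumes v: "valid_mon n m" and x: "gsig s m \<in> S"
    and H: "H \<in> S" "\<And>\<psi> N. rep n H \<psi> N = c * of_nat (ff n N p ^ e) * \<psi> N" "c \<noteq> 0"
    and k: "k < n" "fst m k \<noteq> snd m k" "0 < p k" and e: "2 \<le> e * (\<Sum>l<n. p l)"
  shows "\<not> fin_dim S"
proof -
  have ne: "fst m \<noteq> snd m" using k by auto
  define h where "h N = c * of_nat (ff n N p ^ e)" for N
  have inf: "infinite ((\<lambda>N. real (ff n (shiftv m N) p ^ e) - real (ff n N p ^ e)) ` {N. \<forall>k<n. snd m k \<le> N k})"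
    using infinite_ff_differences[where al = "fst m" and be = "snd m", OF k(1) _ _ e] k(2,3) by simp
  show ?thesis
  proof (rule infinite_eigenvalues_not_fin_dim[where M = "shiftv m" and h = h])
    show "rep n H \<psi> N = h N * \<psi> N" for \<psi> N
      unfolding h_def by (rule H)
    show "rep n (gsig s m) (\<lambda>K. if K = shiftv m N then 1 else 0) N \<noteq> 0" if "N \<in> {N. \<forall>k<n. snd m k \<le> N k}" for N
      using rep_gsig_entry[OF v ne, of N s] that by simp
    show "infinite ((\<lambda>N. h (shiftv m N) - h N) ` {N. \<forall>k<n. snd m k \<le> N k})"
      by (rule infinite_scaled[OF inf H(3)])
        (simp add: h_def algebra_simps)
  qed (use x H br weyl in auto)
qed

end

section \<open>The generated Lie algebra\<close>

lemma lie_gen_superset: "G \<subseteq> lie_gen n G"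
  by (auto simp: lie_gen_def)

lemma lie_gen_least:
  assumes "G \<subseteq> S" "real_subspace S" "\<And>x y. x \<in> S \<Longrightarrow> y \<in> S \<Longrightarrow> wbr n x y \<in> S"
  shows "lie_gen n G \<subseteq> S"
  unfolding lie_gen_def using assms by (intro Inter_lower) blast

lemma real_subspace_lie_gen: "real_subspace (lie_gen n G)"
  unfolding real_subspace_def lie_gen_def by simp

lemma wbr_lie_gen: "x \<in> lie_gen n G \<Longrightarrow> y \<in> lie_gen n G \<Longrightarrow> wbr n x y \<in> lie_gen n G"
  unfolding lie_gen_def by simp

lemma lie_gen_in_weyl:
  assumes "\<And>x. x \<in> G \<Longrightarrow> in_weyl n x" "x \<in> lie_gen n G"
  shows "in_weyl n x"
proof -
  have "lie_gen n G \<subseteq> {x. in_weyl n x}"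
  proof (rule lie_gen_least)
    have "in_weyl n (\<lambda>m. 0)" by (simp add: in_weyl_def wsupp_def)
    then show "real_subspace {x. in_weyl n x}"
      by (simp add: real_subspace_def in_weyl_add in_weyl_scale)
  qed (use assms(1) in_weyl_wbr in auto)
  then show ?thesis using assms(2) by auto
qed

lemma valid_mon_unit: "k < n \<Longrightarrow> valid_mon n (unit_vec k, unit_vec k)"
  by (auto simp: valid_mon_def unit_vec_def)

lemma wsupp_inum: "wsupp (inum k) = {(unit_vec k, unit_vec k)}"
  by (auto simp: wsupp_def inum_def Defs.mono_def)

lemma in_weyl_inum: "k < n \<Longrightarrow> in_weyl n (inum k)"
  by (simp add: in_weyl_def wsupp_inum valid_mon_unit)

text \<open>A number operator has exponent 1 on each side, so the only effective contraction vector
  is \<open>unit_vec k\<close>, and that contraction restores \<open>m\<close>.\<close>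

lemma bcoef_num:
  assumes "k < n"
  shows "bcoef n (unit_vec k, unit_vec k) m m' = (if m' = m then of_nat (fst m k) - of_nat (snd m k) else 0)"
proof (cases "m' = m")
  case True
  have "contr k (unit_vec k, unit_vec k) m = m" by (simp add: contr_def)
  then show ?thesis
    using bcoef_contr[OF assms, of "(unit_vec k, unit_vec k)" m] True by (simp add: unit_vec_def)
next
  case False
  have "bcoef n (unit_vec k, unit_vec k) m m' = 0"
  proof (rule ccontr)
    assume "bcoef n (unit_vec k, unit_vec k) m m' \<noteq> 0"
    then obtain j k' where j: "\<And>i. fst m' i + j i = unit_vec k i + fst m i"
      "\<And>i. snd m' i + j i = unit_vec k i + snd m i" "\<And>i. j i \<le> unit_vec k i" "0 < j k'"
      by (rule bcoef_nzE) auto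
    have "k' = k" using j(3)[of k'] j(4) by (auto simp: unit_vec_def split: if_splits)
    then have je: "j i = unit_vec k i" for i
      using j(3)[of i] j(4) by (auto simp: unit_vec_def split: if_splits)
    have "fst m' = fst m" "snd m' = snd m"
      using j(1,2) unfolding je by auto
    then show False using False by (simp add: prod_eq_iff)
  qed
  then show ?thesis using False by simp
qed

lemma wbr_inum:
  assumes "k < n" "finite (wsupp y)"
  shows "wbr n (inum k) y m = \<i> * (of_nat (fst m k) - of_nat (snd m k)) * y m"
proof -
  have "wbr n (inum k) y m = inum k (unit_vec k, unit_vec k) * y m * bcoef n (unit_vec k, unit_vec k) m m"
    by (rule wbr_single) (use assms in \<open>auto simp: wsupp_inum bcoef_num split: if_splits\<close>)
  then show ?thesis by (simp add: bcoef_num[OF assms(1)] inum_def Defs.mono_def mult_ac)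
qed

lemma wbr_inum_gplus:
  assumes "k < n"
  shows "wbr n (inum k) (gplus m) = (\<lambda>m'. complex_of_real (real (fst m k) - real (snd m k)) * gminus m m')"
proof
  fix m'
  have fin: "finite (wsupp (gplus m))" using finite_wsupp_gsig[of True m] by (simp add: gsig_def)
  show "wbr n (inum k) (gplus m) m' = complex_of_real (real (fst m k) - real (snd m k)) * gminus m m'"
    unfolding wbr_inum[OF assms fin]
    by (cases "m' = m"; cases "m' = swapm m")
      (simp_all add: gplus_eq gminus_eq Defs.mono_def algebra_simps swapm_eq_iff)
qed

lemma wbr_inum_gminus:
  assumes "k < n"
  shows "wbr n (inum k) (gminus m) = (\<lambda>m'. complex_of_real (real (snd m k) - real (fst m k)) * gplus m m')"
proof
  fix m'
  have fin: "finite (wsupp (gminus m))" using finite_wsupp_gsig[of False m] by (simp add: gsig_def)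
  show "wbr n (inum k) (gminus m) m' = complex_of_real (real (snd m k) - real (fst m k)) * gplus m m'"
    unfolding wbr_inum[OF assms fin]
    by (cases "m' = m"; cases "m' = swapm m")
      (simp_all add: gplus_eq gminus_eq Defs.mono_def algebra_simps swapm_eq_iff)
qed

context weyl_lie
begin

text \<open>The bracket with the number operator of mode \<open>k\<close> exchanges g_+ and g_- up
  to the weight of \<open>m\<close> at \<open>k\<close>, which can be divided out as it is
  nonzero.\<close>

lemma both_signs:
  assumes g: "gsig s m \<in> S" and k: "k < n" "fst m k \<noteq> snd m k"
  shows "gplus m \<in> S" "gminus m \<in> S"
proof -
  define w where "w = real (fst m k) - real (snd m k)"
  have w: "w \<noteq> 0" using k(2) by (simp add: w_def)
  have "gplus m \<in> S \<and> gminus m \<in> S"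
  proof (cases s)
    case True
    then have p: "gplus m \<in> S" using g by (simp add: gsig_def)
    have "(\<lambda>m'. complex_of_real (1 / w) * wbr n (inum k) (gplus m) m') \<in> S"
      by (intro scale br num k p)
    moreover have "(\<lambda>m'. complex_of_real (1 / w) * wbr n (inum k) (gplus m) m') = gminus m"
      using w unfolding wbr_inum_gplus[OF k(1)] w_def[symmetric] by simp
    ultimately show ?thesis using p by simp
  next
    case False
    then have p: "gminus m \<in> S" using g by (simp add: gsig_def)
    have "(\<lambda>m'. complex_of_real (- 1 / w) * wbr n (inum k) (gminus m) m') \<in> S"
      by (intro scale br num k p)
    moreover have e: "real (snd m k) - real (fst m k) = - w" by (simp add: w_def)
    have "(\<lambda>m'. complex_of_real (- 1 / w) * wbr n (inum k) (gminus m) m') = gplus m"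
      using w unfolding wbr_inum_gminus[OF k(1)] e by simp
    ultimately show ?thesis using p by simp
  qed
  then show "gplus m \<in> S" "gminus m \<in> S" by auto
qed

end

section \<open>Classes of monomials\<close>

lemma ne_modeE:
  assumes "valid_mon n m" "fst m \<noteq> snd m"
  obtains k where "k < n" "fst m k \<noteq> snd m k"
proof -
  obtain k where k: "fst m k \<noteq> snd m k" using assms(2) by auto
  then have "k < n" using assms(1) unfolding valid_mon_def by (metis not_le)
  with k that show ?thesis by blast
qed

lemma mode_le_mdeg: "k < n \<Longrightarrow> fst m k + snd m k \<le> mdeg n m"
  unfolding mdeg_def by (rule member_le_sum) auto

lemma is_omE:
  assumes "is_om n m"
  obtains i where "i < n" "fst m i + snd m i = 1" "\<And>k. k < n \<Longrightarrow> k \<noteq> i \<Longrightarrow> fst m k = snd m k" "3 \<le> mdeg n m"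
  using assms unfolding is_om_def by auto

lemma is_omI:
  assumes "i < n" "fst m i + snd m i = 1" "\<And>k. k < n \<Longrightarrow> k \<noteq> i \<Longrightarrow> fst m k = snd m k" "3 \<le> mdeg n m"
  shows "is_om n m"
  unfolding is_om_def
proof (intro conjI ex1I[of _ i])
  fix k assume k: "k < n \<and> fst m k + snd m k = 1 \<and> (\<forall>j<n. j \<noteq> k \<longrightarrow> fst m j = snd m j)"
  show "k = i"
  proof (rule ccontr)
    assume "k \<noteq> i"
    then have "fst m i = snd m i" using k assms(1) by auto
    with assms(2) show False by presburger
  qed
qed (use assms in auto)

lemma is_om_ne: "is_om n m \<Longrightarrow> fst m \<noteq> snd m"
proof
  assume om: "is_om n m" and eq: "fst m = snd m"
  obtain i where "fst m i + snd m i = 1" using om by (rule is_omE)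
  then show False unfolding eq by presburger
qed

lemma mclass_Com: "mclass n m = Com \<longleftrightarrow> is_om n m"
proof -
  have "is_om n m \<Longrightarrow> 3 \<le> mdeg n m" by (simp add: is_om_def)
  then show ?thesis using is_om_ne[of n m] by (auto simp: mclass_def)
qed

lemma mclass_CperpI: "fst m \<noteq> snd m \<Longrightarrow> 3 \<le> mdeg n m \<Longrightarrow> \<not> is_om n m \<Longrightarrow> mclass n m = Cperp"
  by (auto simp: mclass_def)

lemma mdeg_diag: "fst m = snd m \<Longrightarrow> mdeg n m = 2 * (\<Sum>k<n. fst m k)"
  by (simp add: mdeg_def sum.distrib sum_distrib_left mult_2)

lemma mdeg_0: "valid_mon n m \<Longrightarrow> mdeg n m = 0 \<Longrightarrow> fst m = snd m"
proof
  fix k assume "valid_mon n m" "mdeg n m = 0"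
  then show "fst m k = snd m k" using mode_le_mdeg[of k n m] by (cases "k < n") (auto simp: valid_mon_def)
qed

lemma mclass_diag: "fst m = snd m \<Longrightarrow> mclass n m = C0 \<or> mclass n m = Ceq"
proof -
  assume eq: "fst m = snd m"
  have "mdeg n m = 0 \<or> mdeg n m = 2 \<or> 4 \<le> mdeg n m" "mdeg n m \<noteq> 1"
    using mdeg_diag[OF eq, of n] by presburger+
  with eq show ?thesis by (auto simp: mclass_def)
qed

lemma mclass_Cperp:
  assumes "valid_mon n m" "mclass n m = Cperp"
  shows "fst m \<noteq> snd m" "3 \<le> mdeg n m" "\<not> is_om n m"
proof -
  show ne: "fst m \<noteq> snd m" using mclass_diag[of m n] assms(2) by auto
  have "mdeg n m \<noteq> 0" using mdeg_0[OF assms(1)] ne by blast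
  moreover have "mdeg n m \<noteq> 1" "mdeg n m \<noteq> 2" using assms(2) ne by (auto simp: mclass_def split: if_splits)
  ultimately show "3 \<le> mdeg n m" by linarith
  show "\<not> is_om n m" using assms(2) mclass_Com[of n m] by auto
qed

lemma mclass_Ceq: "mclass n m = Ceq \<Longrightarrow> fst m = snd m \<and> 4 \<le> mdeg n m"
  by (auto simp: mclass_def split: if_splits)

lemma mclass_C2: "mclass n m = C2 \<Longrightarrow> fst m \<noteq> snd m \<and> mdeg n m = 2"
  by (auto simp: mclass_def split: if_splits)

lemma mclass_C0: "mclass n m = C0 \<Longrightarrow> fst m = snd m \<and> mdeg n m \<le> 2"
  by (auto simp: mclass_def split: if_splits)

text \<open>A balanced mode that occurs at all uses up the whole degree 2 and leaves nothing
  off-diagonal.\<close>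

lemma quadratic_diag_mode:
  assumes v: "valid_mon n m" and d: "mdeg n m = 2" and ne: "fst m \<noteq> snd m"
    and k: "k < n" "fst m k = snd m k"
  shows "fst m k = 0"
proof (rule ccontr)
  assume k0: "fst m k \<noteq> 0"
  have "mdeg n m = (fst m k + snd m k) + (\<Sum>i\<in>{..<n}-{k}. fst m i + snd m i)"
    unfolding mdeg_def using k(1) by (subst sum.remove[of _ k]) auto
  then have "(\<Sum>i\<in>{..<n}-{k}. fst m i + snd m i) = 0" using d k k0 by linarith
  then have z: "fst m i = snd m i" if "i < n" "i \<noteq> k" for i using that by auto
  obtain i where "i < n" "fst m i \<noteq> snd m i" using ne_modeE[OF v ne] .
  then show False using z k(2) by blast
qed

text \<open>With p = \<open>fst m2 k\<close>, the conditions on \<open>m2\<close> say that mode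
  \<open>k\<close> enters it through the polynomial N(N-1)...(N-p+1) of the number operator N, with
  p > 0.\<close>

definition clash :: "nat \<Rightarrow> mon \<Rightarrow> mon \<Rightarrow> bool" where
  "clash n m1 m2 \<longleftrightarrow> (\<exists>k<n. fst m1 k \<noteq> snd m1 k \<and> fst m2 k = snd m2 k \<and> 0 < fst m2 k)"

lemma clash_swapm [simp]: "clash n (swapm m1) m2 = clash n m1 m2" "clash n m1 (swapm m2) = clash n m1 m2"
  by (auto simp: clash_def)

lemma clashD: "\<not> clash n m1 m2 \<Longrightarrow> k < n \<Longrightarrow> fst m1 k \<noteq> snd m1 k \<Longrightarrow> fst m2 k = snd m2 k \<Longrightarrow> fst m2 k = 0"
  by (auto simp: clash_def)

text \<open>Mode \<open>i\<close> contributes the factors x+1 and x, whose difference is constant.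
  Every other mode is balanced and contributes the same squared falling factorial to both
  terms.\<close>

lemma phi_om:
  assumes i: "i < n" "fst m i + snd m i = 1" "\<And>k. k < n \<Longrightarrow> k \<noteq> i \<Longrightarrow> fst m k = snd m k"
  defines "p \<equiv> (\<lambda>k. if k = i then 0 else fst m k)"
  shows "\<exists>c::complex. c \<noteq> 0 \<and> (\<forall>N. of_nat (phi n (swapm m) N) - of_nat (phi n m N) = c * of_nat (ff n N p ^ 2))"
proof -
  define X where "X N = (\<Prod>k\<in>{..<n}-{i}. amp (fst m k) (snd m k) (N k))" for N
  have amp2: "amp a a x = ffac x a ^ 2" for a x
    by (cases "a \<le> x") (auto simp: amp_def power2_eq_square ffac_eq_0_iff)
  have phi: "phi n m N = amp (fst m i) (snd m i) (N i) * X N" for N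
    unfolding phi_def X_def using i(1) by (subst prod.remove[of _ i]) auto
  have "(\<Prod>k\<in>{..<n}-{i}. amp (snd m k) (fst m k) (N k)) = X N" for N
    unfolding X_def by (intro prod.cong refl) (use i(3) in auto)
  then have phis: "phi n (swapm m) N = amp (snd m i) (fst m i) (N i) * X N" for N
    unfolding phi_def using i(1) by (subst prod.remove[of _ i]) auto
  have ff: "ff n N p ^ 2 = X N" for N
  proof -
    have "ff n N p = ffac (N i) (p i) * (\<Prod>k\<in>{..<n}-{i}. ffac (N k) (p k))"
      unfolding ff_def using i(1) by (subst prod.remove[of _ i]) auto
    also have "\<dots> = (\<Prod>k\<in>{..<n}-{i}. ffac (N k) (p k))" by (simp add: p_def)
    finally have "ff n N p ^ 2 = (\<Prod>k\<in>{..<n}-{i}. ffac (N k) (p k) ^ 2)" by (simp add: prod_power_distrib)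
    also have "\<dots> = X N"
      unfolding X_def
    proof (intro prod.cong refl)
      fix k assume "k \<in> {..<n} - {i}"
      then have "fst m k = snd m k" "p k = fst m k" using i(3) by (auto simp: p_def)
      then show "ffac (N k) (p k) ^ 2 = amp (fst m k) (snd m k) (N k)" by (simp add: amp2)
    qed
    finally show ?thesis .
  qed
  have a: "amp 1 0 x = x + 1" "amp 0 1 x = x" for x by (simp_all add: amp_def ffac_def)
  have "fst m i = 1 \<and> snd m i = 0 \<or> fst m i = 0 \<and> snd m i = 1" using i(2) by arith
  then show ?thesis
  proof
    assume "fst m i = 1 \<and> snd m i = 0"
    then show ?thesis
      by (intro exI[of _ "-1"]) (simp add: phi phis ff a[simplified] algebra_simps)
  next
    assume "fst m i = 0 \<and> snd m i = 1"
    then show ?thesis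
      by (intro exI[of _ 1]) (simp add: phi phis ff a[simplified] algebra_simps)
  qed
qed

context weyl_lie
begin

lemma clash_not_fin_dim:
  assumes v1: "valid_mon n m1" and x: "gsig s m1 \<in> S"
    and v2: "valid_mon n m2" and y: "gsig s' m2 \<in> S" and s': "s' \<or> fst m2 \<noteq> snd m2"
    and cl: "mclass n m2 = Ceq \<or> mclass n m2 = Com" and clash: "clash n m1 m2"
  shows "\<not> fin_dim S"
proof -
  obtain k where k: "k < n" "fst m1 k \<noteq> snd m1 k" "fst m2 k = snd m2 k" "0 < fst m2 k"
    using clash by (auto simp: clash_def)
  from cl show ?thesis
  proof
    assume "mclass n m2 = Ceq"
    then have d: "fst m2 = snd m2" "4 \<le> mdeg n m2" using mclass_Ceq by auto
    \<comment> \<open>On a diagonal monomial g_- is 0, so the sign must be +.\<close>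
    have H: "gplus m2 \<in> S" using y s' d(1) by (auto simp: gsig_def)
    have sw: "swapm m2 = m2" using d(1) by (simp add: swapm_eq_iff)
    have rep: "rep n (gplus m2) \<psi> N = 2 * \<i> * of_nat (ff n N (fst m2) ^ 1) * \<psi> N" for \<psi> N
    proof -
      have "shiftv m2 N = N" if "ff n N (fst m2) \<noteq> 0"
      proof
        fix l show "shiftv m2 N l = N l"
          using ff_nzD[OF that, of l] v2 d(1) by (cases "l < n") (auto simp: shiftv_def valid_mon_def)
      qed
      then have "rmon n m2 \<psi> N = of_nat (ff n N (fst m2)) * \<psi> N"
        by (cases "ff n N (fst m2) = 0") (auto simp: rmon_def d(1)[symmetric])
      then show ?thesis unfolding rep_gplus[OF v2] sw by simp
    qed
    \<comment> \<open>Half the degree, at least 2, is the sum of the exponents \<open>p\<close>, so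
      \<open>e = 1\<close> is enough.\<close>
    show ?thesis
      by (rule diag_not_fin_dim[OF v1 x H rep _ k(1,2,4)]) (use d mdeg_diag[OF d(1), of n] in auto)
  next
    assume "mclass n m2 = Com"
    then have "is_om n m2" by (simp add: mclass_Com)
    then obtain i where i: "i < n" "fst m2 i + snd m2 i = 1" "\<And>k. k < n \<Longrightarrow> k \<noteq> i \<Longrightarrow> fst m2 k = snd m2 k"
      by (rule is_omE) blast
    define p where "p = (\<lambda>k. if k = i then 0 else fst m2 k)"
    have ki: "k \<noteq> i" using k(3) i(2) by auto presburger
    have im: "fst m2 i \<noteq> snd m2 i" using i(2) by presburger
    obtain c :: complex where c: "c \<noteq> 0" "\<And>N. of_nat (phi n (swapm m2) N) - of_nat (phi n m2 N) = c * of_nat (ff n N p ^ 2)"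
      using phi_om[OF i] unfolding p_def by blast
    note pm = both_signs[OF y i(1) im]
    have rep: "rep n (wbr n (gplus m2) (gminus m2)) \<psi> N = (2 * \<i> * c) * of_nat (ff n N p ^ 2) * \<psi> N" for \<psi> N
      unfolding rep_wbr_gplus_gminus[OF v2] c(2) by (simp only: mult.assoc)
    have pk: "0 < p k" using k(4) ki by (simp add: p_def)
    have "p k \<le> (\<Sum>l<n. p l)" using k(1) by (intro member_le_sum) auto
    \<comment> \<open>The eigenvalue is a square, so \<open>e = 2\<close>, and one positive exponent
      suffices.\<close>
    then have "2 \<le> 2 * (\<Sum>l<n. p l)" using pk by linarith
    with c(1) show ?thesis
      by (intro diag_not_fin_dim[OF v1 x br[OF pm] rep _ k(1,2) pk]) auto
  qed
qed

end

section \<open>Brackets of basis elements\<close>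

lemma mdeg_contr:
  assumes "k < n" "0 < fst m1 k + fst m2 k" "0 < snd m1 k + snd m2 k"
  shows "mdeg n (contr k m1 m2) + 2 = mdeg n m1 + mdeg n m2"
proof -
  have "mdeg n (contr k m1 m2) + (\<Sum>i<n. if i = k then 2 else 0)
     = (\<Sum>i<n. (fst m1 i + snd m1 i) + (fst m2 i + snd m2 i))"
    unfolding mdeg_def sum.distrib[symmetric]
    by (intro sum.cong refl) (use assms in \<open>auto simp: contr_def unit_vec_def\<close>)
  then show ?thesis using assms(1) by (simp add: mdeg_def sum.distrib)
qed

lemma contr_weight:
  assumes "0 < fst m1 k + fst m2 k" "0 < snd m1 k + snd m2 k"
  shows "int (fst (contr k m1 m2) i) - int (snd (contr k m1 m2) i)
    = (int (fst m1 i) - int (snd m1 i)) + (int (fst m2 i) - int (snd m2 i))"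
  using assms by (auto simp: contr_def unit_vec_def of_nat_diff)

text \<open>Either \<open>m2\<close> or its adjoint can be used; the choice makes both weights at \<open>k\<close> and \<open>j\<close>
  nonzero, so that the top-order term of the bracket is neither diagonal nor of class \<open>om\<close>.\<close>

lemma clash_om_wbr_Cperp:
  assumes d1: "2 \<le> mdeg n m1" and om: "is_om n m2" and clash: "clash n m1 m2"
  shows "\<exists>m. mclass n m = Cperp \<and> wbr n (gsig s m1) (gsig s' m2) m \<noteq> 0"
proof -
  obtain k where k: "k < n" "fst m1 k \<noteq> snd m1 k" "fst m2 k = snd m2 k" "0 < fst m2 k"
    using clash by (auto simp: clash_def)
  obtain j where j: "j < n" "fst m2 j + snd m2 j = 1" and d2: "3 \<le> mdeg n m2"
    using om by (rule is_omE)
  have kj: "k \<noteq> j" using k(3) j(2) by auto presburger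
  define wt :: "mon \<Rightarrow> nat \<Rightarrow> int" where "wt m i = int (fst m i) - int (snd m i)" for m i
  have wsw: "wt (swapm m) i = - wt m i" for m i by (simp add: wt_def)
  have w2j: "wt m2 j \<noteq> 0" using j(2) unfolding wt_def by presburger
  have w1k: "wt m1 k \<noteq> 0" using k(2) by (simp add: wt_def)
  obtain m2' where m2': "m2' = m2 \<or> m2' = swapm m2" "wt m1 j + wt m2' j \<noteq> 0"
  proof (cases "wt m1 j + wt m2 j = 0")
    case True
    then have "wt m1 j + wt (swapm m2) j \<noteq> 0" using w2j by (simp add: wsw)
    then show ?thesis using that[of "swapm m2"] by simp
  next
    case False
    then show ?thesis using that[of m2] by simp
  qed
  have k': "fst m2' k = snd m2' k" "0 < fst m2' k" using m2'(1) k by auto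
  have w2j': "wt m2' j \<noteq> 0" using m2'(1) w2j wsw[of m2 j] by auto
  have w2k': "wt m2' k = 0" using k'(1) by (simp add: wt_def)
  have d2': "mdeg n m2' = mdeg n m2" using m2'(1) by (auto simp: mdeg_def add.commute)
  define m where "m = contr k m1 m2'"
  have pos: "0 < fst m1 k + fst m2' k" "0 < snd m1 k + snd m2' k" using k' by auto
  have wm: "wt m i = wt m1 i + wt m2' i" for i
    using contr_weight[OF pos, of i] by (simp add: wt_def m_def)
  have bw: "wt m' i = wt a i + wt b i" if "bcoef n a b m' \<noteq> 0" for a b m' i
    using bcoef_weight[OF that, of i] by (simp add: wt_def)
  have "bcoef n m1 m2' m \<noteq> 0"
  proof -
    have "bcoef n m1 m2' m = of_nat (snd m1 k * fst m2' k) - of_nat (snd m2' k * fst m1 k)"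
      unfolding m_def using bcoef_contr[OF k(1) pos] .
    also have "\<dots> = of_nat (fst m2' k) * (of_nat (snd m1 k) - of_nat (fst m1 k))"
      by (simp add: k'(1) algebra_simps)
    finally show ?thesis using k(2) k'(2) by simp
  qed
  moreover have "wbr n (gsig s m1) (gsig s' m2) m = gsig s m1 m1 * gsig s' m2 m2' * bcoef n m1 m2' m"
  \<comment> \<open>Both candidates for \<open>b\<close> have weight 0 at \<open>k\<close>, so the
    weight of \<open>m\<close> there singles out \<open>m1\<close> from its adjoint; the weight at
    \<open>j\<close> then singles out \<open>m2'\<close>.\<close>
  proof (rule wbr_single)
    fix a b assume a: "a \<in> wsupp (gsig s m1)" and b: "b \<in> wsupp (gsig s' m2)" and nz: "bcoef n a b m \<noteq> 0"
    have a': "a = m1 \<or> a = swapm m1" using a wsupp_gsig[of s m1] by auto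
    have "b = m2 \<or> b = swapm m2" using b wsupp_gsig[of s' m2] by auto
    then have b': "b = m2' \<or> b = swapm m2'" using m2'(1) by auto
    then have "wt b k = 0" using w2k' wsw[of m2' k] by auto
    then have "wt a k = wt m1 k" using bw[OF nz, of k] wm[of k] w2k' by linarith
    then have "a = m1" using a' w1k wsw[of m1 k] by auto
    then have "wt b j = wt m2' j" using bw[OF nz, of j] wm[of j] by simp
    then have "b = m2'" using b' w2j' wsw[of m2' j] by auto
    with \<open>a = m1\<close> show "a = m1 \<and> b = m2'" by simp
  qed auto
  moreover have "gsig s m1 m1 \<noteq> 0" using k(2) by (intro gsig_nz) auto
  moreover have "gsig s' m2 m2' \<noteq> 0"
    using m2'(1) gsig_nz[of s' m2] is_om_ne[OF om] by auto
  ultimately have "wbr n (gsig s m1) (gsig s' m2) m \<noteq> 0" by simp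
  moreover have "mclass n m = Cperp"
  proof (rule mclass_CperpI)
    have mk: "fst m k \<noteq> snd m k" using wm[of k] w2k' w1k by (auto simp: wt_def)
    have mj: "fst m j \<noteq> snd m j" using wm[of j] m2'(2) by (auto simp: wt_def)
    show "fst m \<noteq> snd m" using mk by auto
    show "3 \<le> mdeg n m" using mdeg_contr[OF k(1) pos] d1 d2 d2' by (simp add: m_def)
    show "\<not> is_om n m"
    proof
      assume "is_om n m"
      then obtain i where "\<And>k. k < n \<Longrightarrow> k \<noteq> i \<Longrightarrow> fst m k = snd m k" by (rule is_omE) blast
      then show False using mk mj kj k(1) j(1) by metis
    qed
  qed
  ultimately show ?thesis by blast
qed

text \<open>One contraction in the clashing mode has a coefficient proportional to the weight of
  \<open>m1\<close> there. The same weight separates \<open>m1\<close> from its adjoint, so nothing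
  cancels.\<close>

lemma clash_diag_wbr:
  assumes clash: "clash n m1 m2" and d: "fst m2 = snd m2" and s': "s'"
  shows "\<exists>m. wbr n (gsig s' m2) (gsig s m1) m \<noteq> 0"
proof -
  obtain k where k: "k < n" "fst m1 k \<noteq> snd m1 k" "fst m2 k = snd m2 k" "0 < fst m2 k"
    using clash by (auto simp: clash_def)
  define m where "m = contr k m2 m1"
  have pos: "0 < fst m2 k + fst m1 k" "0 < snd m2 k + snd m1 k" using k by auto
  have "bcoef n m2 m1 m = of_nat (snd m2 k * fst m1 k) - of_nat (snd m1 k * fst m2 k)"
    unfolding m_def using bcoef_contr[OF k(1) pos] .
  also have "\<dots> = of_nat (fst m2 k) * (of_nat (fst m1 k) - of_nat (snd m1 k))"
    by (simp add: k(3) algebra_simps)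
  finally have "bcoef n m2 m1 m \<noteq> 0" using k(2,4) by simp
  moreover have "wbr n (gsig s' m2) (gsig s m1) m = gsig s' m2 m2 * gsig s m1 m1 * bcoef n m2 m1 m"
  proof (rule wbr_single)
    fix a b assume a: "a \<in> wsupp (gsig s' m2)" and b: "b \<in> wsupp (gsig s m1)" and nz: "bcoef n a b m \<noteq> 0"
    have a': "a = m2" using a wsupp_gsig[of s' m2] d swapm_eq_iff[of m2] by auto
    have b': "b = m1 \<or> b = swapm m1" using b wsupp_gsig[of s m1] by auto
    have "int (fst b k) - int (snd b k) = int (fst m1 k) - int (snd m1 k)"
      using bcoef_weight[OF nz, of k] contr_weight[OF pos, of k] a' k(3) by (simp add: m_def)
    then show "a = m2 \<and> b = m1" using a' b' k(2) by auto
  qed auto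
  moreover have "gsig s' m2 m2 \<noteq> 0" "gsig s m1 m1 \<noteq> 0" using s' k(2) by (auto intro!: gsig_nz)
  ultimately show ?thesis by (intro exI[of _ m]) simp
qed

text \<open>A contraction in a balanced mode of \<open>b\<close> would need that mode in
  \<open>a\<close>: unbalanced it is a clash, and balanced modes do not occur in a quadratic
  off-diagonal \<open>a\<close>. Hence there is exactly one contraction, in the unbalanced mode
  \<open>i\<close> of \<open>b\<close>, and it either keeps the unbalanced mode or moves it to the
  other mode of \<open>a\<close>.\<close>

lemma bcoef_C2_om:
  assumes va: "valid_mon n a" and vb: "valid_mon n b"
    and a: "mdeg n a = 2" "fst a \<noteq> snd a" and b: "is_om n b" and nc: "\<not> clash n a b"
    and nz: "bcoef n a b m \<noteq> 0"
  shows "is_om n m"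
proof -
  obtain i where i: "i < n" "fst b i + snd b i = 1" "\<And>k. k < n \<Longrightarrow> k \<noteq> i \<Longrightarrow> fst b k = snd b k"
    and d: "3 \<le> mdeg n b" using b by (rule is_omE) blast
  obtain j k0 where j: "\<And>k. fst m k + j k = fst a k + fst b k" "\<And>k. snd m k + j k = snd a k + snd b k"
    "\<And>k. j k \<le> max (fst a k) (snd a k)" "\<And>k. j k \<le> max (fst b k) (snd b k)" and k0: "0 < j k0"
    using nz by (rule bcoef_nzE) blast
  have ji: "k = i" if "0 < j k" for k
  proof (rule ccontr)
    assume ki: "k \<noteq> i"
    have kn: "k < n" using j(3)[of k] that va by (cases "k < n") (auto simp: valid_mon_def)
    have e: "fst b k = snd b k" using i(3)[OF kn ki] .
    then have "0 < fst b k" using j(4)[of k] that by auto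
    then have ea: "fst a k = snd a k" using clashD[OF nc kn _ e] by auto
    then have "fst a k = 0" using quadratic_diag_mode[OF va a kn] by simp
    then show False using j(3)[of k] that ea by auto
  qed
  have "j i = 1" using ji[OF k0] k0 j(4)[of i] i(2) by (auto simp: max_def split: if_splits)
  have j0: "j k = 0" if "k \<noteq> i" for k using ji[of k] that by auto
  have m: "fst m k = fst a k + fst b k" "snd m k = snd a k + snd b k" if "k \<noteq> i" for k
    using j(1,2)[of k] j0[OF that] by auto
  have mi: "fst m i + 1 = fst a i + fst b i" "snd m i + 1 = snd a i + snd b i"
    using j(1,2)[of i] \<open>j i = 1\<close> by auto
  have sp: "mdeg n m' = (fst m' i + snd m' i) + (\<Sum>k\<in>{..<n}-{i}. fst m' k + snd m' k)" for m'
    unfolding mdeg_def using i(1) by (subst sum.remove[of _ i]) auto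
  have dm: "3 \<le> mdeg n m"
  proof -
    have "(\<Sum>k\<in>{..<n}-{i}. fst m k + snd m k) = (\<Sum>k\<in>{..<n}-{i}. fst a k + snd a k) + (\<Sum>k\<in>{..<n}-{i}. fst b k + snd b k)"
      unfolding sum.distrib[symmetric] by (intro sum.cong refl) (use m in auto)
    then show ?thesis using sp[of m] sp[of a] sp[of b] mi a(1) d by linarith
  qed
  have ai: "fst a i \<noteq> snd a i"
  proof
    assume e: "fst a i = snd a i"
    then have "fst a i = 0" using quadratic_diag_mode[OF va a i(1)] by simp
    then show False using j(3)[of i] e \<open>j i = 1\<close> by auto
  qed
  have ai2: "fst a i + snd a i \<le> 2" using mode_le_mdeg[OF i(1), of a] a(1) by simp
  show ?thesis
  proof (cases "fst a i + snd a i = 1")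
    case False
    \<comment> \<open>Here \<open>a\<close> is the square of a creation or an annihilation operator
      of mode \<open>i\<close>, and the unbalanced mode stays \<open>i\<close>.\<close>
    then have a2: "fst a i + snd a i = 2" using ai ai2 by presburger
    then have "(\<Sum>k\<in>{..<n}-{i}. fst a k + snd a k) = 0" using sp[of a] a(1) by linarith
    then have z: "fst a k = 0 \<and> snd a k = 0" if "k < n" "k \<noteq> i" for k using that by auto
    show ?thesis
    proof (rule is_omI[OF i(1) _ _ dm])
      show "fst m i + snd m i = 1" using mi a2 i(2) by linarith
      show "fst m k = snd m k" if "k < n" "k \<noteq> i" for k
        using m[OF that(2)] z[OF that] i(3)[OF that] by simp
    qed
  next
    case True
    \<comment> \<open>Here \<open>a\<close> has a second mode \<open>l\<close>, absent from
      \<open>b\<close> for lack of a clash; mode \<open>i\<close> becomes empty and \<open>l\<close>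
      the unbalanced mode.\<close>
    then have "(\<Sum>k\<in>{..<n}-{i}. fst a k + snd a k) = 1" using sp[of a] a(1) by linarith
    then obtain l where l: "l < n" "l \<noteq> i" "fst a l + snd a l = 1"
      and z: "\<forall>k\<in>{..<n}-{i}. l \<noteq> k \<longrightarrow> fst a k + snd a k = 0"
      unfolding sum_eq_1_iff[OF finite_Diff[OF finite_lessThan]] by auto
    have "fst a l \<noteq> snd a l" using l(3) by presburger
    then have bl: "fst b l = 0 \<and> snd b l = 0" using clashD[OF nc l(1)] i(3)[OF l(1,2)] by auto
    show ?thesis
    proof (rule is_omI[OF l(1) _ _ dm])
      show "fst m l + snd m l = 1" using m[OF l(2)] bl l(3) by simp
      show "fst m k = snd m k" if "k < n" "k \<noteq> l" for k
      proof (cases "k = i")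
        case True
        then show ?thesis using mi \<open>fst a i + snd a i = 1\<close> i(2) by simp
      next
        case False
        then show ?thesis using m[OF False] z that i(3)[OF that(1) False] by auto
      qed
    qed
  qed
qed

text \<open>A contracted mode that is unbalanced in one factor is unbalanced in the other, otherwise
  the two clash. So both factors have the same unbalanced mode; the contraction removes it and
  leaves a diagonal monomial.\<close>

lemma bcoef_om_om:
  assumes va: "valid_mon n a" and vb: "valid_mon n b"
    and a: "is_om n a" and b: "is_om n b" and nc: "\<not> clash n a b" "\<not> clash n b a"
    and nz: "bcoef n a b m \<noteq> 0"
  shows "fst m = snd m"
proof -
  obtain i where i: "i < n" "fst a i + snd a i = 1" "\<And>k. k < n \<Longrightarrow> k \<noteq> i \<Longrightarrow> fst a k = snd a k"
    using a by (rule is_omE) blast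
  obtain i' where i': "i' < n" "fst b i' + snd b i' = 1" "\<And>k. k < n \<Longrightarrow> k \<noteq> i' \<Longrightarrow> fst b k = snd b k"
    using b by (rule is_omE) blast
  obtain j k where j: "\<And>k. fst m k + j k = fst a k + fst b k" "\<And>k. snd m k + j k = snd a k + snd b k"
    "\<And>k. j k \<le> max (fst a k) (snd a k)" "\<And>k. j k \<le> max (fst b k) (snd b k)"
    and k: "0 < j k" "\<not> (fst a k = snd a k \<and> fst b k = snd b k)"
    using nz by (rule bcoef_nzE) blast
  have kn: "k < n" using j(3)[of k] k(1) va by (cases "k < n") (auto simp: valid_mon_def)
  have "fst b k \<noteq> snd b k"
  proof
    assume e: "fst b k = snd b k"
    then have "fst b k = 0" using clashD[OF nc(1) kn _ e] k(2) by auto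
    then show False using e j(4)[of k] k(1) by auto
  qed
  then have ki': "k = i'" using i'(3)[OF kn] by blast
  have "fst a k \<noteq> snd a k"
  proof
    assume e: "fst a k = snd a k"
    then have "fst a k = 0" using clashD[OF nc(2) kn _ e] k(2) by auto
    then show False using e j(3)[of k] k(1) by auto
  qed
  then have ki: "k = i" using i(3)[OF kn] by blast
  show ?thesis
  proof
    fix l
    show "fst m l = snd m l"
    proof (cases "l = k")
      case True
      have "fst m k + snd m k + 2 * j k = 2" using j(1,2)[of k] i(2) i'(2) ki ki' by simp
      then have "fst m k = 0" "snd m k = 0" using k(1) by linarith+
      then show ?thesis using True by simp
    next
      case False
      have "fst a l = snd a l" "fst b l = snd b l"
        using i(3)[of l] i'(3)[of l] False ki ki' va vb by (cases "l < n"; auto simp: valid_mon_def)+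
      then show ?thesis using j(1,2)[of l] by simp
    qed
  qed
qed

section \<open>A finite-dimensional overalgebra\<close>

definition mode_deg :: "nat set \<Rightarrow> mon \<Rightarrow> nat" where
  "mode_deg A m = (\<Sum>k\<in>A. fst m k + snd m k)"

text \<open>With \<open>M\<close> the set of modes in which some generator is off-diagonal: elements of degree at
  most two in the modes of \<open>M\<close>, with coefficients that are polynomials in the remaining number
  operators. The bounds \<open>2 * D\<close>, \<open>D\<close>, \<open>0\<close> on the degree of the coefficients of the
  constant, linear and quadratic part make their span closed under brackets.\<close>

definition overset :: "nat \<Rightarrow> nat set \<Rightarrow> nat \<Rightarrow> mon set" where
  "overset n M D = {m. valid_mon n m \<and> (\<forall>k. k \<notin> M \<longrightarrow> fst m k = snd m k) \<and>
     (mode_deg ({..<n} \<inter> M) m = 0 \<and> mode_deg ({..<n} - M) m \<le> 2 * D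
      \<or> mode_deg ({..<n} \<inter> M) m = 1 \<and> mode_deg ({..<n} - M) m \<le> D
      \<or> mode_deg ({..<n} \<inter> M) m = 2 \<and> mode_deg ({..<n} - M) m = 0)}"

lemma mdeg_split: "mdeg n m = mode_deg ({..<n} \<inter> M) m + mode_deg ({..<n} - M) m"
  unfolding mdeg_def mode_deg_def by (subst sum.Int_Diff[of _ _ M]) auto

lemma swapm_overset [simp]: "swapm m \<in> overset n M D \<longleftrightarrow> m \<in> overset n M D"
proof -
  have "mode_deg A (swapm m) = mode_deg A m" for A by (simp add: mode_deg_def add.commute)
  then show ?thesis by (simp add: overset_def eq_commute[of "snd m _"])
qed

lemma finite_overset: "finite (overset n M D)"
proof (rule finite_subset[OF _ finite_bounded_mons[of n "2 * D + 2"]], clarify, intro conjI allI)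
  fix a b k assume m: "(a, b) \<in> overset n M D"
  show "valid_mon n (a, b)" using m by (simp add: overset_def)
  have "mdeg n (a, b) \<le> 2 * D + 2" using m mdeg_split[of n "(a, b)" M] by (auto simp: overset_def)
  then have "a k + b k \<le> 2 * D + 2"
    using mode_le_mdeg[of k n "(a, b)"] m by (cases "k < n") (auto simp: overset_def valid_mon_def)
  then show "fst (a, b) k \<le> 2 * D + 2" "snd (a, b) k \<le> 2 * D + 2" by auto
qed

text \<open>A nonzero coefficient needs a contraction in a mode of \<open>M\<close>, so neither
  factor is of the constant kind, and the degree in \<open>M\<close> drops by at least 2. Linear
  with linear gives constant, with coefficient degree \<open>D + D\<close>; linear with quadratic
  gives linear, bound \<open>D\<close>; quadratic with quadratic is at most quadratic, bound
  0.\<close>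

lemma bcoef_overset:
  assumes a: "a \<in> overset n M D" and b: "b \<in> overset n M D" and nz: "bcoef n a b m \<noteq> 0"
  shows "m \<in> overset n M D"
proof -
  obtain j k where j: "\<And>k. fst m k + j k = fst a k + fst b k" "\<And>k. snd m k + j k = snd a k + snd b k"
    "\<And>k. j k \<le> max (fst a k) (snd a k)" "\<And>k. j k \<le> max (fst b k) (snd b k)"
    and k: "0 < j k" "\<not> (fst a k = snd a k \<and> fst b k = snd b k)"
    using nz by (rule bcoef_nzE) blast
  have va: "valid_mon n a" "valid_mon n b" using a b by (auto simp: overset_def)
  have off: "fst a l = snd a l" "fst b l = snd b l" if "l \<notin> M" for l
    using a b that by (auto simp: overset_def)
  have kn: "k < n" using j(3)[of k] k(1) va by (cases "k < n") (auto simp: valid_mon_def)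
  have kM: "k \<in> M" using off k(2) by blast
  let ?A = "{..<n} \<inter> M" and ?O = "{..<n} - M"
  have deg: "mode_deg A m + 2 * (\<Sum>l\<in>A. j l) = mode_deg A a + mode_deg A b" for A
  proof -
    have "mode_deg A m + (\<Sum>l\<in>A. j l) + (\<Sum>l\<in>A. j l) = (\<Sum>l\<in>A. (fst m l + j l) + (snd m l + j l))"
      by (simp add: mode_deg_def sum.distrib)
    also have "\<dots> = mode_deg A a + mode_deg A b"
      unfolding j by (simp add: mode_deg_def sum.distrib)
    finally show ?thesis by simp
  qed
  have kA: "k \<in> ?A" using kn kM by simp
  have "fst a k + snd a k \<le> mode_deg ?A a" "fst b k + snd b k \<le> mode_deg ?A b" "j k \<le> (\<Sum>l\<in>?A. j l)"
    unfolding mode_deg_def using kA by (auto intro!: member_le_sum[of k ?A "\<lambda>k. fst a k + snd a k"] member_le_sum[of k ?A "\<lambda>k. fst b k + snd b k"] member_le_sum)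
  then have pos: "0 < mode_deg ?A a" "0 < mode_deg ?A b" "0 < (\<Sum>l\<in>?A. j l)"
    using j(3,4)[of k] k(1) by linarith+
  have "valid_mon n m" using j(1,2) va unfolding valid_mon_def by (metis add_is_0)
  moreover have "fst m l = snd m l" if "l \<notin> M" for l using j(1,2)[of l] off[OF that] by simp
  moreover have "mode_deg ?A m = 0 \<and> mode_deg ?O m \<le> 2 * D
      \<or> mode_deg ?A m = 1 \<and> mode_deg ?O m \<le> D \<or> mode_deg ?A m = 2 \<and> mode_deg ?O m = 0"
  proof -
    have "mode_deg ?A a = 1 \<and> mode_deg ?O a \<le> D \<or> mode_deg ?A a = 2 \<and> mode_deg ?O a = 0"
      "mode_deg ?A b = 1 \<and> mode_deg ?O b \<le> D \<or> mode_deg ?A b = 2 \<and> mode_deg ?O b = 0"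
      using a b pos by (auto simp: overset_def)
    then show ?thesis using deg[of ?A] deg[of ?O] pos(3)
      by (elim disjE conjE) linarith+
  qed
  ultimately show ?thesis by (simp add: overset_def)
qed

text \<open>The degree in \<open>M\<close> of a diagonal monomial is even, so the linear kind is
  excluded. A number operator outside \<open>M\<close> is of the constant kind with degree 2, hence
  the demand \<open>1 \<le> D\<close>.\<close>

lemma overset_diag:
  assumes "valid_mon n m" "fst m = snd m" "mdeg n m \<le> 2" "1 \<le> D"
  shows "m \<in> overset n M D"
proof -
  have "mode_deg ({..<n} \<inter> M) m = 2 * (\<Sum>k\<in>{..<n} \<inter> M. fst m k)"
    using assms(2) by (simp add: mode_deg_def sum.distrib mult_2)
  then have "mode_deg ({..<n} \<inter> M) m \<noteq> 1" by presburger
  moreover have "mode_deg ({..<n} \<inter> M) m + mode_deg ({..<n} - M) m \<le> 2"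
    using assms(3) mdeg_split[of n m M] by simp
  ultimately have "mode_deg ({..<n} \<inter> M) m = 0 \<and> mode_deg ({..<n} - M) m \<le> 2 * D
     \<or> mode_deg ({..<n} \<inter> M) m = 2 \<and> mode_deg ({..<n} - M) m = 0"
    using assms(4) by linarith
  then show ?thesis using assms(1,2) by (auto simp: overset_def)
qed

lemma fin_dim_bounded_support:
  assumes "finite L"
  shows "fin_dim {x. wsupp x \<subseteq> L}"
proof -
  let ?B = "Defs.mono ` L \<union> (\<lambda>m m'. \<i> * Defs.mono m m') ` L"
  have "x \<in> rspan ?B" if x: "wsupp x \<subseteq> L" for x
  proof -
    have "(\<lambda>m'. \<Sum>m\<in>L. complex_of_real (Re (x m)) * Defs.mono m m' + complex_of_real (Im (x m)) * (\<i> * Defs.mono m m')) \<in> rspan ?B"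
      by (intro rspan_sum rspan_add rspan_scale rspan_base) auto
    moreover have "(\<Sum>m\<in>L. complex_of_real (Re (x m)) * Defs.mono m m' + complex_of_real (Im (x m)) * (\<i> * Defs.mono m m')) = x m'" for m'
    proof -
      have "(\<Sum>m\<in>L. complex_of_real (Re (x m)) * Defs.mono m m' + complex_of_real (Im (x m)) * (\<i> * Defs.mono m m'))
         = (\<Sum>m\<in>L. if m = m' then x m' else 0)"
        by (intro sum.cong refl) (auto simp: Defs.mono_def complex_eq_iff)
      also have "\<dots> = x m'" using assms x by (auto simp: sum.delta wsupp_def)
      finally show ?thesis .
    qed
    ultimately show ?thesis by simp
  qed
  then show ?thesis unfolding fin_dim_def using assms by (intro exI[of _ ?B]) auto
qed

lemma fin_dim_subset: "fin_dim T \<Longrightarrow> S \<subseteq> T \<Longrightarrow> fin_dim S"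
  by (auto simp: fin_dim_def)

lemma lie_gen_fin_dim:
  assumes "\<And>x. x \<in> G \<Longrightarrow> wsupp x \<subseteq> overset n M D"
  shows "fin_dim (lie_gen n G)"
proof (rule fin_dim_subset[OF fin_dim_bounded_support[OF finite_overset]])
  show "lie_gen n G \<subseteq> {x. wsupp x \<subseteq> overset n M D}"
  proof (rule lie_gen_least)
    show "G \<subseteq> {x. wsupp x \<subseteq> overset n M D}" using assms by blast
    have "wsupp (\<lambda>m. x m + y m) \<subseteq> wsupp x \<union> wsupp y" "wsupp (\<lambda>m. complex_of_real c * x m) \<subseteq> wsupp x" for x y c
      by (auto simp: wsupp_def)
    moreover have "wsupp (\<lambda>m. 0) = {}" by (simp add: wsupp_def)
    ultimately show "real_subspace {x. wsupp x \<subseteq> overset n M D}"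
      unfolding real_subspace_def by (simp, meson Un_subset_iff order_trans sup.bounded_iff)
    fix x y assume xy: "x \<in> {x. wsupp x \<subseteq> overset n M D}" "y \<in> {x. wsupp x \<subseteq> overset n M D}"
    have "m \<in> overset n M D" if "m \<in> wsupp (wbr n x y)" for m
    proof -
      have nz: "wbr n x y m \<noteq> 0" using that by (simp add: wsupp_def)
      have fin: "finite (wsupp x)" "finite (wsupp y)" using xy finite_overset finite_subset by blast+
      obtain a b where "a \<in> wsupp x" "b \<in> wsupp y" "bcoef n a b m \<noteq> 0"
        using nz fin by (rule wbr_nzE)
      then show ?thesis using xy bcoef_overset by blast
    qed
    then show "wbr n x y \<in> {x. wsupp x \<subseteq> overset n M D}" by blast
  qed
qed

section \<open>The criterion\<close>

locale generators =
  fixes n :: nat and R :: "'r set" and sg :: "'r \<Rightarrow> bool" and ga :: "'r \<Rightarrow> mon"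
    and G :: "welem set"
  assumes fin: "finite R"
    and basis: "\<And>p. p \<in> R \<Longrightarrow> is_basis_gamma n (sg p) (ga p)"
    and not1: "\<And>p. p \<in> R \<Longrightarrow> gsig (sg p) (ga p) \<notin> Asub n C1"
    and G: "G = inum ` {..<n} \<union> (\<lambda>p. gsig (sg p) (ga p)) ` R"
begin

abbreviation gen :: "'r \<Rightarrow> welem" where "gen p \<equiv> gsig (sg p) (ga p)"

lemma valid: "p \<in> R \<Longrightarrow> valid_mon n (ga p)"
  using basis by (simp add: is_basis_gamma_def)

lemma sign: "p \<in> R \<Longrightarrow> sg p \<or> fst (ga p) \<noteq> snd (ga p)"
  using basis[of p] lex_gt_neq by (auto simp: is_basis_gamma_def split: if_splits)

lemma gen_Asub: "p \<in> R \<Longrightarrow> gen p \<in> Asub n K \<longleftrightarrow> mclass n (ga p) = K"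
  by (rule gsig_Asub_iff[OF basis])

lemma not_C1: "p \<in> R \<Longrightarrow> mclass n (ga p) \<noteq> C1"
  using not1 gen_Asub by blast

lemma gen_in: "p \<in> R \<Longrightarrow> gen p \<in> G"
  by (auto simp: G)

lemma G_Asub:
  assumes "x \<in> G" "x \<in> Asub n K" "K \<noteq> C0"
  obtains p where "p \<in> R" "x = gen p" "mclass n (ga p) = K"
proof -
  have "x \<noteq> inum k" if "k < n" for k
  proof
    assume x: "x = inum k"
    have "mclass n (unit_vec k, unit_vec k) = C0"
      using that by (simp add: mclass_def mdeg_def unit_vec_def sum.distrib)
    moreover have "mclass n (unit_vec k, unit_vec k) = K"
      using assms(2) by (rule Asub_wsupp) (simp add: x wsupp_inum)
    ultimately show False using assms(3) by simp
  qed
  then obtain p where "p \<in> R" "x = gen p" using assms(1) by (auto simp: G)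
  then show ?thesis using that gen_Asub assms(2) by blast
qed

lemma G_in_weyl: "x \<in> G \<Longrightarrow> in_weyl n x"
  by (auto simp: G in_weyl_inum intro: in_weyl_gsig valid)

definition compatible :: bool where
  "compatible \<longleftrightarrow> (\<forall>p\<in>R. mclass n (ga p) \<noteq> Cperp) \<and>
     (\<forall>p\<in>R. \<forall>q\<in>R. mclass n (ga q) \<in> {Ceq, Com} \<longrightarrow> \<not> clash n (ga p) (ga q))"

lemma fin_dim_imp_compatible:
  assumes "fin_dim (lie_gen n G)"
  shows compatible
proof -
  let ?S = "lie_gen n G"
  interpret weyl_lie n ?S
  proof
    show "real_subspace ?S" by (rule real_subspace_lie_gen)
    show "wbr n x y \<in> ?S" if "x \<in> ?S" "y \<in> ?S" for x y using that by (rule wbr_lie_gen)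
    show "in_weyl n x" if "x \<in> ?S" for x using G_in_weyl that by (rule lie_gen_in_weyl)
    show "inum k \<in> ?S" if "k < n" for k using lie_gen_superset[of G n] that by (auto simp: G)
  qed
  have gS: "gen p \<in> ?S" if "p \<in> R" for p using gen_in[OF that] lie_gen_superset by blast
  have "mclass n (ga p) \<noteq> Cperp" if p: "p \<in> R" for p
  proof
    assume "mclass n (ga p) = Cperp"
    note c = mclass_Cperp[OF valid[OF p] this]
    obtain k where k: "k < n" "fst (ga p) k \<noteq> snd (ga p) k" using ne_modeE[OF valid[OF p] c(1)] .
    from perp_not_fin_dim[OF valid[OF p] c both_signs[OF gS[OF p] k]] assms show False by simp
  qed
  moreover have "\<not> clash n (ga p) (ga q)" if "p \<in> R" "q \<in> R" "mclass n (ga q) \<in> {Ceq, Com}" for p q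
    using clash_not_fin_dim[OF valid[OF that(1)] gS[OF that(1)] valid[OF that(2)] gS[OF that(2)] sign[OF that(2)]]
      that(3) assms by blast
  ultimately show ?thesis by (simp add: compatible_def)
qed

lemma compatible_imp_fin_dim:
  assumes compatible
  shows "fin_dim (lie_gen n G)"
proof -
  define M where "M = {k. \<exists>p\<in>R. fst (ga p) k \<noteq> snd (ga p) k}"
  \<comment> \<open>The sum bounds the degree of every generator, and the 1 makes room for the
    number operators.\<close>
  define D where "D = 1 + (\<Sum>p\<in>R. mdeg n (ga p))"
  let ?A = "{..<n} \<inter> M" and ?O = "{..<n} - M"
  have perp: "mclass n (ga p) \<noteq> Cperp" if "p \<in> R" for p
    using assms that by (simp add: compatible_def)
  have nc: "fst (ga q) k = 0" if "q \<in> R" "mclass n (ga q) = Ceq \<or> mclass n (ga q) = Com" "k \<in> ?A" "fst (ga q) k = snd (ga q) k" for q k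
  proof -
    obtain p where p: "p \<in> R" "fst (ga p) k \<noteq> snd (ga p) k" using \<open>k \<in> ?A\<close> by (auto simp: M_def)
    have "\<not> clash n (ga p) (ga q)" using assms p that(1,2) by (auto simp: compatible_def)
    then show ?thesis using clashD[of n "ga p" "ga q" k] p(2) that(3,4) by auto
  qed
  have D1: "1 \<le> D" by (simp add: D_def)
  have ga: "ga q \<in> overset n M D" if q: "q \<in> R" for q
  proof -
    have v: "valid_mon n (ga q)" by (rule valid[OF q])
    have off: "\<forall>k. k \<notin> M \<longrightarrow> fst (ga q) k = snd (ga q) k" using q by (auto simp: M_def)
    have dO: "mode_deg ?O (ga q) \<le> D"
      using mdeg_split[of n "ga q" M] member_le_sum[OF q, of "\<lambda>p. mdeg n (ga p)"] fin by (simp add: D_def)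
    consider "mclass n (ga q) = C0" | "mclass n (ga q) = C2" | "mclass n (ga q) = Ceq" | "mclass n (ga q) = Com"
      using perp[OF q] not_C1[OF q] by (cases "mclass n (ga q)") auto
    then show ?thesis
    proof cases
      case 1
      then show ?thesis using mclass_C0[OF 1] by (intro overset_diag v D1) auto
    next
      case 2
      note c = mclass_C2[OF 2]
      have "mode_deg ?O (ga q) = 0"
        unfolding mode_deg_def
      proof (intro sum.neutral ballI)
        fix k assume k: "k \<in> ?O"
        then have "fst (ga q) k = snd (ga q) k" "k < n" using off by auto
        then show "fst (ga q) k + snd (ga q) k = 0" using quadratic_diag_mode[OF v, of k] c by auto
      qed
      then show ?thesis using v off c mdeg_split[of n "ga q" M] by (simp add: overset_def)
    next
      case 3
      have "mode_deg ?A (ga q) = 0"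
        unfolding mode_deg_def
        by (intro sum.neutral ballI) (use nc[OF q] 3 mclass_Ceq[OF 3] in auto)
      then show ?thesis using v off dO by (simp add: overset_def)
    next
      case 4
      obtain i where i: "i < n" "fst (ga q) i + snd (ga q) i = 1" "\<And>k. k < n \<Longrightarrow> k \<noteq> i \<Longrightarrow> fst (ga q) k = snd (ga q) k"
        using 4[unfolded mclass_Com] by (rule is_omE) blast
      have iM: "i \<in> ?A"
      proof -
        have "fst (ga q) i \<noteq> snd (ga q) i" using i(2) by presburger
        then show ?thesis using i(1) q by (auto simp: M_def)
      qed
      have "mode_deg ?A (ga q) = (fst (ga q) i + snd (ga q) i) + (\<Sum>k\<in>?A-{i}. fst (ga q) k + snd (ga q) k)"
        unfolding mode_deg_def using iM by (subst sum.remove[of _ i]) auto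
      also have "(\<Sum>k\<in>?A-{i}. fst (ga q) k + snd (ga q) k) = 0"
      proof (intro sum.neutral ballI)
        fix k assume k: "k \<in> ?A - {i}"
        then have "fst (ga q) k = snd (ga q) k" using i(3) by auto
        moreover then have "fst (ga q) k = 0" using nc[OF q] 4 k by auto
        ultimately show "fst (ga q) k + snd (ga q) k = 0" by simp
      qed
      finally have "mode_deg ?A (ga q) = 1" using i(2) by simp
      then show ?thesis using v off dO by (simp add: overset_def)
    qed
  qed
  show ?thesis
  proof (rule lie_gen_fin_dim)
    fix x assume "x \<in> G"
    then consider k where "k < n" "x = inum k" | p where "p \<in> R" "x = gen p" by (auto simp: G)
    then show "wsupp x \<subseteq> overset n M D"
    proof cases
      case 1
      have "mdeg n (unit_vec k, unit_vec k) = 2"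
        using 1 by (simp add: mdeg_def unit_vec_def sum.distrib)
      then show ?thesis unfolding 1 wsupp_inum using valid_mon_unit[OF 1(1)] D1
        by (auto intro!: overset_diag)
    next
      case 2
      have "{ga p, swapm (ga p)} \<subseteq> overset n M D" using ga[OF 2(1)] by simp
      then show ?thesis unfolding 2 using wsupp_gsig by (rule order_trans[rotated])
    qed
  qed
qed

section \<open>The four conditions and compatibility\<close>

abbreviation conditions :: bool where
  "conditions \<equiv> G \<inter> Asub n Cperp = {}
            \<and> G \<inter> Asub n Ceq \<subseteq> centr n G
            \<and> (\<forall>x\<in>G \<inter> Asub n C2. \<forall>y\<in>G \<inter> Asub n Com. wbr n x y \<in> Asub n Com)
            \<and> (\<forall>x\<in>G \<inter> Asub n Com. \<forall>y\<in>G \<inter> Asub n Com. wproj n Cperp (wbr n x y) = (\<lambda>m. 0))"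

lemma conditions_imp_compatible:
  assumes c: conditions
  shows compatible
proof -
  have perp: "mclass n (ga p) \<noteq> Cperp" if "p \<in> R" for p
    using c gen_in[OF that] gen_Asub[OF that] by blast
  have "\<not> clash n (ga p) (ga q)" if p: "p \<in> R" and q: "q \<in> R" and cq: "mclass n (ga q) \<in> {Ceq, Com}" for p q
  proof
    assume clash: "clash n (ga p) (ga q)"
    then have ne: "fst (ga p) \<noteq> snd (ga p)" by (auto simp: clash_def)
    \<comment> \<open>The exclusion of degree one enters here: what remains for an off-diagonal
      generator are the two classes tested by (iii) and (iv).\<close>
    then have cp: "mclass n (ga p) = C2 \<or> mclass n (ga p) = Com"
      using perp[OF p] not_C1[OF p] mclass_C0[of n "ga p"] mclass_Ceq[of n "ga p"]
      by (cases "mclass n (ga p)") auto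
    show False
    proof (cases "mclass n (ga q) = Ceq")
      case True
      note d = conjunct1[OF mclass_Ceq[OF True]]
      have "gen q \<in> centr n G" using c gen_in[OF q] gen_Asub[OF q] True by blast
      then have "wbr n (gen q) (gen p) = (\<lambda>m. 0)" using gen_in[OF p] by (simp add: centr_def)
      moreover have "sg q" using sign[OF q] d by simp
      ultimately show False using clash_diag_wbr[OF clash d] by (metis (full_types))
    next
      case False
      then have cq': "mclass n (ga q) = Com" using cq by simp
      have "2 \<le> mdeg n (ga p)"
        using cp
      proof
        assume "mclass n (ga p) = C2" then show ?thesis using mclass_C2 by simp
      next
        assume "mclass n (ga p) = Com" then show ?thesis unfolding mclass_Com by (rule is_omE) simp
      qed
      then obtain m where m: "mclass n m = Cperp" "wbr n (gen p) (gen q) m \<noteq> 0"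
        using clash_om_wbr_Cperp[OF _ cq'[unfolded mclass_Com] clash] by blast
      have y: "gen q \<in> G \<inter> Asub n Com" using gen_in[OF q] gen_Asub[OF q] cq' by simp
      from cp show False
      proof
        assume "mclass n (ga p) = C2"
        then have "gen p \<in> G \<inter> Asub n C2" using gen_in[OF p] gen_Asub[OF p] by simp
        then have "wbr n (gen p) (gen q) \<in> Asub n Com" using c y by blast
        then have "mclass n m = Com" by (rule Asub_wsupp) (simp add: wsupp_def m)
        then show False using m(1) by simp
      next
        assume "mclass n (ga p) = Com"
        then have "gen p \<in> G \<inter> Asub n Com" using gen_in[OF p] gen_Asub[OF p] by simp
        then have "wproj n Cperp (wbr n (gen p) (gen q)) = (\<lambda>m. 0)" using c y by blast
        then have "wproj n Cperp (wbr n (gen p) (gen q)) m = 0" by simp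
        then show False using m by (simp add: wproj_def)
      qed
    qed
  qed
  with perp show ?thesis by (simp add: compatible_def)
qed

lemma compatible_imp_conditions:
  assumes c: compatible
  shows conditions
proof (intro conjI)
  have perp: "mclass n (ga p) \<noteq> Cperp" if "p \<in> R" for p
    using c that by (simp add: compatible_def)
  have nc: "\<not> clash n (ga p) (ga q)" if "p \<in> R" "q \<in> R" "mclass n (ga q) = Ceq \<or> mclass n (ga q) = Com" for p q
    using c that by (auto simp: compatible_def)
  have in2: "a = ga p \<or> a = swapm (ga p)" if "a \<in> wsupp (gen p)" for a p
    using that wsupp_gsig[of "sg p" "ga p"] by auto
  show "G \<inter> Asub n Cperp = {}"
  proof (rule ccontr)
    assume "\<not> ?thesis"
    then obtain x where "x \<in> G" "x \<in> Asub n Cperp" by blast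
    then obtain p where "p \<in> R" "mclass n (ga p) = Cperp" by (rule G_Asub) auto
    then show False using perp by blast
  qed
  show "G \<inter> Asub n Ceq \<subseteq> centr n G"
  proof
    fix x assume "x \<in> G \<inter> Asub n Ceq"
    then have x: "x \<in> G" "x \<in> Asub n Ceq" by auto
    obtain q where q: "q \<in> R" "x = gen q" "mclass n (ga q) = Ceq" using x by (rule G_Asub) auto
    note d = conjunct1[OF mclass_Ceq[OF q(3)]]
    have "wbr n x y m = 0" if y: "y \<in> G" for y m
    proof (rule ccontr)
      assume nz: "wbr n x y m \<noteq> 0"
      have fin: "finite (wsupp x)" "finite (wsupp y)" using G_in_weyl x(1) y by (auto simp: in_weyl_def)
      obtain a b where ab: "a \<in> wsupp x" "b \<in> wsupp y" "bcoef n a b m \<noteq> 0" using nz fin by (rule wbr_nzE)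
      have a: "a = ga q" using ab(1) in2[of a q] d unfolding q(2) by (auto simp: swapm_eq_iff[THEN iffD2])
      \<comment> \<open>The contracted mode occurs in the diagonal monomial \<open>a\<close>, so
        \<open>b\<close> is unbalanced there. A number operator is balanced everywhere, and any
        other generator would clash with \<open>x\<close>.\<close>
      obtain j k where jk: "j k \<le> max (fst a k) (snd a k)" "(0::nat) < j k" "\<not> (fst a k = snd a k \<and> fst b k = snd b k)"
        using ab(3) by (rule bcoef_nzE) blast
      have bk: "fst b k \<noteq> snd b k" using jk(3) a d by simp
      have ak: "fst (ga q) k = snd (ga q) k" "0 < fst (ga q) k" using jk(1,2) a d by auto
      have kn: "k < n" using valid[OF q(1)] ak(2) by (cases "k < n") (auto simp: valid_mon_def)
      from y consider l where "l < n" "y = inum l" | p where "p \<in> R" "y = gen p" by (auto simp: G)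
      then show False
      proof cases
        case 1
        then show False using ab(2) bk by (simp add: wsupp_inum)
      next
        case 2
        then have "fst (ga p) k \<noteq> snd (ga p) k" using bk in2[of b p] ab(2) by auto
        then show False using clashD[OF nc[OF 2(1) q(1)] kn _ ak(1)] q(3) ak(2) by simp
      qed
    qed
    then show "x \<in> centr n G" using x by (auto simp: centr_def)
  qed
  show "\<forall>x\<in>G \<inter> Asub n C2. \<forall>y\<in>G \<inter> Asub n Com. wbr n x y \<in> Asub n Com"
  proof (intro ballI)
    fix x y assume "x \<in> G \<inter> Asub n C2" "y \<in> G \<inter> Asub n Com"
    then have x: "x \<in> G" "x \<in> Asub n C2" and y: "y \<in> G" "y \<in> Asub n Com" by auto
    obtain p where p: "p \<in> R" "x = gen p" "mclass n (ga p) = C2" using x by (rule G_Asub) auto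
    obtain q where q: "q \<in> R" "y = gen q" "mclass n (ga q) = Com" using y by (rule G_Asub) auto
    have fin: "finite (wsupp x)" "finite (wsupp y)" using p q by auto
    show "wbr n x y \<in> Asub n Com"
    \<comment> \<open>Membership asks for real coefficients in the basis elements, so
      skew-hermiticity of the bracket is required besides the class of its monomials.\<close>
    proof (rule Ahat_AsubI)
      show "wbr n x y \<in> Ahat n" unfolding p(2) q(2) by (intro wbr_Ahat gsig_Ahat valid p q)
      fix m assume "m \<in> wsupp (wbr n x y)"
      then have nz: "wbr n x y m \<noteq> 0" by (simp add: wsupp_def)
      obtain a b where ab: "a \<in> wsupp x" "b \<in> wsupp y" "bcoef n a b m \<noteq> 0" using nz fin by (rule wbr_nzE)
      have a: "a = ga p \<or> a = swapm (ga p)" and b: "b = ga q \<or> b = swapm (ga q)"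
        using ab(1,2) in2 unfolding p(2) q(2) by auto
      have "valid_mon n a" "valid_mon n b" using a b valid p(1) q(1) by auto
      moreover have "mclass n a = C2" using a p(3) by auto
      moreover have "mclass n b = Com" using b q(3) by auto
      moreover have "\<not> clash n a b" using nc[OF p(1) q(1)] q(3) a b by auto
      ultimately show "mclass n m = Com"
        using bcoef_C2_om[OF _ _ _ _ _ _ ab(3)] mclass_C2[of n a] by (auto simp: mclass_Com)
    qed
  qed
  show "\<forall>x\<in>G \<inter> Asub n Com. \<forall>y\<in>G \<inter> Asub n Com. wproj n Cperp (wbr n x y) = (\<lambda>m. 0)"
  proof (intro ballI)
    fix x y assume "x \<in> G \<inter> Asub n Com" "y \<in> G \<inter> Asub n Com"
    then have x: "x \<in> G" "x \<in> Asub n Com" and y: "y \<in> G" "y \<in> Asub n Com" by auto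
    obtain p where p: "p \<in> R" "x = gen p" "mclass n (ga p) = Com" using x by (rule G_Asub) auto
    obtain q where q: "q \<in> R" "y = gen q" "mclass n (ga q) = Com" using y by (rule G_Asub) auto
    have fin: "finite (wsupp x)" "finite (wsupp y)" using p q by auto
    have "wbr n x y m = 0" if perp: "mclass n m = Cperp" for m
    proof (rule ccontr)
      assume nz: "wbr n x y m \<noteq> 0"
      obtain a b where ab: "a \<in> wsupp x" "b \<in> wsupp y" "bcoef n a b m \<noteq> 0" using nz fin by (rule wbr_nzE)
      have a: "a = ga p \<or> a = swapm (ga p)" and b: "b = ga q \<or> b = swapm (ga q)"
        using ab(1,2) in2 unfolding p(2) q(2) by auto
      have "valid_mon n a" "valid_mon n b" using a b valid p(1) q(1) by auto
      moreover have "mclass n a = Com" using a p(3) by auto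
      moreover have "mclass n b = Com" using b q(3) by auto
      moreover have "\<not> clash n a b" "\<not> clash n b a" using nc[OF p(1) q(1)] nc[OF q(1) p(1)] p(3) q(3) a b by auto
      ultimately have "fst m = snd m"
        using bcoef_om_om[OF _ _ _ _ _ _ ab(3)] by (simp add: mclass_Com)
      then show False using mclass_diag[of m n] perp by auto
    qed
    then show "wproj n Cperp (wbr n x y) = (\<lambda>m. 0)" by (auto simp: wproj_def)
  qed
qed

end

theorem theorem5:
  fixes n :: nat and R :: "'r set" and sg :: "'r \<Rightarrow> bool" and ga :: "'r \<Rightarrow> mon"
    and G :: "welem set"
  assumes n: "n \<ge> 1"
    and R: "finite R"
    and basis: "\<And>p. p \<in> R \<Longrightarrow> is_basis_gamma n (sg p) (ga p)"
    and not1: "\<And>p. p \<in> R \<Longrightarrow> gsig (sg p) (ga p) \<notin> Asub n C1"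
    and G: "G = inum ` {..<n} \<union> (\<lambda>p. gsig (sg p) (ga p)) ` R"
  shows "fin_dim (lie_gen n G) \<longleftrightarrow>
           (G \<inter> Asub n Cperp = {}
            \<and> G \<inter> Asub n Ceq \<subseteq> centr n G
            \<and> (\<forall>x\<in>G \<inter> Asub n C2. \<forall>y\<in>G \<inter> Asub n Com. wbr n x y \<in> Asub n Com)
            \<and> (\<forall>x\<in>G \<inter> Asub n Com. \<forall>y\<in>G \<inter> Asub n Com. wproj n Cperp (wbr n x y) = (\<lambda>m. 0)))"
proof -
  interpret generators n R sg ga G
    using R basis not1 G by unfold_locales
  show ?thesis
    by (rule iffI[OF compatible_imp_conditions[OF fin_dim_imp_compatible]
          compatible_imp_fin_dim[OF conditions_imp_compatible]])
qed

end
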